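(* Let $\{G_N\}_{N\ge1}$ be a sequence of simple graphs, $G_N$ having vertex set $\{1,\dots,N\}$ and adjacency matrix $A(G_N)$, which converges to a graphon $W$ with $\int_{[0,1]^2}W(x,y)\,dx\,dy>0$. Consider the Ising model $\mathbb{P}_\beta$ with $J_N=\frac1NA(G_N)$, i.e. with sufficient statistic $H_N(\tau)=\frac1N\tau'A(G_N)\tau$, and a single observation $\sigma\in S_N$ from it. (a) If $0\le\beta_1<\beta_2<\frac{1}{\|W\|}$, then there does not exist a sequence of consistent tests for $H_0:\beta=\beta_1$ versus $H_1:\beta=\beta_2$. (b) If $\beta_0>\frac1{\|W\|}$, then the maximum pseudolikelihood estimators $\{\hat\beta_N\}_{N\ge1}$ are $\sqrt N$-consistent at $\beta=\beta_0$.
   Context: Graph limits: a graphon is a measurable $W:[0,1]^2\to[0,1]$ with $W(x,y)=W(y,x)$. For a finite simple graph $H$, $t(H,W)=\int_{[0,1]^{|V(H)|}}\prod_{(i,j)\in E(H)}W(x_i,x_j)\,dx_1\cdots dx_{|V(H)|}$, and $t(H,G_N)=t(H,W_{G_N})$ where $W_{G_N}(x,y)=1$ if $(\lceil Nx\rceil,\lceil Ny\rceil)$ is an edge of $G_N$ and $0$ otherwise. $G_N$ converges to $W$ if $t(H,G_N)\to t(H,W)$ for every finite simple graph $H$ (equivalently, convergence in cut-metric). $\|W\|$ is the operator norm of $T_W:L_2[0,1]\to L_2[0,1]$, $(T_Wf)(x)=\int_0^1W(x,y)f(y)\,dy$. Ising model: $S_N=\{-1,1\}^N$, $H_N(\tau)=\tau'J_N\tau$,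 and for $\beta\ge0$, $$\mathbb{P}_\beta(\sigma=\tau)=2^{-N}\exp\{\tfrac12\beta H_N(\tau)-F_N(\beta)\},\qquad F_N(\beta)=\log\Big\{2^{-N}\sum_{\tau\in S_N}e^{\frac12\beta H_N(\tau)}\Big\}.$$ A sequence of test functions $\phi_N:S_N\to\{0,1\}$ is consistent for $\beta=\beta_1$ versus $\beta=\beta_2$ if $\mathbb{E}_{\beta_1}\phi_N\to0$ and $\mathbb{E}_{\beta_2}\phi_N\to1$. MPLE: with $m_i(\tau)=\sum_jJ_N(i,j)\tau_j$ and $L_\tau(x)=\frac1N\sum_{i=1}^Nm_i(\tau)(\tau_i-\tanh(x\,m_i(\tau)))$ (nonincreasing in $x\ge 0$; it is $\frac1N$ times the derivative of the log-pseudolikelihood), $\hat\beta_N=\inf\{x\ge0:L_\sigma(x)=0\}$, with the conventions $\hat\beta_N=0$ if $L_\sigma(0)<0$ and $\hat\beta_N=\infty$ if $L_\sigma(x)>0$ for all $x\ge0$. It is $b_N$-consistent at $\beta_0$ if $\limsup_{K\to\infty}\limsup_{N\to\infty}\mathbb{P}_{\beta_0}(b_N|\hat\beta_N-\beta_0|>K)=0$. *)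

theory Defs
  imports "HOL-Probability.Probability"
begin

section \<open>Graphs and graphons\<close>

definition simple_graph :: "'a set \<Rightarrow> 'a set set \<Rightarrow> bool" where
  "simple_graph V E \<longleftrightarrow> finite V \<and> (\<forall>e\<in>E. e \<subseteq> V \<and> card e = 2)"

definition adjacency :: "'a set set \<Rightarrow> 'a \<Rightarrow> 'a \<Rightarrow> real" where
  "adjacency E i j = of_bool ({i, j} \<in> E)"

text \<open>Measurability is Lebesgue measurability; Borel graphons are included.\<close>

definition graphon :: "(real \<Rightarrow> real \<Rightarrow> real) \<Rightarrow> bool" where
  "graphon W \<longleftrightarrow>
     (\<lambda>(x, y). W x y) \<in> borel_measurable (lebesgue_on ({0..1} \<times> {0..1})) \<and>
     (\<forall>x\<in>{0..1}. \<forall>y\<in>{0..1}. 0 \<le> W x y \<and> W x y \<le> 1 \<and> W x y = W y x)"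

text \<open>
  The integral is with respect to Lebesgue measure on the cube of functions from \<open>V\<close> to \<open>[0, 1]\<close>.
  The completion is needed because the integrand is only Lebesgue measurable, and the Bochner
  integral of a non-measurable function is 0 by convention.  Each edge contributes one factor; as
  the kernels used are symmetric on the unit square, ordering its endpoints by \<open>Min\<close> and \<open>Max\<close> is
  immaterial.
\<close>

definition hom_density ::
    "'a::linorder set \<Rightarrow> 'a set set \<Rightarrow> (real \<Rightarrow> real \<Rightarrow> real) \<Rightarrow> real" where
  "hom_density V E W =
     (LINT x | completion (Pi\<^sub>M V (\<lambda>_. restrict_space lborel {0..1})).
        (\<Prod>e\<in>E. W (x (Min e)) (x (Max e))))"

text \<open>The kernel of a graph with vertex set \<open>{1..N}\<close>; 0 is not a vertex, so it vanishes on the axes.\<close>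

definition graph_kernel :: "nat \<Rightarrow> nat set set \<Rightarrow> real \<Rightarrow> real \<Rightarrow> real" where
  "graph_kernel N E x y = adjacency E (nat \<lceil>real N * x\<rceil>) (nat \<lceil>real N * y\<rceil>)"

text \<open>Every finite simple graph is isomorphic to one whose vertices are natural numbers.\<close>

definition converges_to_graphon :: "(nat \<Rightarrow> nat set set) \<Rightarrow> (real \<Rightarrow> real \<Rightarrow> real) \<Rightarrow> bool" where
  "converges_to_graphon G W \<longleftrightarrow>
     (\<forall>(V :: nat set) E. simple_graph V E \<longrightarrow>
        (\<lambda>N. hom_density V E (graph_kernel N (G N))) \<longlonglongrightarrow> hom_density V E W)"

definition square_integrable :: "(real \<Rightarrow> real) \<Rightarrow> bool" where
  "square_integrable f \<longleftrightarrow>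
     f \<in> borel_measurable (lebesgue_on {0..1}) \<and> integrable (lebesgue_on {0..1}) (\<lambda>x. (f x)\<^sup>2)"

definition L2_norm_unit :: "(real \<Rightarrow> real) \<Rightarrow> real" where
  "L2_norm_unit f = sqrt (LINT x | lebesgue_on {0..1}. (f x)\<^sup>2)"

definition graphon_operator :: "(real \<Rightarrow> real \<Rightarrow> real) \<Rightarrow> (real \<Rightarrow> real) \<Rightarrow> real \<Rightarrow> real" where
  "graphon_operator W f x = (LINT y | lebesgue_on {0..1}. W x y * f y)"

text \<open>
  The operator norm on \<open>L\<^sub>2[0, 1]\<close>, with elements of \<open>L\<^sub>2\<close> given by representatives.
  For a graphon the supremum is over a set bounded by 1.
\<close>

definition graphon_norm :: "(real \<Rightarrow> real \<Rightarrow> real) \<Rightarrow> real" where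
  "graphon_norm W =
     Sup {L2_norm_unit (graphon_operator W f) | f. square_integrable f \<and> L2_norm_unit f \<le> 1}"


section \<open>Ising models\<close>

definition spins :: "nat \<Rightarrow> (nat \<Rightarrow> real) set" where
  "spins N = {1..N} \<rightarrow>\<^sub>E {-1, 1}"

definition hamiltonian :: "nat \<Rightarrow> (nat \<Rightarrow> nat \<Rightarrow> real) \<Rightarrow> (nat \<Rightarrow> real) \<Rightarrow> real" where
  "hamiltonian N J \<tau> = (\<Sum>i\<in>{1..N}. \<Sum>j\<in>{1..N}. \<tau> i * J i j * \<tau> j)"

definition log_partition :: "nat \<Rightarrow> (nat \<Rightarrow> nat \<Rightarrow> real) \<Rightarrow> real \<Rightarrow> real" where
  "log_partition N J \<beta> = ln (1 / 2 ^ N * (\<Sum>\<tau>\<in>spins N. exp (\<beta> / 2 * hamiltonian N J \<tau>)))"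

definition ising :: "nat \<Rightarrow> (nat \<Rightarrow> nat \<Rightarrow> real) \<Rightarrow> real \<Rightarrow> (nat \<Rightarrow> real) measure" where
  "ising N J \<beta> = point_measure (spins N)
     (\<lambda>\<tau>. ennreal (1 / 2 ^ N * exp (\<beta> / 2 * hamiltonian N J \<tau> - log_partition N J \<beta>)))"

definition consistent_tests ::
    "(nat \<Rightarrow> nat \<Rightarrow> nat \<Rightarrow> real) \<Rightarrow> real \<Rightarrow> real \<Rightarrow> (nat \<Rightarrow> (nat \<Rightarrow> real) \<Rightarrow> real) \<Rightarrow> bool" where
  "consistent_tests J \<beta>\<^sub>1 \<beta>\<^sub>2 \<phi> \<longleftrightarrow>
     (\<forall>N\<ge>1. \<forall>\<tau>\<in>spins N. \<phi> N \<tau> \<in> {0, 1}) \<and>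
     (\<lambda>N. LINT \<tau> | ising N (J N) \<beta>\<^sub>1. \<phi> N \<tau>) \<longlonglongrightarrow> 0 \<and>
     (\<lambda>N. LINT \<tau> | ising N (J N) \<beta>\<^sub>2. \<phi> N \<tau>) \<longlonglongrightarrow> 1"


section \<open>Maximum pseudolikelihood estimation\<close>

definition local_field :: "nat \<Rightarrow> (nat \<Rightarrow> nat \<Rightarrow> real) \<Rightarrow> (nat \<Rightarrow> real) \<Rightarrow> nat \<Rightarrow> real" where
  "local_field N J \<tau> i = (\<Sum>j\<in>{1..N}. J i j * \<tau> j)"

definition pseudo_score :: "nat \<Rightarrow> (nat \<Rightarrow> nat \<Rightarrow> real) \<Rightarrow> (nat \<Rightarrow> real) \<Rightarrow> real \<Rightarrow> real" where
  "pseudo_score N J \<tau> x =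
     1 / real N * (\<Sum>i\<in>{1..N}. local_field N J \<tau> i * (\<tau> i - tanh (x * local_field N J \<tau> i)))"

text \<open>
  The score is continuous and nonincreasing in \<open>x \<ge> 0\<close>, so in the third case the set of zeros is
  nonempty.
\<close>

definition mple :: "nat \<Rightarrow> (nat \<Rightarrow> nat \<Rightarrow> real) \<Rightarrow> (nat \<Rightarrow> real) \<Rightarrow> ereal" where
  "mple N J \<tau> =
     (if pseudo_score N J \<tau> 0 < 0 then 0
      else if \<forall>x\<ge>0. pseudo_score N J \<tau> x > 0 then \<infinity>
      else ereal (Inf {x. 0 \<le> x \<and> pseudo_score N J \<tau> x = 0}))"

definition mple_consistent ::
    "(nat \<Rightarrow> real) \<Rightarrow> (nat \<Rightarrow> nat \<Rightarrow> nat \<Rightarrow> real) \<Rightarrow> real \<Rightarrow> bool" where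
  "mple_consistent b J \<beta>\<^sub>0 \<longleftrightarrow>
     Limsup at_top (\<lambda>K :: real. limsup (\<lambda>N. ereal (measure (ising N (J N) \<beta>\<^sub>0)
       {\<sigma> \<in> spins N. ereal (b N) * \<bar>mple N (J N) \<sigma> - ereal \<beta>\<^sub>0\<bar> > ereal K}))) = 0"

end

theory Submission
  imports Defs "HOL-Real_Asymp.Real_Asymp"
begin

text \<open>
  Only path densities are needed.  Let \<open>p\<^sub>n\<close> be the homomorphism density of the path with \<open>n\<close> edges,
  that is \<open>\<langle>1, T\<^sub>W\<^sup>n 1\<rangle>\<close> for \<open>W\<close> and \<open>N\<^sup>-\<^sup>1 \<langle>1, J\<^sub>N\<^sup>n 1\<rangle>\<close> for \<open>G\<^sub>N\<close>.  It satisfies \<open>p\<^sub>n \<le> \<parallel>W\<parallel>\<^sup>n\<close>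
  and \<open>p\<^sub>2\<^sub>k \<ge> l\<^sup>2\<^sup>k\<^sup>+\<^sup>2\<close> for every \<open>l < \<parallel>W\<parallel>\<close>, so the growth of \<open>\<beta>\<^sup>n p\<^sub>n\<close> detects on which side of
  \<open>1 / \<parallel>W\<parallel>\<close> the parameter \<open>\<beta>\<close> lies.

  Below the threshold, some \<open>\<beta>\<^sup>m\<^sup>+\<^sup>1 p\<^sub>m\<close> is less than 1.  As the entries of \<open>J\<^sub>N\<close> are at most \<open>1 / N\<close>, this
  gives an explicit matrix \<open>R\<close> dominating \<open>(1 - \<beta> J\<^sub>N)\<^sup>-\<^sup>1\<close> whose trace exceeds \<open>N\<close> by a bounded amount.
  Comparison with a Gaussian then bounds the partition function, uniformly in \<open>N\<close>, on a
  neighbourhood of the tested parameters, and truncating the likelihood ratio excludes consistent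
  tests.

  Above the threshold, a bounded trial magnetisation built from \<open>J\<^sub>N\<^sup>k 1\<close> makes the mean-field lower
  bound for the log-partition function grow linearly in \<open>N\<close>.  Hence \<open>\<Sum>\<^sub>i m\<^sub>i\<^sup>2 \<ge> \<eta> N\<close> with probability
  tending to 1, so that the score has slope bounded away from 0, while its second moment at
  \<open>\<beta>\<^sub>0\<close> is of order \<open>1 / N\<close>.
\<close>

section \<open>Integral operators on the unit interval\<close>

abbreviation unit_lborel :: "real measure" where
  "unit_lborel \<equiv> restrict_space lborel {0..1}"

interpretation unit_lborel: prob_space unit_lborel
  by (rule prob_spaceI) (simp add: space_restrict_space emeasure_restrict_space)

interpretation unit_pair: pair_prob_space unit_lborel unit_lborel ..

interpretation unit_product: product_prob_space "\<lambda>_. unit_lborel" I for I :: "nat set" ..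

text \<open>A function that agrees almost everywhere with a measurable one is measurable for the
  completion, because sets that differ from measurable ones by a null set are. This moves integrals
  over \<open>lebesgue_on\<close> and over the completed cube to Borel measures, where Fubini is
  available.\<close>

lemma integral_completion_AE:
  fixes f g :: "'a \<Rightarrow> real"
  assumes f: "f \<in> borel_measurable M" and ae: "AE x in M. g x = f x"
  shows "g \<in> borel_measurable (completion M)" "integral\<^sup>L (completion M) g = integral\<^sup>L M f"
    "integrable (completion M) g \<longleftrightarrow> integrable M f"
proof -
  have ae': "AE x in completion M. g x = f x"
    using ae by (simp add: AE_completion)
  show g: "g \<in> borel_measurable (completion M)"
  proof (rule measurableI)
    fix A :: "real set" assume A: "A \<in> sets borel"
    have "f -` A \<inter> space (completion M) \<in> sets (completion M)"
      using f A by (auto intro: sets_completionI_sets measurable_sets)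
    moreover have "AE x in completion M. (x \<in> f -` A \<inter> space (completion M)) = (x \<in> g -` A \<inter> space (completion M))"
      using ae' by eventually_elim auto
    ultimately show "g -` A \<inter> space (completion M) \<in> sets (completion M)"
      by (auto intro: completion.in_sets_AE[rotated])
  qed auto
  have "integral\<^sup>L (completion M) g = integral\<^sup>L (completion M) f"
    using g f ae' by (intro integral_cong_AE) (auto intro: measurable_completion)
  then show "integral\<^sup>L (completion M) g = integral\<^sup>L M f"
    using f by (simp add: integral_completion)
  have "integrable (completion M) g \<longleftrightarrow> integrable (completion M) f"
    using g f ae' by (intro integrable_cong_AE) (auto intro: measurable_completion)
  then show "integrable (completion M) g \<longleftrightarrow> integrable M f"
    using f by (simp add: integrable_completion)
qed

lemma integral_lebesgue_on_AE:
  fixes f g :: "'a::euclidean_space \<Rightarrow> real"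
  assumes S: "S \<in> sets borel" and f: "f \<in> borel_measurable (restrict_space lborel S)"
    and ae: "AE x in restrict_space lborel S. g x = f x"
  shows "g \<in> borel_measurable (lebesgue_on S)"
    "integral\<^sup>L (lebesgue_on S) g = integral\<^sup>L (restrict_space lborel S) f"
    "integrable (lebesgue_on S) g \<longleftrightarrow> integrable (restrict_space lborel S) f"
proof -
  have f': "(\<lambda>x. indicator S x *\<^sub>R f x) \<in> borel_measurable lborel"
    using f S by (simp add: borel_measurable_restrict_space_iff)
  have ae': "AE x in lborel. indicator S x *\<^sub>R g x = indicator S x *\<^sub>R f x"
    using ae S by (subst (asm) AE_restrict_space_iff) (auto simp: indicator_def)
  have S': "S \<in> sets lebesgue" using S by simp
  show "g \<in> borel_measurable (lebesgue_on S)"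
    using integral_completion_AE(1)[OF f' ae'] S' by (subst borel_measurable_restrict_space_iff) auto
  show "integral\<^sup>L (lebesgue_on S) g = integral\<^sup>L (restrict_space lborel S) f"
    using integral_completion_AE(2)[OF f' ae'] S S' by (simp add: integral_restrict_space)
  show "integrable (lebesgue_on S) g \<longleftrightarrow> integrable (restrict_space lborel S) f"
    using integral_completion_AE(3)[OF f' ae'] S S' by (simp add: integrable_restrict_space)
qed

lemma lebesgue_on_borel_version:
  fixes f :: "'a::euclidean_space \<Rightarrow> real"
  assumes S: "S \<in> sets borel" and f: "f \<in> borel_measurable (lebesgue_on S)"
  obtains f' where "f' \<in> borel_measurable (restrict_space lborel S)"
    "AE x in restrict_space lborel S. f x = f' x"
proof -
  have "(\<lambda>x. indicator S x *\<^sub>R f x) \<in> borel_measurable (completion lborel)"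
    using f S by (simp add: borel_measurable_restrict_space_iff)
  from completion_ex_borel_measurable_real[OF this] obtain f' where
    f': "f' \<in> borel_measurable lborel" "AE x in lborel. indicator S x *\<^sub>R f x = f' x" by blast
  have "f' \<in> borel_measurable (restrict_space lborel S)"
    using f'(1) by (rule measurable_restrict_space1)
  moreover have "AE x in restrict_space lborel S. f x = f' x"
    using f'(2) S by (subst AE_restrict_space_iff) (auto simp: indicator_def)
  ultimately show ?thesis by (rule that)
qed

lemmas integral_lebesgue_on_unit =
  integral_lebesgue_on_AE[OF borel_closed[OF closed_atLeastAtMost[of 0 "1 :: real"]]]

text \<open>The graphon lives on the square as a subset of the plane, while Fubini needs a product
  measure. Both measures agree on measurable rectangles, which determine them once the
  sigma-algebras are identified.\<close>

lemma unit_pair_eq: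
  "unit_lborel \<Otimes>\<^sub>M unit_lborel = restrict_space lborel ({0..1} \<times> {0..1})" (is "_ = ?R")
proof (rule pair_measure_eqI)
  show "sigma_finite_measure unit_lborel" "sigma_finite_measure unit_lborel" by unfold_locales
  have sets_unit: "A \<subseteq> {0..1}" "A \<in> sets lborel" if "A \<in> sets unit_lborel" for A
    using that by (simp_all add: sets_restrict_space_iff)
  have sq: "{0..1::real} \<times> {0..1::real} \<in> sets borel"
    by (rule borel_closed[OF closed_Times]) simp_all
  have Times: "A \<times> B \<in> sets lborel" if "A \<in> sets lborel" "B \<in> sets lborel" for A B :: "real set"
    unfolding lborel_prod[symmetric] using that by (rule pair_measureI)
  have rect: "A \<times> B \<subseteq> {0..1} \<times> {0..1}" "A \<times> B \<in> sets lborel" "A \<times> B \<in> sets ?R"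
    if "A \<in> sets unit_lborel" "B \<in> sets unit_lborel" for A B
  proof -
    show 1: "A \<times> B \<subseteq> {0..1} \<times> {0..1}" using sets_unit(1)[OF that(1)] sets_unit(1)[OF that(2)] by (rule Sigma_mono)
    show 2: "A \<times> B \<in> sets lborel" using sets_unit(2)[OF that(1)] sets_unit(2)[OF that(2)] by (rule Times)
    show "A \<times> B \<in> sets ?R" using 1 2 sq by (subst sets_restrict_space_iff) (simp_all only: sets_lborel space_lborel space_borel Int_UNIV_right simp_thms)
  qed
  show "sets (unit_lborel \<Otimes>\<^sub>M unit_lborel) = sets ?R"
  proof (rule antisym; rule subsetI)
    fix A assume "A \<in> sets ?R"
    then obtain B where B: "A = ({0..1} \<times> {0..1}) \<inter> B" "B \<in> sets (borel \<Otimes>\<^sub>M borel)"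
      unfolding borel_prod sets_restrict_space sets_lborel by blast
    have I: "(\<lambda>z. z) \<in> unit_lborel \<rightarrow>\<^sub>M borel" by (rule measurable_restrict_space1) simp
    have "(\<lambda>z. (fst z, snd z)) \<in> unit_lborel \<Otimes>\<^sub>M unit_lborel \<rightarrow>\<^sub>M borel \<Otimes>\<^sub>M borel"
      by (rule measurable_Pair[OF measurable_compose[OF measurable_fst I] measurable_compose[OF measurable_snd I]])
    from measurable_sets[OF this B(2)] show "A \<in> sets (unit_lborel \<Otimes>\<^sub>M unit_lborel)"
      by (simp add: B(1) space_pair_measure space_restrict_space Int_commute)
  next
    fix A assume "A \<in> sets (unit_lborel \<Otimes>\<^sub>M unit_lborel)"
    moreover have "sigma_sets (space ?R) {a \<times> b |a b. a \<in> sets unit_lborel \<and> b \<in> sets unit_lborel} \<subseteq> sets ?R"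
      by (rule sets.sigma_sets_subset) (use rect(3) in blast)
    moreover have "space ?R = space unit_lborel \<times> space unit_lborel"
      by (simp add: space_restrict_space)
    ultimately show "A \<in> sets ?R" unfolding sets_pair_measure by auto
  qed
  fix A B assume A: "A \<in> sets unit_lborel" and B: "B \<in> sets unit_lborel"
  have "emeasure ?R (A \<times> B) = emeasure lborel (A \<times> B)"
    by (rule emeasure_restrict_space[OF _ rect(1)[OF A B]]) (use sq in simp)
  also have "\<dots> = emeasure lborel A * emeasure lborel B"
    unfolding lborel_prod[symmetric]
    by (rule lborel.emeasure_pair_measure_Times[OF sets_unit(2)[OF A] sets_unit(2)[OF B]])
  finally show "emeasure unit_lborel A * emeasure unit_lborel B = emeasure ?R (A \<times> B)"
    using sets_unit[OF A] sets_unit[OF B] by (simp add: emeasure_restrict_space)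
qed

text \<open>Bounds on the whole plane make the later estimates hold at every real point;
  measurability concerns the unit square only.\<close>

definition unit_kernel :: "(real \<Rightarrow> real \<Rightarrow> real) \<Rightarrow> bool" where
  "unit_kernel K \<longleftrightarrow> case_prod K \<in> borel_measurable (unit_lborel \<Otimes>\<^sub>M unit_lborel) \<and>
     (\<forall>x y. 0 \<le> K x y \<and> K x y \<le> 1)"

definition kernel_op :: "(real \<Rightarrow> real \<Rightarrow> real) \<Rightarrow> (real \<Rightarrow> real) \<Rightarrow> real \<Rightarrow> real" where
  "kernel_op K f x = (LINT y|unit_lborel. K x y * f y)"

lemma kernel_op_measurable:
  assumes K: "unit_kernel K" and f[measurable]: "f \<in> borel_measurable unit_lborel"
  shows "kernel_op K f \<in> borel_measurable unit_lborel"
proof -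
  have [measurable]: "case_prod K \<in> borel_measurable (unit_lborel \<Otimes>\<^sub>M unit_lborel)"
    using K by (simp add: unit_kernel_def)
  show ?thesis unfolding kernel_op_def by measurable
qed

lemma unit_kernel_section:
  assumes "unit_kernel K" "x \<in> {0..1}"
  shows "K x \<in> borel_measurable unit_lborel"
proof -
  have "(\<lambda>y. case_prod K (x, y)) \<in> borel_measurable unit_lborel"
    by (rule measurable_Pair2) (use assms in \<open>auto simp: unit_kernel_def space_restrict_space\<close>)
  then show ?thesis by simp
qed

text \<open>The bound covers every real \<open>x\<close>, even where the section of \<open>K\<close>
  is not measurable: an integral that does not exist is 0 by convention.\<close>

lemma kernel_op_abs_le:
  assumes K: "unit_kernel K" and f: "integrable unit_lborel f"
  shows "\<bar>kernel_op K f x\<bar> \<le> (LINT y|unit_lborel. \<bar>f y\<bar>)"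
proof (cases "integrable unit_lborel (\<lambda>y. K x y * f y)")
  case True
  have "\<bar>kernel_op K f x\<bar> \<le> (LINT y|unit_lborel. \<bar>K x y * f y\<bar>)"
    unfolding kernel_op_def by (rule integral_abs_bound)
  also have "\<dots> \<le> (LINT y|unit_lborel. \<bar>f y\<bar>)"
    using True f K by (intro integral_mono integrable_abs)
      (auto simp: abs_mult unit_kernel_def intro!: mult_left_le_one_le)
  finally show ?thesis .
qed (simp add: kernel_op_def not_integrable_integral_eq)

lemma integrable_unit_bounded:
  fixes f :: "real \<Rightarrow> real"
  assumes "f \<in> borel_measurable unit_lborel" "\<And>x. \<bar>f x\<bar> \<le> B"
  shows "integrable unit_lborel f"
  using assms by (intro unit_lborel.integrable_const_bound[where B=B]) auto

text \<open>A nonnegative kernel preserves order, so a pointwise majorant passes through the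
  operator. Iterated, this compares other functions with the iterates of the constant 1.\<close>

lemma kernel_op_mono_abs:
  assumes K: "unit_kernel K" and f: "f \<in> borel_measurable unit_lborel"
    and g: "integrable unit_lborel g" and le: "\<And>x. x \<in> {0..1} \<Longrightarrow> \<bar>f x\<bar> \<le> g x" and x: "x \<in> {0..1}"
  shows "\<bar>kernel_op K f x\<bar> \<le> kernel_op K g x"
proof -
  note [measurable] = f unit_kernel_section[OF K x]
  have g': "g \<in> borel_measurable unit_lborel" using g by auto
  have K1: "0 \<le> K x y" "K x y \<le> 1" for y using K by (auto simp: unit_kernel_def)
  have i: "integrable unit_lborel (\<lambda>y. K x y * g y)"
    by (rule Bochner_Integration.integrable_bound[OF g])
      (use g' K1 in \<open>auto simp: abs_mult intro!: mult_left_le_one_le\<close>)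
  have le': "\<bar>K x y * f y\<bar> \<le> K x y * g y" if "y \<in> {0..1}" for y
    using le[OF that] K1[of y] by (auto simp: abs_mult intro: mult_left_mono)
  have i2: "integrable unit_lborel (\<lambda>y. K x y * f y)"
    by (rule Bochner_Integration.integrable_bound[OF i])
      (use le' in \<open>auto simp: space_restrict_space intro!: AE_I2 order_trans[OF le' abs_ge_self]\<close>)
  have "\<bar>kernel_op K f x\<bar> \<le> (LINT y|unit_lborel. \<bar>K x y * f y\<bar>)"
    unfolding kernel_op_def by (rule integral_abs_bound)
  also have "\<dots> \<le> kernel_op K g x"
    unfolding kernel_op_def using i i2 le'
    by (intro integral_mono) (auto simp: space_restrict_space)
  finally show ?thesis .
qed

lemma kernel_op_power_bounded:
  assumes K: "unit_kernel K" and g: "g \<in> borel_measurable unit_lborel" "\<And>x. \<bar>g x\<bar> \<le> 1"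
  shows "(kernel_op K ^^ n) g \<in> borel_measurable unit_lborel" "\<bar>(kernel_op K ^^ n) g x\<bar> \<le> 1"
proof (induction n arbitrary: x)
  case (Suc n)
  { case 1 show ?case using Suc kernel_op_measurable[OF K] by simp }
  { case 2
    have i: "integrable unit_lborel ((kernel_op K ^^ n) g)"
      using Suc by (intro integrable_unit_bounded[where B=1]) auto
    have "\<bar>(kernel_op K ^^ Suc n) g x\<bar> \<le> (LINT y|unit_lborel. \<bar>(kernel_op K ^^ n) g y\<bar>)"
      using kernel_op_abs_le[OF K i] by simp
    also have "\<dots> \<le> (LINT y|unit_lborel. 1)"
      using Suc(2) i by (intro integral_mono) auto
    finally show ?case using unit_lborel.prob_space by simp }
qed (use g in auto)

text \<open>Integrating out the last vertex turns the weight \<open>g\<close> there into the weight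
  \<open>kernel_op K g\<close> at the previous vertex. The free end weight is what lets the
  induction run; path densities are the case of the constant 1.\<close>

lemma path_integral:
  assumes K: "unit_kernel K" and g: "g \<in> borel_measurable unit_lborel" "\<And>x. \<bar>g x\<bar> \<le> 1"
  shows "(LINT x|Pi\<^sub>M {..n} (\<lambda>_. unit_lborel). (\<Prod>i<n. K (x i) (x (Suc i))) * g (x n)) =
    (LINT x|unit_lborel. (kernel_op K ^^ n) g x)"
  using g
proof (induction n arbitrary: g)
  case 0
  have "{..0::nat} = {0}" by auto
  then show ?case
    using unit_product.product_integral_singleton[OF 0(1), of 0] by simp
next
  case (Suc n)
  have [measurable]: "case_prod K \<in> borel_measurable (unit_lborel \<Otimes>\<^sub>M unit_lborel)"
    and K01: "\<And>x y. 0 \<le> K x y \<and> K x y \<le> 1"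
    using K by (auto simp: unit_kernel_def)
  note [measurable] = \<open>g \<in> borel_measurable unit_lborel\<close>
  have P: "prob_space (Pi\<^sub>M {..Suc n} (\<lambda>_. unit_lborel))"
    by (rule prob_space_PiM) unfold_locales
  let ?F = "\<lambda>x. (\<Prod>i<Suc n. K (x i) (x (Suc i))) * g (x (Suc n))"
  have m: "?F \<in> borel_measurable (Pi\<^sub>M {..Suc n} (\<lambda>_. unit_lborel))"
  proof -
    have [measurable]: "(\<lambda>x. x i) \<in> Pi\<^sub>M {..Suc n} (\<lambda>_. unit_lborel) \<rightarrow>\<^sub>M unit_lborel" if "i \<le> Suc n" for i
      using that by (intro measurable_component_singleton) auto
    have "(\<lambda>x. case_prod K (x i, x (Suc i))) \<in> borel_measurable (Pi\<^sub>M {..Suc n} (\<lambda>_. unit_lborel))"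
      if "i < Suc n" for i
      using that by (intro measurable_compose[OF _ \<open>case_prod K \<in> _\<close>] measurable_Pair) auto
    then show ?thesis
      by (intro borel_measurable_times borel_measurable_prod) (auto intro: measurable_compose[OF _ \<open>g \<in> _\<close>])
  qed
  have b: "\<bar>?F x\<bar> \<le> 1" for x
    using K01 Suc.prems(2) by (auto simp: abs_mult abs_prod intro!: mult_le_one prod_le_1)
  have eq: "{..Suc n} = insert (Suc n) {..n}" by auto
  have "integrable (Pi\<^sub>M {..Suc n} (\<lambda>_. unit_lborel)) ?F"
    using m b by (intro finite_measure.integrable_const_bound[OF prob_space.finite_measure[OF P], where B=1]) auto
  then have "(LINT x|Pi\<^sub>M {..Suc n} (\<lambda>_. unit_lborel). ?F x) =
     (LINT x|Pi\<^sub>M {..n} (\<lambda>_. unit_lborel). LINT y|unit_lborel. ?F (x(Suc n := y)))"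
    unfolding eq by (intro unit_product.product_integral_insert) auto
  also have "\<dots> = (LINT x|Pi\<^sub>M {..n} (\<lambda>_. unit_lborel). (\<Prod>i<n. K (x i) (x (Suc i))) * kernel_op K g (x n))"
  proof (intro Bochner_Integration.integral_cong refl)
    fix x :: "nat \<Rightarrow> real"
    \<comment> \<open>Only the last edge factor and the end weight involve the coordinate being
      integrated.\<close>
    have F: "?F (x(Suc n := y)) = (\<Prod>i<n. K (x i) (x (Suc i))) * (K (x n) y * g y)" for y
      by (auto simp: mult_ac intro!: arg_cong2[where f="(*)"] prod.cong)
    show "(LINT y|unit_lborel. ?F (x(Suc n := y))) = (\<Prod>i<n. K (x i) (x (Suc i))) * kernel_op K g (x n)"
      by (simp only: F kernel_op_def integral_mult_right_zero)
  qed
  also have "\<dots> = (LINT x|unit_lborel. (kernel_op K ^^ n) (kernel_op K g) x)"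
    using kernel_op_power_bounded[OF K Suc.prems, of 1] by (intro Suc.IH) auto
  finally show ?case by (simp add: funpow_swap1)
qed

section \<open>Homomorphism densities of paths\<close>

definition path_edges :: "nat \<Rightarrow> nat set set" where
  "path_edges n = (\<lambda>i. {i, Suc i}) ` {..<n}"

lemma simple_graph_path: "simple_graph {..n} (path_edges n)"
  by (auto simp: simple_graph_def path_edges_def)

lemma prod_path_edges:
  "(\<Prod>e\<in>path_edges n. K (x (Min e)) (x (Max e))) = (\<Prod>i<n. K (x i) (x (Suc i)))"
proof -
  have "inj_on (\<lambda>i. {i, Suc i}) {..<n}"
    by (auto simp: inj_on_def doubleton_eq_iff)
  then show ?thesis
    by (simp add: path_edges_def prod.reindex)
qed

definition path_density :: "(real \<Rightarrow> real \<Rightarrow> real) \<Rightarrow> nat \<Rightarrow> real" where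
  "path_density K n = (LINT x|unit_lborel. (kernel_op K ^^ n) (\<lambda>_. 1) x)"

text \<open>Two distinct coordinates are jointly distributed by the product of their laws, so a null
  set of the square pulls back to a null set of the cube. Distinctness matters: the diagonal is
  itself null in the square.\<close>

lemma AE_PiM_pair:
  fixes Q :: "real \<times> real \<Rightarrow> bool"
  assumes ae: "AE z in unit_lborel \<Otimes>\<^sub>M unit_lborel. Q z" and ij: "i \<noteq> j" "i \<in> I" "j \<in> I" "finite (I :: nat set)"
  shows "AE x in Pi\<^sub>M I (\<lambda>_. unit_lborel). Q (x i, x j)"
proof -
  from ae obtain N where N: "{z \<in> space (unit_lborel \<Otimes>\<^sub>M unit_lborel). \<not> Q z} \<subseteq> N"
    "emeasure (unit_lborel \<Otimes>\<^sub>M unit_lborel) N = 0" "N \<in> sets (unit_lborel \<Otimes>\<^sub>M unit_lborel)"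
    by (rule AE_E)
  let ?f = "\<lambda>a b. indicator N (a, b) :: ennreal"
  have f: "case_prod ?f \<in> borel_measurable (unit_lborel \<Otimes>\<^sub>M unit_lborel)"
    using N(3) by (simp add: case_prod_beta')
  have [measurable]: "(\<lambda>x. ?f (x i) (x j)) \<in> borel_measurable (Pi\<^sub>M J (\<lambda>_. unit_lborel))" if "i \<in> J" "j \<in> J" for J
    using measurable_compose[OF measurable_Pair[OF measurable_component_singleton[OF that(1)] measurable_component_singleton[OF that(2)]] f]
    by simp
  have "(\<integral>\<^sup>+x. ?f (x i) (x j) \<partial>Pi\<^sub>M {i, j} (\<lambda>_. unit_lborel)) =
      (\<integral>\<^sup>+x. ?f (restrict x {i, j} i) (restrict x {i, j} j) \<partial>Pi\<^sub>M I (\<lambda>_. unit_lborel))"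
    using ij by (subst unit_product.distr_restrict[of "{i, j}" I]) (auto simp: nn_integral_distr measurable_restrict_subset)
  moreover have "(\<integral>\<^sup>+x. ?f (x i) (x j) \<partial>Pi\<^sub>M {i, j} (\<lambda>_. unit_lborel)) = 0"
    using unit_product.product_nn_integral_pair[OF f ij(1)] N by simp
  ultimately have "(\<integral>\<^sup>+x. ?f (x i) (x j) \<partial>Pi\<^sub>M I (\<lambda>_. unit_lborel)) = 0" by simp
  then have "AE x in Pi\<^sub>M I (\<lambda>_. unit_lborel). ?f (x i) (x j) = 0"
    using ij by (subst (asm) nn_integral_0_iff_AE) auto
  then show ?thesis
    using AE_space
  proof eventually_elim
    case (elim x)
    then have "(x i, x j) \<in> space (unit_lborel \<Otimes>\<^sub>M unit_lborel)"
      using ij by (auto simp: space_PiM space_pair_measure PiE_def Pi_def)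
    then show ?case using elim N(1) by (auto simp: indicator_def split: if_splits)
  qed
qed

text \<open>A path has finitely many edges, so almost-everywhere agreement of the kernels survives
  the product; the completion in \<open>hom_density\<close> absorbs the exceptional null
  set.\<close>

lemma hom_density_path:
  assumes K: "unit_kernel K" and ae: "AE (x, y) in unit_lborel \<Otimes>\<^sub>M unit_lborel. W x y = K x y"
  shows "hom_density {..n} (path_edges n) W = path_density K n"
proof -
  have [measurable]: "case_prod K \<in> borel_measurable (unit_lborel \<Otimes>\<^sub>M unit_lborel)"
    using K by (simp add: unit_kernel_def)
  let ?P = "Pi\<^sub>M {..n} (\<lambda>_. unit_lborel)"
  have m: "(\<lambda>x. \<Prod>i<n. K (x i) (x (Suc i))) \<in> borel_measurable ?P"
  proof (intro borel_measurable_prod)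
    fix i assume "i \<in> {..<n}"
    then have "(\<lambda>x. case_prod K (x i, x (Suc i))) \<in> borel_measurable ?P"
      by (intro measurable_compose[OF _ \<open>case_prod K \<in> _\<close>] measurable_Pair measurable_component_singleton) auto
    then show "(\<lambda>x. K (x i) (x (Suc i))) \<in> borel_measurable ?P" by simp
  qed
  have "AE x in ?P. \<forall>i\<in>{..<n}. W (x i) (x (Suc i)) = K (x i) (x (Suc i))"
    using AE_PiM_pair[OF ae, of _ "Suc _" "{..n}"] by (intro AE_finite_allI) auto
  then have "AE x in ?P. (\<Prod>i<n. W (x i) (x (Suc i))) = (\<Prod>i<n. K (x i) (x (Suc i)))"
    by eventually_elim (auto intro: prod.cong)
  from integral_completion_AE(2)[OF m this]
  show ?thesis
    using path_integral[OF K, of "\<lambda>_. 1" n]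
    by (simp add: hom_density_def prod_path_edges path_density_def)
qed

section \<open>Path densities of graphs and graphons\<close>

text \<open>The vector \<open>J^n 1\<close>: its entry at \<open>i\<close> is the total weight of
  the walks with \<open>n\<close> steps that start at \<open>i\<close>.\<close>

definition walk :: "nat \<Rightarrow> (nat \<Rightarrow> nat \<Rightarrow> real) \<Rightarrow> nat \<Rightarrow> nat \<Rightarrow> real" where
  "walk N J n = (local_field N J ^^ n) (\<lambda>_. 1)"

lemma walk_0 [simp]: "walk N J 0 = (\<lambda>_. 1)"
  by (simp add: walk_def)

lemma walk_Suc: "walk N J (Suc n) i = (\<Sum>j\<in>{1..N}. J i j * walk N J n j)"
  by (simp add: walk_def local_field_def)

definition walk_mean :: "nat \<Rightarrow> (nat \<Rightarrow> nat \<Rightarrow> real) \<Rightarrow> nat \<Rightarrow> real" where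
  "walk_mean N J n = 1 / real N * (\<Sum>i\<in>{1..N}. walk N J n i)"

lemma integral_unit_step:
  assumes N: "N \<ge> 1"
  shows "(LINT y|unit_lborel. h (nat \<lceil>real N * y\<rceil>)) = 1 / real N * (\<Sum>j\<in>{1..N}. h j)"
proof -
  let ?A = "\<lambda>j. {(real j - 1) / real N <.. real j / real N}"
  \<comment> \<open>The cells are open on the left to match the ceiling. At \<open>y = 0\<close> the
    ceiling is 0, which indexes no cell; that point is discarded as a null set.\<close>
  have step: "h (nat \<lceil>real N * y\<rceil>) = (\<Sum>j\<in>{1..N}. h j * indicator (?A j) y)" if y: "y \<in> {0<..1}" for y
  proof -
    let ?k = "nat \<lceil>real N * y\<rceil>"
    have y0: "real N * y > 0" using y N by simp
    have k1: "?k \<ge> 1" using y0 by linarith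
    have "real N * y \<le> real N" using y N by simp
    then have kN: "?k \<le> N" by linarith
    have ind: "indicator (?A j) y = (if j = ?k then 1 else 0 :: real)" if "j \<in> {1..N}" for j
    proof -
      have "y \<in> ?A j \<longleftrightarrow> real j - 1 < real N * y \<and> real N * y \<le> real j"
        using N by (auto simp: field_simps)
      also have "\<dots> \<longleftrightarrow> j = ?k" using y0 by linarith
      finally show ?thesis by (simp add: indicator_def)
    qed
    have "(\<Sum>j\<in>{1..N}. h j * indicator (?A j) y) = (\<Sum>j\<in>{1..N}. if j = ?k then h j else 0)"
      by (intro sum.cong refl) (simp add: ind)
    also have "\<dots> = h ?k" using k1 kN by simp
    finally show ?thesis by simp
  qed
  have meas: "measure unit_lborel (?A j \<inter> {0..1}) = 1 / real N" if "j \<in> {1..N}" for j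
  proof -
    have "0 \<le> (real j - 1) / real N" "real j / real N \<le> 1"
      using that N by (auto simp: field_simps)
    then have "?A j \<subseteq> {0..1}" by auto
    then have "?A j \<inter> {0..1} = ?A j" by auto
    then show ?thesis
      using \<open>?A j \<subseteq> {0..1}\<close> N by (simp add: measure_restrict_space divide_right_mono diff_divide_distrib)
  qed
  have AE0: "AE y in unit_lborel. y \<noteq> 0"
    by (subst AE_restrict_space_iff) (auto intro: AE_mp[OF AE_lborel_singleton[of 0]])
  have sum_meas: "(\<lambda>y. \<Sum>j\<in>{1..N}. h j * indicator (?A j) y) \<in> borel_measurable unit_lborel"
    by (rule measurable_restrict_space1, intro borel_measurable_sum borel_measurable_times borel_measurable_indicator) auto
  have A: "(\<lambda>y. h (nat \<lceil>real N * y\<rceil>)) \<in> borel_measurable unit_lborel"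
    by (rule measurable_restrict_space1) measurable
  have int: "integrable unit_lborel (\<lambda>y. h j * indicator (?A j) y)" for j
  proof (rule integrable_unit_bounded)
    show "(\<lambda>y. h j * indicator (?A j) y) \<in> borel_measurable unit_lborel"
      by (rule measurable_restrict_space1) measurable
  qed (auto simp: indicator_def abs_mult)
  have "(LINT y|unit_lborel. h (nat \<lceil>real N * y\<rceil>)) =
      (LINT y|unit_lborel. (\<Sum>j\<in>{1..N}. h j * indicator (?A j) y))"
  proof (rule integral_cong_AE[OF A sum_meas])
    show "AE y in unit_lborel. h (nat \<lceil>real N * y\<rceil>) = (\<Sum>j\<in>{1..N}. h j * indicator (?A j) y)"
      using AE0 AE_space
    proof eventually_elim
      case (elim y)
      then show ?case by (intro step) (auto simp: space_restrict_space)
    qed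
  qed
  also have "\<dots> = (\<Sum>j\<in>{1..N}. LINT y|unit_lborel. h j * indicator (?A j) y)"
    using int by (intro Bochner_Integration.integral_sum)
  also have "\<dots> = (\<Sum>j\<in>{1..N}. h j * (1 / real N))"
    by (intro sum.cong refl) (simp add: meas space_restrict_space)
  finally show ?thesis by (simp add: sum_distrib_left mult.commute)
qed

lemma unit_kernel_graph_kernel: "unit_kernel (graph_kernel N E)"
  unfolding unit_kernel_def
proof
  have [measurable]: "(\<lambda>x. nat \<lceil>real N * x\<rceil>) \<in> unit_lborel \<rightarrow>\<^sub>M count_space UNIV"
    by (rule measurable_restrict_space1) measurable
  have "(\<lambda>z. (nat \<lceil>real N * fst z\<rceil>, nat \<lceil>real N * snd z\<rceil>)) \<in>
      unit_lborel \<Otimes>\<^sub>M unit_lborel \<rightarrow>\<^sub>M count_space UNIV \<Otimes>\<^sub>M count_space UNIV"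
    by measurable
  from measurable_compose[OF this, of "\<lambda>z. adjacency E (fst z) (snd z)" borel]
  have "(\<lambda>z. adjacency E (nat \<lceil>real N * fst z\<rceil>) (nat \<lceil>real N * snd z\<rceil>)) \<in>
      borel_measurable (unit_lborel \<Otimes>\<^sub>M unit_lborel)"
    by (simp add: pair_measure_countable)
  then show "case_prod (graph_kernel N E) \<in> borel_measurable (unit_lborel \<Otimes>\<^sub>M unit_lborel)"
    by (simp add: graph_kernel_def case_prod_beta')
  show "\<forall>x y. 0 \<le> graph_kernel N E x y \<and> graph_kernel N E x y \<le> 1"
    by (simp add: graph_kernel_def adjacency_def)
qed

text \<open>Iterating the operator of a graph kernel on the constant 1 gives step functions whose
  values are the walk weights; the cell width \<open>1 / N\<close> becomes the scaling of
  \<open>J\<close>.\<close>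

lemma path_density_graph_kernel:
  assumes N: "N \<ge> 1" and J: "\<And>i j. J i j = 1 / real N * adjacency E i j"
  shows "path_density (graph_kernel N E) n = walk_mean N J n"
proof -
  have "(kernel_op (graph_kernel N E) ^^ n) (\<lambda>_. 1) = (\<lambda>x. walk N J n (nat \<lceil>real N * x\<rceil>))"
  proof (induction n)
    case (Suc n)
    show ?case
    proof
      fix x
      have "(kernel_op (graph_kernel N E) ^^ Suc n) (\<lambda>_. 1) x =
        (LINT y|unit_lborel. (\<lambda>j. adjacency E (nat \<lceil>real N * x\<rceil>) j * walk N J n j) (nat \<lceil>real N * y\<rceil>))"
        by (simp add: Suc kernel_op_def graph_kernel_def)
      also have "\<dots> = walk N J (Suc n) (nat \<lceil>real N * x\<rceil>)"
        by (subst integral_unit_step[OF N]) (simp add: walk_Suc J sum_distrib_left mult.assoc)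
      finally show "(kernel_op (graph_kernel N E) ^^ Suc n) (\<lambda>_. 1) x = walk N J (Suc n) (nat \<lceil>real N * x\<rceil>)" .
    qed
  qed simp
  then show ?thesis
    by (simp add: path_density_def walk_mean_def integral_unit_step[OF N])
qed

lemma graphon_borel_version:
  assumes W: "graphon W"
  obtains K where "unit_kernel K" "\<And>x y. K x y = K y x"
    "AE (x, y) in unit_lborel \<Otimes>\<^sub>M unit_lborel. W x y = K x y"
    "(LINT (x, y) | lebesgue_on ({0..1} \<times> {0..1}). W x y) = path_density K 1"
proof -
  let ?P = "unit_lborel \<Otimes>\<^sub>M unit_lborel"
  have S: "{0..1::real} \<times> {0..1::real} \<in> sets borel"
    by (simp add: borel_closed closed_Times)
  have "case_prod W \<in> borel_measurable (lebesgue_on ({0..1} \<times> {0..1}))"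
    using W by (simp add: graphon_def)
  from lebesgue_on_borel_version[OF S this, folded unit_pair_eq]
  obtain V where [measurable]: "V \<in> borel_measurable ?P" and ae: "AE z in ?P. case_prod W z = V z" .
  \<comment> \<open>Swapping the coordinates preserves the product measure, so the transpose of
    \<open>V\<close> also agrees with the symmetric \<open>W\<close> almost everywhere. The maximum
    of \<open>V\<close> and its transpose, clipped to \<open>[0, 1]\<close>, is then symmetric and
    bounded everywhere and still equals \<open>W\<close> almost everywhere.\<close>
  have "AE z in distr ?P ?P (\<lambda>(x, y). (y, x)). case_prod W z = V z"
    using ae by (simp only: unit_pair.distr_pair_swap[symmetric])
  then have ae2: "AE z in ?P. case_prod W ((\<lambda>(x, y). (y, x)) z) = V ((\<lambda>(x, y). (y, x)) z)"
    by (rule AE_distrD[rotated]) measurable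
  define K where "K x y = max 0 (min 1 (max (V (x, y)) (V (y, x))))" for x y
  have "(\<lambda>z. max 0 (min 1 (max (V z) (V (snd z, fst z))))) \<in> borel_measurable ?P"
    by measurable
  then have K: "unit_kernel K"
    by (simp add: unit_kernel_def K_def case_prod_beta')
  moreover have "K x y = K y x" for x y by (simp add: K_def max.commute)
  moreover have ae3: "AE (x, y) in ?P. W x y = K x y"
    using ae ae2 AE_space
  proof eventually_elim
    case (elim z)
    obtain x y where z: "z = (x, y)" by (cases z)
    have xy: "x \<in> {0..1}" "y \<in> {0..1}" using elim(3) z by (auto simp: space_pair_measure space_restrict_space)
    then have "0 \<le> W x y" "W x y \<le> 1" "W x y = W y x" using W unfolding graphon_def by blast+
    then show ?case using elim(1,2) z by (auto simp: K_def)
  qed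
  moreover have "integral\<^sup>L (lebesgue_on ({0..1} \<times> {0..1})) (case_prod W) = path_density K 1"
  proof -
    have Km: "case_prod K \<in> borel_measurable ?P" using K by (simp add: unit_kernel_def)
    have ae4: "AE z in ?P. case_prod W z = case_prod K z" using ae3 by eventually_elim auto
    have "integral\<^sup>L (lebesgue_on ({0..1} \<times> {0..1})) (case_prod W) = integral\<^sup>L ?P (case_prod K)"
      using integral_lebesgue_on_AE(2)[OF S, folded unit_pair_eq, OF Km ae4] .
    also have "\<dots> = path_density K 1"
    proof -
      have "integrable ?P (case_prod K)"
        using Km K by (intro unit_pair.integrable_const_bound[where B=1]) (auto simp: unit_kernel_def)
      from unit_pair.integral_fst'[OF this] show ?thesis
        by (simp add: path_density_def kernel_op_def)
    qed
    finally show ?thesis .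
  qed
  ultimately show ?thesis by (rule that)
qed

section \<open>Path densities and the operator norm\<close>

lemma kernel_op_AE:
  assumes K: "unit_kernel K" and ae: "AE (x, y) in unit_lborel \<Otimes>\<^sub>M unit_lborel. W x y = K x y"
    and g: "g \<in> borel_measurable unit_lborel" and fg: "AE x in unit_lborel. f x = g x"
  shows "AE x in unit_lborel. graphon_operator W f x = kernel_op K g x"
  using unit_pair.AE_pair[OF ae] AE_space
proof eventually_elim
  case (elim x)
  then have x: "x \<in> {0..1}" by (simp add: space_restrict_space)
  have "AE y in unit_lborel. W x y * f y = K x y * g y"
    using elim(1) fg by eventually_elim simp
  then show ?case
    unfolding graphon_operator_def kernel_op_def using unit_kernel_section[OF K x] g
    by (intro integral_lebesgue_on_unit(2)) auto
qed

lemma L2_norm_graphon_operator: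
  assumes K: "unit_kernel K" and ae: "AE (x, y) in unit_lborel \<Otimes>\<^sub>M unit_lborel. W x y = K x y"
    and g: "g \<in> borel_measurable unit_lborel" and fg: "AE x in unit_lborel. f x = g x"
  shows "L2_norm_unit (graphon_operator W f) = sqrt (LINT x|unit_lborel. (kernel_op K g x)\<^sup>2)"
  unfolding L2_norm_unit_def using kernel_op_AE[OF assms] kernel_op_measurable[OF K g]
  by (subst integral_lebesgue_on_unit(2)) (auto elim: eventually_mono)

section \<open>Square-integrable functions and the operator norm\<close>

lemma integrable_mult_of_squares:
  fixes f g :: "real \<Rightarrow> real"
  assumes f: "f \<in> borel_measurable M" "integrable M (\<lambda>x. (f x)\<^sup>2)"
    and g: "g \<in> borel_measurable M" "integrable M (\<lambda>x. (g x)\<^sup>2)"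
  shows "integrable M (\<lambda>x. f x * g x)"
proof (rule Bochner_Integration.integrable_bound)
  show "integrable M (\<lambda>x. (f x)\<^sup>2 + (g x)\<^sup>2)" using f g by simp
  have "\<bar>a * b\<bar> \<le> a\<^sup>2 + b\<^sup>2" for a b :: real
    using sum_squares_bound[of "\<bar>a\<bar>" "\<bar>b\<bar>"] abs_ge_zero[of "a * b"] by (simp only: abs_mult power2_abs)
  then show "AE x in M. norm (f x * g x) \<le> norm ((f x)\<^sup>2 + (g x)\<^sup>2)" by auto
qed (use f g in auto)

text \<open>The integral of \<open>(s * f - t * g)^2\<close> is nonnegative for all \<open>s\<close>
  and \<open>t\<close>. Taking \<open>s = ?c\<close>, \<open>t = ?b\<close> gives the claim after
  division by \<open>?c\<close>; if \<open>?c = 0\<close>, a suitable \<open>t\<close> makes the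
  form equal to -1 unless \<open>?b = 0\<close>.\<close>

lemma integral_Cauchy_Schwarz:
  fixes f g :: "real \<Rightarrow> real"
  assumes f: "f \<in> borel_measurable M" "integrable M (\<lambda>x. (f x)\<^sup>2)"
    and g: "g \<in> borel_measurable M" "integrable M (\<lambda>x. (g x)\<^sup>2)"
  shows "(LINT x|M. f x * g x)\<^sup>2 \<le> (LINT x|M. (f x)\<^sup>2) * (LINT x|M. (g x)\<^sup>2)"
proof -
  let ?a = "LINT x|M. (f x)\<^sup>2" and ?b = "LINT x|M. f x * g x" and ?c = "LINT x|M. (g x)\<^sup>2"
  note fg = integrable_mult_of_squares[OF f g]
  have q: "0 \<le> s\<^sup>2 * ?a - 2 * s * t * ?b + t\<^sup>2 * ?c" for s t :: real
  proof -
    have "0 \<le> (LINT x|M. (s * f x - t * g x)\<^sup>2)" by simp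
    also have "\<dots> = (LINT x|M. s\<^sup>2 * (f x)\<^sup>2 - 2 * s * t * (f x * g x) + t\<^sup>2 * (g x)\<^sup>2)"
      by (intro Bochner_Integration.integral_cong refl) (simp add: power2_eq_square algebra_simps)
    also have "\<dots> = s\<^sup>2 * ?a - 2 * s * t * ?b + t\<^sup>2 * ?c"
      using f g fg by simp
    finally show ?thesis .
  qed
  have a: "?a \<ge> 0" and c: "?c \<ge> 0" by simp_all
  show ?thesis
  proof (cases "?c = 0")
    case True
    have "?b = 0"
    proof (rule ccontr)
      assume b: "?b \<noteq> 0"
      have "0 \<le> ?a - 2 * ((?a + 1) / (2 * ?b)) * ?b"
        using q[of 1 "(?a + 1) / (2 * ?b)"] True by simp
      then show False using b by (simp add: field_simps)
    qed
    then show ?thesis using True by simp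
  next
    case False
    with c have c: "?c > 0" by linarith
    have "0 \<le> ?c * (?c * ?a - ?b\<^sup>2)"
      using q[of ?c ?b] by (simp add: power2_eq_square algebra_simps)
    then show ?thesis using c by (simp add: zero_le_mult_iff mult.commute)
  qed
qed

lemma integral_abs_le_L2:
  fixes f :: "real \<Rightarrow> real"
  assumes f: "f \<in> borel_measurable unit_lborel" "integrable unit_lborel (\<lambda>x. (f x)\<^sup>2)"
  shows "integrable unit_lborel f" "(LINT x|unit_lborel. \<bar>f x\<bar>)\<^sup>2 \<le> (LINT x|unit_lborel. (f x)\<^sup>2)"
proof -
  show "integrable unit_lborel f"
    using unit_lborel.square_integrable_imp_integrable[OF f] .
  show "(LINT x|unit_lborel. \<bar>f x\<bar>)\<^sup>2 \<le> (LINT x|unit_lborel. (f x)\<^sup>2)"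
    using integral_Cauchy_Schwarz[of "\<lambda>x. \<bar>f x\<bar>" unit_lborel "\<lambda>_. 1"] f unit_lborel.prob_space by simp
qed

lemma square_integrable_borel_version:
  assumes "square_integrable f"
  obtains g where "g \<in> borel_measurable unit_lborel" "AE x in unit_lborel. f x = g x"
    "integrable unit_lborel (\<lambda>x. (g x)\<^sup>2)" "(L2_norm_unit f)\<^sup>2 = (LINT x|unit_lborel. (g x)\<^sup>2)"
proof -
  obtain g where g: "g \<in> borel_measurable unit_lborel" "AE x in unit_lborel. f x = g x"
    using assms lebesgue_on_borel_version[of "{0..1}" f] unfolding square_integrable_def by auto
  have ae: "AE x in unit_lborel. (f x)\<^sup>2 = (g x)\<^sup>2" using g(2) by eventually_elim simp
  have g2: "(\<lambda>x. (g x)\<^sup>2) \<in> borel_measurable unit_lborel" using g(1) by simp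
  show ?thesis
    using that[OF g] assms integral_lebesgue_on_unit[OF g2 ae]
    by (simp add: square_integrable_def L2_norm_unit_def)
qed

text \<open>One application of the operator yields a bounded function: with \<open>K \<le> 1\<close>
  on a probability space, its values are at most the integral of \<open>|f|\<close>, hence at most
  the norm of \<open>f\<close>.\<close>

lemma kernel_op_square_integrable:
  assumes K: "unit_kernel K" and f: "f \<in> borel_measurable unit_lborel" "integrable unit_lborel (\<lambda>x. (f x)\<^sup>2)"
  shows "(kernel_op K f x)\<^sup>2 \<le> (LINT x|unit_lborel. (f x)\<^sup>2)"
    "integrable unit_lborel (\<lambda>x. (kernel_op K f x)\<^sup>2)"
proof -
  note L = integral_abs_le_L2[OF f]
  show b: "(kernel_op K f x)\<^sup>2 \<le> (LINT x|unit_lborel. (f x)\<^sup>2)" for x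
    using power_mono[OF kernel_op_abs_le[OF K L(1), of x], of 2] L(2) by simp
  show "integrable unit_lborel (\<lambda>x. (kernel_op K f x)\<^sup>2)"
    using kernel_op_measurable[OF K f(1)] b by (intro integrable_unit_bounded) auto
qed

text \<open>A real \<open>Sup\<close> is informative only over a set that is bounded above; this
  licenses \<open>cSup_upper\<close> and \<open>less_cSup_iff\<close> for the operator norm.\<close>

lemma bdd_above_graphon_norm:
  assumes K: "unit_kernel K" and ae: "AE (x, y) in unit_lborel \<Otimes>\<^sub>M unit_lborel. W x y = K x y"
  shows "bdd_above {L2_norm_unit (graphon_operator W f) | f. square_integrable f \<and> L2_norm_unit f \<le> 1}"
proof (rule bdd_aboveI)
  fix r assume "r \<in> {L2_norm_unit (graphon_operator W f) | f. square_integrable f \<and> L2_norm_unit f \<le> 1}"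
  then obtain f where f: "square_integrable f" "L2_norm_unit f \<le> 1" and r: "r = L2_norm_unit (graphon_operator W f)"
    by blast
  obtain g where g: "g \<in> borel_measurable unit_lborel" "AE x in unit_lborel. f x = g x"
    "integrable unit_lborel (\<lambda>x. (g x)\<^sup>2)" "(L2_norm_unit f)\<^sup>2 = (LINT x|unit_lborel. (g x)\<^sup>2)"
    using square_integrable_borel_version[OF f(1)] .
  have "L2_norm_unit f \<ge> 0" by (simp add: L2_norm_unit_def)
  then have "(LINT x|unit_lborel. (g x)\<^sup>2) \<le> 1"
    using f(2) unfolding g(4)[symmetric] by (simp add: power_le_one)
  then have "(kernel_op K g x)\<^sup>2 \<le> 1" for x
    using kernel_op_square_integrable(1)[OF K g(1,3), of x] by linarith
  then have "(LINT x|unit_lborel. (kernel_op K g x)\<^sup>2) \<le> (LINT x|unit_lborel. 1)"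
    using kernel_op_square_integrable(2)[OF K g(1,3)] by (intro integral_mono) auto
  then show "r \<le> 1"
    unfolding r L2_norm_graphon_operator[OF K ae g(1,2)] using unit_lborel.prob_space by simp
qed

text \<open>The supremum ranges over the unit ball, so \<open>f\<close> is divided by its norm; when
  that norm is 0, the operator sends \<open>f\<close> to 0 at every point.\<close>

lemma kernel_op_norm_le:
  assumes K: "unit_kernel K" and ae: "AE (x, y) in unit_lborel \<Otimes>\<^sub>M unit_lborel. W x y = K x y"
    and f: "f \<in> borel_measurable unit_lborel" "integrable unit_lborel (\<lambda>x. (f x)\<^sup>2)"
  shows "sqrt (LINT x|unit_lborel. (kernel_op K f x)\<^sup>2) \<le> graphon_norm W * sqrt (LINT x|unit_lborel. (f x)\<^sup>2)"
proof -
  define s where "s = sqrt (LINT x|unit_lborel. (f x)\<^sup>2)"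
  have s0: "s \<ge> 0" and s2: "(LINT x|unit_lborel. (f x)\<^sup>2) = s\<^sup>2" by (simp_all add: s_def)
  show ?thesis
  proof (cases "s = 0")
    case True
    then have "kernel_op K f x = 0" for x
      using kernel_op_square_integrable(1)[OF K f, of x] s2 by simp
    then show ?thesis using True s_def by simp
  next
    case False
    then have s: "s > 0" using s0 by simp
    define g where "g x = f x / s" for x
    have g: "g \<in> borel_measurable unit_lborel" using f unfolding g_def by measurable
    have "(LINT x|unit_lborel. (g x)\<^sup>2) = 1"
      using s s2 by (simp add: g_def power_divide)
    moreover have "integrable unit_lborel (\<lambda>x. (g x)\<^sup>2)" using f(2) by (simp add: g_def power_divide)
    moreover have g2: "(\<lambda>x. (g x)\<^sup>2) \<in> borel_measurable unit_lborel" using g by simp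
    ultimately have "square_integrable g" "L2_norm_unit g \<le> 1"
      using integral_lebesgue_on_unit[OF g, of g] integral_lebesgue_on_unit[OF g2, of "\<lambda>x. (g x)\<^sup>2"]
      by (auto simp: square_integrable_def L2_norm_unit_def)
    then have "L2_norm_unit (graphon_operator W g) \<le> graphon_norm W"
      unfolding graphon_norm_def by (intro cSup_upper bdd_above_graphon_norm[OF K ae]) auto
    moreover have "L2_norm_unit (graphon_operator W g) = sqrt (LINT x|unit_lborel. (kernel_op K g x)\<^sup>2)"
      by (rule L2_norm_graphon_operator[OF K ae g]) simp
    moreover have "kernel_op K g x = kernel_op K f x / s" for x
      by (simp add: kernel_op_def g_def)
    ultimately have "sqrt (LINT x|unit_lborel. (kernel_op K f x)\<^sup>2) / s \<le> graphon_norm W"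
      using s by (simp add: power_divide real_sqrt_divide)
    then show ?thesis using s by (simp add: s_def[symmetric] pos_divide_le_eq)
  qed
qed

text \<open>The constant 1 has norm 1, so the norm of \<open>T^n 1\<close> is at most the
  \<open>n\<close>-th power of the operator norm; on a probability space the integral is at most the
  norm.\<close>

lemma path_density_le_norm_power:
  assumes K: "unit_kernel K" and ae: "AE (x, y) in unit_lborel \<Otimes>\<^sub>M unit_lborel. W x y = K x y"
    and norm0: "graphon_norm W \<ge> 0"
  shows "path_density K n \<le> graphon_norm W ^ n"
proof -
  let ?f = "\<lambda>n. (kernel_op K ^^ n) (\<lambda>_. 1)"
  have m: "?f n \<in> borel_measurable unit_lborel" and b: "\<bar>?f n x\<bar> \<le> 1" for n x
    using kernel_op_power_bounded[OF K, of "\<lambda>_. 1"] by auto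
  have i: "integrable unit_lborel (\<lambda>x. (?f n x)\<^sup>2)" for n
    using m b by (intro integrable_unit_bounded[where B=1]) (auto simp: abs_square_le_1)
  have le: "sqrt (LINT x|unit_lborel. (?f n x)\<^sup>2) \<le> graphon_norm W ^ n" for n
  proof (induction n)
    case 0 then show ?case using unit_lborel.prob_space by simp
  next
    case (Suc n)
    have "sqrt (LINT x|unit_lborel. (?f (Suc n) x)\<^sup>2) \<le> graphon_norm W * sqrt (LINT x|unit_lborel. (?f n x)\<^sup>2)"
      using kernel_op_norm_le[OF K ae m i] by simp
    also have "\<dots> \<le> graphon_norm W ^ Suc n" using Suc norm0 by (simp add: mult_left_mono)
    finally show ?case .
  qed
  have "path_density K n \<le> (LINT x|unit_lborel. \<bar>?f n x\<bar>)"
    using integral_abs_le_L2(1)[OF m i] unfolding path_density_def by (intro integral_mono integrable_abs) auto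
  also have "\<dots> \<le> sqrt (LINT x|unit_lborel. (?f n x)\<^sup>2)"
    using integral_abs_le_L2(2)[OF m i, of n] by (simp add: real_le_rsqrt)
  finally show ?thesis using le[of n] by linarith
qed

text \<open>Fubini exchanges the two integrations and symmetry of \<open>K\<close> identifies the
  result. The integrand on the square is dominated by \<open>B * |f y|\<close>, so it is enough that
  one factor is bounded.\<close>

lemma kernel_op_self_adjoint:
  assumes K: "unit_kernel K" and sym: "\<And>x y. K x y = K y x"
    and f: "integrable unit_lborel f" and g: "g \<in> borel_measurable unit_lborel" "\<And>x. \<bar>g x\<bar> \<le> B"
  shows "(LINT x|unit_lborel. kernel_op K f x * g x) = (LINT x|unit_lborel. f x * kernel_op K g x)"
proof -
  have [measurable]: "case_prod K \<in> borel_measurable (unit_lborel \<Otimes>\<^sub>M unit_lborel)"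
    and K01: "\<And>x y. 0 \<le> K x y" "\<And>x y. K x y \<le> 1"
    using K by (auto simp: unit_kernel_def)
  note [measurable] = g(1) borel_measurable_integrable[OF f]
  have B: "B \<ge> 0" using g(2)[of 0] by linarith
  have int: "integrable (unit_lborel \<Otimes>\<^sub>M unit_lborel) (\<lambda>(x, y). K x y * f y * g x)"
  proof (rule Bochner_Integration.integrable_bound)
    have "integrable (unit_lborel \<Otimes>\<^sub>M unit_lborel) (\<lambda>z. f (snd z))"
      using f by (intro unit_pair.Fubini_integrable) auto
    then show "integrable (unit_lborel \<Otimes>\<^sub>M unit_lborel) (\<lambda>z. B * f (snd z))"
      by simp
    have "\<bar>K x y * f y * g x\<bar> \<le> \<bar>B * f y\<bar>" for x y
    proof -
      have "\<bar>K x y * f y * g x\<bar> = (K x y * \<bar>g x\<bar>) * \<bar>f y\<bar>" using K01(1)[of x y] by (simp add: abs_mult)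
      also have "\<dots> \<le> (1 * B) * \<bar>f y\<bar>"
        using K01[of x y] g(2)[of x] B by (intro mult_right_mono mult_mono) auto
      finally show ?thesis using B by (simp add: abs_mult)
    qed
    then show "AE z in unit_lborel \<Otimes>\<^sub>M unit_lborel. norm (case z of (x, y) \<Rightarrow> K x y * f y * g x) \<le> norm (B * f (snd z))"
      by auto
  qed measurable
  have "(LINT x|unit_lborel. kernel_op K f x * g x) = (LINT x|unit_lborel. LINT y|unit_lborel. K x y * f y * g x)"
    by (simp add: kernel_op_def)
  also have "\<dots> = (LINT y|unit_lborel. LINT x|unit_lborel. K x y * f y * g x)"
    using unit_pair.Fubini_integral[OF int] by simp
  also have "\<dots> = (LINT y|unit_lborel. f y * kernel_op K g y)"
  proof (intro Bochner_Integration.integral_cong refl)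
    fix y
    have "(LINT x|unit_lborel. K x y * f y * g x) = (LINT x|unit_lborel. f y * (K y x * g x))"
      by (intro Bochner_Integration.integral_cong refl) (simp add: sym[of y])
    then show "(LINT x|unit_lborel. K x y * f y * g x) = f y * kernel_op K g y"
      by (simp add: kernel_op_def)
  qed
  finally show ?thesis .
qed


text \<open>Self-adjointness moves \<open>k\<close> of the \<open>2 * k\<close> operators to the
  other factor.\<close>

lemma path_density_even:
  assumes K: "unit_kernel K" and sym: "\<And>x y. K x y = K y x"
  shows "path_density K (2 * k) = (LINT x|unit_lborel. ((kernel_op K ^^ k) (\<lambda>_. 1) x)\<^sup>2)"
proof -
  let ?f = "\<lambda>n. (kernel_op K ^^ n) (\<lambda>_. 1)"
  have m: "?f n \<in> borel_measurable unit_lborel" and b: "\<bar>?f n x\<bar> \<le> 1" for n x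
    using kernel_op_power_bounded[OF K, of "\<lambda>_. 1"] by auto
  have "(LINT x|unit_lborel. ?f (a + b) x * 1) = (LINT x|unit_lborel. ?f a x * ?f b x)" for a b
  proof (induction b arbitrary: a)
    case (Suc c)
    have "(LINT x|unit_lborel. ?f (a + Suc c) x * 1) = (LINT x|unit_lborel. kernel_op K (?f a) x * ?f c x)"
      using Suc[of "Suc a"] by simp
    also have "\<dots> = (LINT x|unit_lborel. ?f a x * kernel_op K (?f c) x)"
      by (rule kernel_op_self_adjoint[OF K sym _ m b]) (rule integrable_unit_bounded[OF m b])
    finally show ?case by simp
  qed simp
  from this[of k k] show ?thesis
    by (simp add: path_density_def mult_2 power2_eq_square)
qed

text \<open>The numbers \<open>\<parallel>T\<^sup>k f\<parallel>\<^sup>2\<close> are log-convex in \<open>k\<close>, and \<open>\<bar>T f\<bar> \<le> 1\<close> gives \<open>\<bar>T\<^sup>k\<^sup>+\<^sup>1 f\<bar> \<le> T\<^sup>k 1\<close>.\<close>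

lemma path_density_ge_norm_power:
  assumes K: "unit_kernel K" and sym: "\<And>x y. K x y = K y x"
    and ae: "AE (x, y) in unit_lborel \<Otimes>\<^sub>M unit_lborel. W x y = K x y"
    and l: "0 \<le> l" "l < graphon_norm W"
  shows "l ^ (2 * k + 2) \<le> path_density K (2 * k)"
proof -
  let ?S = "{L2_norm_unit (graphon_operator W f) | f. square_integrable f \<and> L2_norm_unit f \<le> 1}"
  have "L2_norm_unit (\<lambda>_. 0) \<le> 1" "square_integrable (\<lambda>_. 0)"
    by (simp_all add: L2_norm_unit_def square_integrable_def)
  then have "?S \<noteq> {}" by blast
  then obtain f where f: "square_integrable f" "L2_norm_unit f \<le> 1" "l < L2_norm_unit (graphon_operator W f)"
    using l(2) bdd_above_graphon_norm[OF K ae] unfolding graphon_norm_def by (auto simp: less_cSup_iff)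
  obtain h where h: "h \<in> borel_measurable unit_lborel" "AE x in unit_lborel. f x = h x"
    "integrable unit_lborel (\<lambda>x. (h x)\<^sup>2)" "(L2_norm_unit f)\<^sup>2 = (LINT x|unit_lborel. (h x)\<^sup>2)"
    using square_integrable_borel_version[OF f(1)] .
  define c where "c n = (LINT x|unit_lborel. ((kernel_op K ^^ n) h x)\<^sup>2)" for n
  have "L2_norm_unit f \<ge> 0" by (simp add: L2_norm_unit_def)
  then have c0: "c 0 \<le> 1" using f(2) by (simp add: c_def h(4)[symmetric] power_le_one)
  have "l < sqrt (c 1)"
    using f(3) unfolding L2_norm_graphon_operator[OF K ae h(1,2)] by (simp add: c_def)
  then have "l\<^sup>2 < (sqrt (c 1))\<^sup>2" using l(1) by (intro power_strict_mono) auto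
  then have c1: "l\<^sup>2 < c 1" by (simp add: c_def)
  let ?g = "kernel_op K h"
  have gm: "?g \<in> borel_measurable unit_lborel" using kernel_op_measurable[OF K h(1)] .
  \<comment> \<open>The near-maximiser \<open>h\<close> may be unbounded, but one application of the
    operator brings it below 1 everywhere; the comparison with the iterates of 1 therefore starts
    from \<open>?g\<close>.\<close>
  have gb: "\<bar>?g x\<bar> \<le> 1" for x
    using kernel_op_square_integrable(1)[OF K h(1,3), of x] c0
    by (simp add: c_def abs_square_le_1[symmetric])
  have pow: "(kernel_op K ^^ Suc n) h = (kernel_op K ^^ n) ?g" for n by (simp add: funpow_swap1)
  have m: "(kernel_op K ^^ n) h \<in> borel_measurable unit_lborel" for n
    using h(1) kernel_op_power_bounded(1)[OF K gm gb] by (cases n) (auto simp: pow simp del: funpow.simps(2))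
  have b: "\<bar>(kernel_op K ^^ Suc n) h x\<bar> \<le> 1" for n x
    unfolding pow by (rule kernel_op_power_bounded(2)[OF K gm gb])
  have i: "integrable unit_lborel (\<lambda>x. ((kernel_op K ^^ n) h x)\<^sup>2)" for n
  proof (cases n)
    case (Suc p)
    show ?thesis
      unfolding Suc by (intro integrable_unit_bounded[where B=1] borel_measurable_power m)
        (use b in \<open>simp add: abs_square_le_1\<close>)
  qed (use h in simp)
  have conv: "(c (Suc n))\<^sup>2 \<le> c n * c (Suc (Suc n))" for n
  proof -
    have "c (Suc n) = (LINT x|unit_lborel. kernel_op K ((kernel_op K ^^ n) h) x * (kernel_op K ^^ Suc n) h x)"
      by (simp add: c_def power2_eq_square)
    also have "\<dots> = (LINT x|unit_lborel. (kernel_op K ^^ n) h x * kernel_op K ((kernel_op K ^^ Suc n) h) x)"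
      by (rule kernel_op_self_adjoint[OF K sym integral_abs_le_L2(1)[OF m i] m b])
    finally have "c (Suc n) = (LINT x|unit_lborel. (kernel_op K ^^ n) h x * (kernel_op K ^^ Suc (Suc n)) h x)" by simp
    then show ?thesis
      unfolding c_def using integral_Cauchy_Schwarz[OF m i m i, of n "Suc (Suc n)"] by simp
  qed
  \<comment> \<open>By log-convexity the ratio of consecutive terms never decreases, and it starts
    at \<open>l\<^sup>2\<close> or more since \<open>c 0 \<le> 1\<close> and
    \<open>c 1 > l\<^sup>2\<close>. Positivity is carried along because the argument divides by
    \<open>c n\<close>.\<close>
  have pos: "c (Suc n) > 0 \<and> l\<^sup>2 * c n \<le> c (Suc n)" for n
  proof (induction n)
    case 0
    have "l\<^sup>2 * c 0 \<le> l\<^sup>2 * 1" using c0 by (intro mult_left_mono) auto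
    moreover have "0 < c 1" using c1 zero_le_power2[of l] by linarith
    ultimately show ?case using c1 by simp
  next
    case (Suc n)
    have cn: "c n > 0"
    proof (rule ccontr)
      assume "\<not> c n > 0"
      then have "c n = 0" by (auto simp: c_def less_le)
      then show False using conv[of n] Suc by simp
    qed
    have "l\<^sup>2 * c (Suc n) * c n \<le> c (Suc n) * c (Suc n)"
      using mult_right_mono[of "l\<^sup>2 * c n" "c (Suc n)" "c (Suc n)"] Suc by (simp add: mult_ac)
    also have "\<dots> \<le> c (Suc (Suc n)) * c n" using conv[of n] by (simp add: power2_eq_square mult.commute)
    finally have le: "l\<^sup>2 * c (Suc n) \<le> c (Suc (Suc n))" using cn by simp
    have "0 < (c (Suc n))\<^sup>2" using Suc by simp
    then have "0 < c n * c (Suc (Suc n))" using conv[of n] by linarith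
    then show ?case using le cn by (simp add: zero_less_mult_iff)
  qed
  have geo: "l ^ (2 * n + 2) \<le> c (Suc n)" for n
  proof (induction n)
    case (Suc n)
    have "l ^ (2 * Suc n + 2) = l\<^sup>2 * l ^ (2 * n + 2)" by (simp add: power2_eq_square)
    also have "\<dots> \<le> l\<^sup>2 * c (Suc n)" using Suc by (intro mult_left_mono) auto
    also have "\<dots> \<le> c (Suc (Suc n))" using pos by blast
    finally show ?case .
  qed (use c1 in \<open>simp add: power2_eq_square\<close>)
  let ?f = "\<lambda>n. (kernel_op K ^^ n) (\<lambda>_. 1)"
  have fm: "?f n \<in> borel_measurable unit_lborel" and fb: "\<bar>?f n x\<bar> \<le> 1" for n x
    using kernel_op_power_bounded[OF K, of "\<lambda>_. 1"] by auto
  have dom: "\<bar>(kernel_op K ^^ n) ?g x\<bar> \<le> ?f n x" if "x \<in> {0..1}" for n x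
    using that
  proof (induction n arbitrary: x)
    case (Suc n)
    have "(kernel_op K ^^ n) ?g \<in> borel_measurable unit_lborel" using m[of "Suc n"] unfolding pow .
    then show ?case
      using kernel_op_mono_abs[OF K _ integrable_unit_bounded[OF fm fb] Suc.IH Suc.prems] by simp
  qed (use gb in simp)
  have "c (Suc k) \<le> (LINT x|unit_lborel. (?f k x)\<^sup>2)"
    unfolding c_def
  proof (rule integral_mono[OF i])
    show "integrable unit_lborel (\<lambda>x. (?f k x)\<^sup>2)"
      using fm fb by (intro integrable_unit_bounded[where B=1]) (auto simp: abs_square_le_1)
    fix x assume "x \<in> space unit_lborel"
    then have x: "x \<in> {0..1}" by (simp add: space_restrict_space)
    have "\<bar>(kernel_op K ^^ Suc k) h x\<bar> \<le> \<bar>?f k x\<bar>" using dom[OF x, of k] unfolding pow by simp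
    then show "((kernel_op K ^^ Suc k) h x)\<^sup>2 \<le> (?f k x)\<^sup>2" by (rule abs_le_square_iff[THEN iffD1])
  qed
  then show ?thesis using geo[of k] path_density_even[OF K sym, of k] by simp
qed

text \<open>The zero function shows that the norm is nonnegative, as the power bound requires; that
  bound at \<open>n = 1\<close> then puts the norm above the edge density.\<close>

lemma graphon_norm_pos:
  assumes K: "unit_kernel K" and ae: "AE (x, y) in unit_lborel \<Otimes>\<^sub>M unit_lborel. W x y = K x y"
    and pos: "path_density K 1 > 0"
  shows "graphon_norm W > 0"
proof -
  have "L2_norm_unit (graphon_operator W (\<lambda>_. 0)) = 0"
    by (simp add: L2_norm_unit_def graphon_operator_def)
  then have "0 \<le> graphon_norm W"
    unfolding graphon_norm_def
    by (intro cSup_upper2[OF _ _ bdd_above_graphon_norm[OF K ae], of 0] CollectI exI[of _ "\<lambda>_. 0"])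
      (auto simp: L2_norm_unit_def square_integrable_def)
  then show ?thesis
    using path_density_le_norm_power[OF K ae, of 1] pos by simp
qed

section \<open>The partition function below the threshold\<close>

lemma sum_PiE_insert_spin:
  fixes f :: "('a \<Rightarrow> real) \<Rightarrow> real"
  assumes "v \<notin> V"
  shows "(\<Sum>\<tau>\<in>insert v V \<rightarrow>\<^sub>E {-1, 1}. f \<tau>) = (\<Sum>\<tau>\<in>V \<rightarrow>\<^sub>E {-1, 1}. f (\<tau>(v := -1)) + f (\<tau>(v := 1)))"
proof -
  have inj: "inj_on (\<lambda>(y, g). g(v := y)) ({-1, 1 :: real} \<times> (V \<rightarrow>\<^sub>E {-1, 1}))"
    using inj_combinator[OF assms, of "\<lambda>_. {-1, 1 :: real}"] .
  have "(\<Sum>\<tau>\<in>insert v V \<rightarrow>\<^sub>E {-1, 1}. f \<tau>) = (\<Sum>(y, g)\<in>{-1, 1} \<times> (V \<rightarrow>\<^sub>E {-1, 1}). f (g(v := y)))"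
    unfolding PiE_insert_eq by (subst sum.reindex[OF inj]) (auto intro: sum.cong)
  also have "\<dots> = (\<Sum>y\<in>{-1, 1}. \<Sum>g\<in>V \<rightarrow>\<^sub>E {-1, 1}. f (g(v := y)))"
    by (rule sum.cartesian_product[symmetric])
  finally show ?thesis by (simp add: sum.distrib)
qed

lemma sinh_le_mult_cosh:
  fixes x :: real
  assumes "0 \<le> x"
  shows "sinh x \<le> x * cosh x"
proof -
  have "(\<lambda>x. x * cosh x - sinh x) 0 \<le> (\<lambda>x. x * cosh x - sinh x) x"
  proof (rule DERIV_nonneg_imp_nondecreasing[OF assms])
    fix y :: real assume "0 \<le> y" "y \<le> x"
    moreover have "((\<lambda>x. x * cosh x - sinh x) has_real_derivative y * sinh y) (at y)"
      by (auto intro!: derivative_eq_intros)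
    ultimately show "\<exists>d. ((\<lambda>x. x * cosh x - sinh x) has_real_derivative d) (at y) \<and> 0 \<le> d"
      by (auto intro!: exI[of _ "y * sinh y"])
  qed
  then show ?thesis by simp
qed

text \<open>The difference of the logarithms vanishes at 0 and has derivative
  \<open>x - tanh x\<close>, nonnegative for \<open>x \<ge> 0\<close>; evenness covers the other
  half-line.\<close>

lemma cosh_le_exp_half_square: "cosh x \<le> exp (x\<^sup>2 / 2)" for x :: real
proof -
  have *: "cosh x \<le> exp (x\<^sup>2 / 2)" if x: "0 \<le> x" for x :: real
  proof -
    have "(\<lambda>x. x\<^sup>2 / 2 - ln (cosh x)) 0 \<le> (\<lambda>x. x\<^sup>2 / 2 - ln (cosh x)) x"
    proof (rule DERIV_nonneg_imp_nondecreasing[OF x])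
      fix y :: real assume y: "0 \<le> y" "y \<le> x"
      have "((\<lambda>x. x\<^sup>2 / 2 - ln (cosh x)) has_real_derivative (y - sinh y / cosh y)) (at y)"
        by (auto intro!: derivative_eq_intros)
      moreover have "sinh y / cosh y \<le> y"
        using sinh_le_mult_cosh[OF y(1)] by (simp add: pos_divide_le_eq)
      ultimately show "\<exists>d. ((\<lambda>x. x\<^sup>2 / 2 - ln (cosh x)) has_real_derivative d) (at y) \<and> 0 \<le> d"
        by (intro exI[of _ "y - sinh y / cosh y"]) simp
    qed
    then have "ln (cosh x) \<le> x\<^sup>2 / 2" by simp
    then show ?thesis by (metis cosh_real_pos exp_le_cancel_iff exp_ln)
  qed
  show ?thesis using *[of "\<bar>x\<bar>"] by simp
qed

text \<open>
  Summing out one spin and bounding \<open>cosh m \<le> exp (m\<^sup>2 / 2)\<close> replaces \<open>B\<close> by a Schur complement,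
  exactly as for a Gaussian integral.  The hypothesis says that \<open>R\<close> dominates \<open>(1 - B)\<^sup>-\<^sup>1\<close>, a
  property inherited by Schur complements.
\<close>

lemma sum_exp_quadratic_le:
  fixes B R :: "'a \<Rightarrow> 'a \<Rightarrow> real"
  assumes "finite V"
    and "\<And>i j. i \<in> V \<Longrightarrow> j \<in> V \<Longrightarrow> B i j = B j i"
    and "\<And>i j. i \<in> V \<Longrightarrow> j \<in> V \<Longrightarrow> 0 \<le> B i j"
    and "\<And>i j. i \<in> V \<Longrightarrow> j \<in> V \<Longrightarrow> 0 \<le> R i j"
    and "\<And>i k. i \<in> V \<Longrightarrow> k \<in> V \<Longrightarrow> of_bool (i = k) + (\<Sum>j\<in>V. R i j * B j k) \<le> R i k"
  shows "(\<Sum>\<tau>\<in>V \<rightarrow>\<^sub>E {-1, 1}. exp ((\<Sum>i\<in>V. \<Sum>j\<in>V. \<tau> i * B i j * \<tau> j) / 2)) \<le> 2 ^ card V * (\<Prod>k\<in>V. sqrt (R k k))"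
  using assms
proof (induction V arbitrary: B rule: finite_induct)
  case (insert v V)
  note sym = insert.prems(1) and Bpos = insert.prems(2) and Rpos = insert.prems(3) and RB = insert.prems(4)
  \<comment> \<open>Schur complements acquire a diagonal even if the initial matrix has none. Since
    the square of a spin is 1, the diagonal entry contributes only the factor
    \<open>exp (d / 2)\<close>.\<close>
  define d where "d = B v v"
  have d0: "0 \<le> d" using Bpos by (simp add: d_def)
  \<comment> \<open>The hypothesis at \<open>i = k = v\<close>, with the nonnegative sum over
    \<open>V\<close> dropped, makes the pivot \<open>1 - d\<close> positive and bounds its inverse
    by \<open>R v v\<close>.\<close>
  have Rd: "1 \<le> R v v * (1 - d)"
  proof -
    have "0 \<le> (\<Sum>j\<in>V. R v j * B j v)" using Rpos Bpos by (intro sum_nonneg mult_nonneg_nonneg) auto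
    then show ?thesis using RB[of v v] insert.hyps by (simp add: d_def algebra_simps)
  qed
  have d1: "d < 1"
  proof (rule ccontr)
    assume "\<not> d < 1"
    then have "R v v * (1 - d) \<le> 0" using Rpos by (intro mult_nonneg_nonpos) auto
    then show False using Rd by linarith
  qed
  then have Rv: "1 / (1 - d) \<le> R v v" using Rd by (simp add: pos_divide_le_eq)
  have expd: "exp (d / 2) \<le> sqrt (R v v)"
  proof -
    have "1 - d \<le> exp (- d)" using exp_ge_add_one_self[of "- d"] by simp
    then have "exp d \<le> 1 / (1 - d)" using d1 by (simp add: exp_minus field_simps)
    then have "(exp (d / 2))\<^sup>2 \<le> R v v" using Rv by (simp flip: exp_double)
    then show ?thesis by (rule real_le_rsqrt)
  qed
  \<comment> \<open>\<open>1 - B'\<close> is the Schur complement of \<open>1 - B\<close> after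
    eliminating \<open>v\<close>.\<close>
  define B' where "B' i j = B i j + B i v * B v j / (1 - d)" for i j
  define Q where "Q C \<tau> = (\<Sum>i\<in>V. \<Sum>j\<in>V. \<tau> i * C i j * \<tau> j)" for C :: "'a \<Rightarrow> 'a \<Rightarrow> real" and \<tau> :: "'a \<Rightarrow> real"
  define m where "m \<tau> = (\<Sum>j\<in>V. B v j * \<tau> j)" for \<tau> :: "'a \<Rightarrow> real"
  have QB': "Q B' \<tau> = Q B \<tau> + (m \<tau>)\<^sup>2 / (1 - d)" for \<tau>
  proof -
    have "(m \<tau>)\<^sup>2 = (\<Sum>i\<in>V. \<Sum>j\<in>V. \<tau> i * (B i v * B v j) * \<tau> j)"
      unfolding m_def power2_eq_square sum_product
      by (intro sum.cong refl) (use sym in \<open>simp add: mult_ac\<close>)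
    then have "(m \<tau>)\<^sup>2 / (1 - d) = (\<Sum>i\<in>V. \<Sum>j\<in>V. \<tau> i * (B i v * B v j / (1 - d)) * \<tau> j)"
      by (simp add: sum_divide_distrib)
    then show ?thesis
      unfolding Q_def B'_def by (simp add: distrib_left distrib_right sum.distrib)
  qed
  have full: "(\<Sum>i\<in>insert v V. \<Sum>j\<in>insert v V. (\<tau>(v := s)) i * B i j * (\<tau>(v := s)) j) = Q B \<tau> + 2 * s * m \<tau> + s\<^sup>2 * d"
    for \<tau> s
  proof -
    have a: "(\<Sum>i\<in>V. (\<tau>(v := s)) i * B i v * (\<tau>(v := s)) v) = s * m \<tau>"
      unfolding m_def sum_distrib_left using insert.hyps sym by (intro sum.cong refl) auto
    have b: "(\<Sum>j\<in>V. (\<tau>(v := s)) v * B v j * (\<tau>(v := s)) j) = s * m \<tau>"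
      unfolding m_def sum_distrib_left using insert.hyps by (intro sum.cong refl) auto
    have c: "(\<Sum>i\<in>V. \<Sum>j\<in>V. (\<tau>(v := s)) i * B i j * (\<tau>(v := s)) j) = Q B \<tau>"
      unfolding Q_def using insert.hyps by (intro sum.cong refl) auto
    show ?thesis
      unfolding sum.insert[OF insert.hyps] sum.distrib a b c by (simp add: d_def power2_eq_square)
  qed
  have step: "exp ((Q B \<tau> + 2 * (-1) * m \<tau> + (-1)\<^sup>2 * d) / 2) + exp ((Q B \<tau> + 2 * 1 * m \<tau> + 1\<^sup>2 * d) / 2) \<le>
      2 * sqrt (R v v) * exp (Q B' \<tau> / 2)" for \<tau>
  proof -
    have e: "exp ((Q B \<tau> + 2 * s * m \<tau> + s\<^sup>2 * d) / 2) = exp (d / 2) * (exp (Q B \<tau> / 2) * exp (s * m \<tau>))"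
      if "s\<^sup>2 = 1" for s
      unfolding that exp_add[symmetric] by (simp add: add_divide_distrib)
    have "exp ((Q B \<tau> + 2 * (-1) * m \<tau> + (-1)\<^sup>2 * d) / 2) + exp ((Q B \<tau> + 2 * 1 * m \<tau> + 1\<^sup>2 * d) / 2)
       = 2 * exp (d / 2) * (exp (Q B \<tau> / 2) * cosh (m \<tau>))"
      by (subst e, simp, subst e, simp, simp add: cosh_field_def algebra_simps)
    also have "\<dots> \<le> 2 * sqrt (R v v) * (exp (Q B \<tau> / 2) * exp ((m \<tau>)\<^sup>2 / (1 - d) / 2))"
    proof (intro mult_mono)
      have "(m \<tau>)\<^sup>2 \<le> (m \<tau>)\<^sup>2 / (1 - d)"
        using d0 d1 by (simp add: pos_le_divide_eq mult_left_le)
      then show "cosh (m \<tau>) \<le> exp ((m \<tau>)\<^sup>2 / (1 - d) / 2)"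
        by (intro order_trans[OF cosh_le_exp_half_square])
          (simp only: exp_le_cancel_iff divide_right_mono zero_le_numeral)
    qed (use expd Rpos in auto)
    also have "\<dots> = 2 * sqrt (R v v) * exp (Q B' \<tau> / 2)"
      by (simp add: QB' add_divide_distrib exp_add)
    finally show ?thesis .
  qed
  have IH: "(\<Sum>\<tau>\<in>V \<rightarrow>\<^sub>E {-1, 1}. exp (Q B' \<tau> / 2)) \<le> 2 ^ card V * (\<Prod>k\<in>V. sqrt (R k k))"
    unfolding Q_def
  proof (rule insert.IH)
    fix i k assume ik: "i \<in> V" "k \<in> V"
    show "B' i k = B' k i" "0 \<le> B' i k" "0 \<le> R i k"
      using ik sym[of i k] sym[of i v] sym[of k v] Bpos[of i k] Bpos[of i v] Bpos[of v k] Rpos[of i k] d1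
      by (auto simp: B'_def intro!: add_nonneg_nonneg divide_nonneg_nonneg mult_nonneg_nonneg)
    \<comment> \<open>Column \<open>v\<close> of the hypothesis shows that the term
      \<open>R i v * B v k\<close>, present in the inequality for \<open>insert v V\<close>, pays
      for all that the elimination adds to \<open>B\<close>. So the inequality persists on
      \<open>V\<close> with the same \<open>R\<close>.\<close>
    have "i \<noteq> v" using ik insert.hyps by auto
    then have "(\<Sum>j\<in>V. R i j * B j v) \<le> R i v * (1 - d)"
      using RB[of i v] ik insert.hyps by (simp add: d_def algebra_simps)
    then have "(\<Sum>j\<in>V. R i j * B j v) / (1 - d) \<le> R i v" using d1 by (simp add: pos_divide_le_eq)
    then have "(\<Sum>j\<in>V. R i j * B j v) / (1 - d) * B v k \<le> R i v * B v k"
      using Bpos ik by (intro mult_right_mono) auto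
    moreover have "(\<Sum>j\<in>V. R i j * B' j k) = (\<Sum>j\<in>V. R i j * B j k) + (\<Sum>j\<in>V. R i j * B j v) / (1 - d) * B v k"
      by (simp add: B'_def distrib_left sum.distrib sum_divide_distrib sum_distrib_left sum_distrib_right mult_ac)
    moreover have "of_bool (i = k) + (R i v * B v k + (\<Sum>j\<in>V. R i j * B j k)) \<le> R i k"
      using RB[of i k] ik insert.hyps by simp
    ultimately show "of_bool (i = k) + (\<Sum>j\<in>V. R i j * B' j k) \<le> R i k" by linarith
  qed
  have "(\<Sum>\<tau>\<in>insert v V \<rightarrow>\<^sub>E {-1, 1}. exp ((\<Sum>i\<in>insert v V. \<Sum>j\<in>insert v V. \<tau> i * B i j * \<tau> j) / 2)) \<le>
      (\<Sum>\<tau>\<in>V \<rightarrow>\<^sub>E {-1, 1}. 2 * sqrt (R v v) * exp (Q B' \<tau> / 2))"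
    unfolding sum_PiE_insert_spin[OF insert.hyps(2)] full by (intro sum_mono step)
  also have "\<dots> = 2 * sqrt (R v v) * (\<Sum>\<tau>\<in>V \<rightarrow>\<^sub>E {-1, 1}. exp (Q B' \<tau> / 2))"
    by (simp add: sum_distrib_left)
  also have "\<dots> \<le> 2 * sqrt (R v v) * (2 ^ card V * (\<Prod>k\<in>V. sqrt (R k k)))"
    using IH Rpos by (intro mult_left_mono) auto
  finally show ?case using insert.hyps by (simp add: mult_ac)
qed simp

section \<open>Graph couplings and the bound on their partition functions\<close>

definition graph_coupling :: "nat \<Rightarrow> (nat \<Rightarrow> nat \<Rightarrow> real) \<Rightarrow> bool" where
  "graph_coupling N J \<longleftrightarrow> N \<ge> 1 \<and> (\<forall>i j. J i j = J j i \<and> 0 \<le> J i j \<and> J i j \<le> 1 / real N) \<and> (\<forall>i. J i i = 0)"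

lemma graph_coupling_adjacency:
  assumes "simple_graph {1..N} E" "N \<ge> 1" "\<And>i j. J i j = 1 / real N * adjacency E i j"
  shows "graph_coupling N J"
proof -
  have "{i} \<notin> E" for i
  proof
    assume "{i} \<in> E"
    then have "card {i} = 2" using assms(1) unfolding simple_graph_def by blast
    then show False by simp
  qed
  then show ?thesis
    using assms(2) by (auto simp: graph_coupling_def assms(3) adjacency_def insert_commute)
qed

lemma walk_bounds:
  assumes J: "graph_coupling N J"
  shows "0 \<le> walk N J n i" "walk N J n i \<le> 1"
proof (induction n arbitrary: i)
  case (Suc n)
  { case 1 show ?case using J Suc by (auto simp: walk_Suc graph_coupling_def intro!: sum_nonneg) }
  { case 2
    have "walk N J (Suc n) i \<le> (\<Sum>j\<in>{1..N}. 1 / real N * 1)"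
      unfolding walk_Suc using J Suc by (intro sum_mono mult_mono) (auto simp: graph_coupling_def)
    also have "\<dots> \<le> 1" by simp
    finally show ?case . }
qed auto

lemma walk_mean_nonneg:
  assumes "graph_coupling N J"
  shows "0 \<le> walk_mean N J n"
  using walk_bounds(1)[OF assms] by (simp add: walk_mean_def sum_nonneg)

definition partition_sum :: "nat \<Rightarrow> (nat \<Rightarrow> nat \<Rightarrow> real) \<Rightarrow> real \<Rightarrow> real" where
  "partition_sum N J \<beta> = (\<Sum>\<tau>\<in>spins N. exp (\<beta> / 2 * hamiltonian N J \<tau>))"

text \<open>In \<open>(1 - \<beta> J)^-1 = 1 + \<beta> J + \<beta>^2 J^2 (1 - \<beta> J)^-1\<close>
  the entries of \<open>J^2\<close> are at most \<open>1 / N\<close>. The last term is therefore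
  dominated by a matrix all of whose rows are \<open>\<beta>^2 / N\<close> times a supersolution
  \<open>w\<close> of \<open>w = 1 + \<beta> J w\<close>; bounded \<open>w\<close> gives it bounded
  trace.\<close>

lemma partition_sum_bounded:
  assumes J: "graph_coupling N J" and b: "0 \<le> \<beta>" and q: "q < 1"
    and m: "\<beta> ^ Suc m * walk_mean N J m \<le> q"
  shows "partition_sum N J \<beta> \<le> 2 ^ N * exp (\<beta>\<^sup>2 / 2 * (1 / (1 - q) * (\<Sum>n\<le>m. \<beta> ^ n)))"
proof -
  have N: "N \<ge> 1" and Jsym: "J i j = J j i" and J0: "0 \<le> J i j" and JN: "J i j \<le> 1 / real N" and Jd: "J i i = 0" for i j
    using J by (auto simp: graph_coupling_def)
  define C where "C = 1 / (1 - q) * (\<Sum>n\<le>m. \<beta> ^ n)"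
  \<comment> \<open>The Neumann series of the constant 1 is cut after the power \<open>m\<close>;
    dividing by \<open>1 - q\<close> makes up for the next term, which is at most
    \<open>q\<close>.\<close>
  define w where "w k = 1 / (1 - q) * (\<Sum>n\<le>m. \<beta> ^ n * walk N J n k)" for k
  define c where "c = \<beta>\<^sup>2 / real N"
  have c0: "0 \<le> c" by (simp add: c_def)
  define R where "R i k = of_bool (i = k) + \<beta> * J i k + c * w k" for i k
  have w0: "0 \<le> w k" for k
    using q b walk_bounds(1)[OF J] by (auto simp: w_def intro!: divide_nonneg_nonneg sum_nonneg)
  have wC: "w k \<le> C" for k
    unfolding w_def C_def using q b walk_bounds(2)[OF J]
    by (intro mult_left_mono sum_mono) (auto intro!: mult_left_le)
  have R0: "0 \<le> R i k" for i k using b J0 w0 c0 by (auto simp: R_def intro!: add_nonneg_nonneg)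
  have super: "1 + \<beta> * (\<Sum>j\<in>{1..N}. w j * J j k) \<le> w k" for k
  proof -
    have "(\<Sum>j\<in>{1..N}. w j * J j k) = 1 / (1 - q) * (\<Sum>j\<in>{1..N}. \<Sum>n\<le>m. \<beta> ^ n * (J k j * walk N J n j))"
      by (simp add: w_def sum_distrib_left sum_distrib_right sum_divide_distrib Jsym[of k] mult_ac)
    also have "(\<Sum>j\<in>{1..N}. \<Sum>n\<le>m. \<beta> ^ n * (J k j * walk N J n j)) = (\<Sum>n\<le>m. \<beta> ^ n * walk N J (Suc n) k)"
      by (subst sum.swap) (simp add: walk_Suc sum_distrib_left)
    finally have "1 + \<beta> * (\<Sum>j\<in>{1..N}. w j * J j k) = 1 + 1 / (1 - q) * (\<Sum>n\<le>m. \<beta> ^ Suc n * walk N J (Suc n) k)"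
      by (simp add: sum_distrib_left mult_ac)
    also have "(\<Sum>n\<le>m. \<beta> ^ Suc n * walk N J (Suc n) k) = (\<Sum>n\<le>Suc m. \<beta> ^ n * walk N J n k) - 1"
      by (subst sum.atMost_Suc_shift) simp
    also have "\<dots> = (\<Sum>n\<le>m. \<beta> ^ n * walk N J n k) + \<beta> ^ Suc m * walk N J (Suc m) k - 1"
      by simp
    also have "1 + 1 / (1 - q) * \<dots> \<le> 1 + 1 / (1 - q) * ((\<Sum>n\<le>m. \<beta> ^ n * walk N J n k) + q - 1)"
    \<comment> \<open>As the entries of \<open>J\<close> are at most \<open>1 / N\<close>, the walk
      weight at any single vertex is at most the mean weight one step shorter. Thus the assumption
      on the mean controls every vertex.\<close>
    proof -
      have "walk N J (Suc m) k \<le> (\<Sum>j\<in>{1..N}. 1 / real N * walk N J m j)"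
        unfolding walk_Suc by (intro sum_mono mult_right_mono JN walk_bounds[OF J])
      then have "\<beta> ^ Suc m * walk N J (Suc m) k \<le> \<beta> ^ Suc m * walk_mean N J m"
        using b by (intro mult_left_mono) (auto simp: walk_mean_def sum_distrib_left)
      then show ?thesis using q m by (intro add_left_mono mult_left_mono) auto
    qed
    also have "\<dots> = w k"
      using q by (simp add: w_def field_simps)
    finally show ?thesis .
  qed
  have RB: "of_bool (i = k) + (\<Sum>j\<in>{1..N}. R i j * (\<beta> * J j k)) \<le> R i k" if "i \<in> {1..N}" for i k
  proof -
    have "(\<Sum>j\<in>{1..N}. R i j * (\<beta> * J j k)) =
      (\<Sum>j\<in>{1..N}. of_bool (i = j) * (\<beta> * J j k)) + \<beta>\<^sup>2 * (\<Sum>j\<in>{1..N}. J i j * J j k)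
        + c * (\<beta> * (\<Sum>j\<in>{1..N}. w j * J j k))"
      unfolding R_def by (simp add: algebra_simps sum.distrib sum_distrib_left power2_eq_square)
    also have "(\<Sum>j\<in>{1..N}. of_bool (i = j) * (\<beta> * J j k)) = \<beta> * J i k"
      using that by (simp add: of_bool_def if_distrib[of "\<lambda>x. x * _"] cong: if_cong)
    also have "\<beta>\<^sup>2 * (\<Sum>j\<in>{1..N}. J i j * J j k) \<le> \<beta>\<^sup>2 * (1 / real N)"
    proof (intro mult_left_mono)
      have "(\<Sum>j\<in>{1..N}. J i j * J j k) \<le> (\<Sum>j\<in>{1..N}. 1 / real N * (1 / real N))"
        using J0 JN by (intro sum_mono mult_mono) auto
      then show "(\<Sum>j\<in>{1..N}. J i j * J j k) \<le> 1 / real N" using N by simp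
    qed simp
    finally have "(\<Sum>j\<in>{1..N}. R i j * (\<beta> * J j k)) \<le>
        \<beta> * J i k + c * (1 + \<beta> * (\<Sum>j\<in>{1..N}. w j * J j k))"
      by (simp add: distrib_left c_def)
    also have "\<dots> \<le> \<beta> * J i k + c * w k"
      by (intro add_left_mono mult_left_mono super c0)
    finally show ?thesis by (simp add: R_def)
  qed
  have "partition_sum N J \<beta> = (\<Sum>\<tau>\<in>{1..N} \<rightarrow>\<^sub>E {-1, 1}. exp ((\<Sum>i\<in>{1..N}. \<Sum>j\<in>{1..N}. \<tau> i * (\<beta> * J i j) * \<tau> j) / 2))"
    by (simp add: partition_sum_def spins_def hamiltonian_def sum_distrib_left sum_divide_distrib mult_ac)
  also have "\<dots> \<le> 2 ^ card {1..N} * (\<Prod>k\<in>{1..N}. sqrt (R k k))"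
    by (rule sum_exp_quadratic_le) (use b J0 R0 RB in \<open>auto simp: Jsym\<close>)
  also have "\<dots> \<le> 2 ^ card {1..N} * (\<Prod>k\<in>{1..N}. exp (\<beta>\<^sup>2 * C / real N / 2))"
  \<comment> \<open>The diagonal of \<open>J\<close> vanishes, so \<open>R k k\<close> exceeds 1 by
    at most \<open>\<beta>\<^sup>2 * C / N\<close>, and the \<open>N\<close> square roots multiply
    to a bounded number.\<close>
  proof (intro mult_left_mono prod_mono conjI)
    fix k
    have "R k k \<le> 1 + \<beta>\<^sup>2 * C / real N"
      using mult_left_mono[OF wC[of k] c0] by (simp add: R_def Jd c_def)
    also have "\<dots> \<le> exp (\<beta>\<^sup>2 * C / real N)" by (rule exp_ge_add_one_self)
    also have "\<dots> = (exp (\<beta>\<^sup>2 * C / real N / 2))\<^sup>2" by (simp flip: exp_double)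
    finally show "sqrt (R k k) \<le> exp (\<beta>\<^sup>2 * C / real N / 2)" by (rule real_le_lsqrt[rotated -1]) (auto simp: R0)
  qed (use R0 in auto)
  also have "\<dots> = 2 ^ N * exp (\<beta>\<^sup>2 / 2 * C)"
    using N by (simp flip: exp_of_nat_mult)
  finally show ?thesis by (simp add: C_def)
qed

section \<open>Contiguity of Ising measures\<close>

lemma finite_spins [simp]: "finite (spins N)"
  by (simp add: spins_def finite_PiE)

lemma card_spins: "card (spins N) = 2 ^ N"
  by (simp add: spins_def card_PiE card_insert_if numeral_2_eq_2)

lemma spins_nonempty: "spins N \<noteq> {}"
  using card_spins[of N] by auto

lemma partition_sum_pos: "partition_sum N J \<beta> > 0"
  unfolding partition_sum_def using spins_nonempty by (intro sum_pos) auto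

lemma ising_weight:
  "1 / 2 ^ N * exp (\<beta> / 2 * hamiltonian N J \<tau> - log_partition N J \<beta>) =
    exp (\<beta> / 2 * hamiltonian N J \<tau>) / partition_sum N J \<beta>"
proof -
  have "exp (log_partition N J \<beta>) = partition_sum N J \<beta> / 2 ^ N"
    using partition_sum_pos[of N J \<beta>]
    unfolding log_partition_def partition_sum_def[symmetric] by (subst exp_ln) auto
  then show ?thesis by (simp add: exp_diff)
qed

lemma ising_altdef:
  "ising N J \<beta> = point_measure (spins N) (\<lambda>\<tau>. ennreal (exp (\<beta> / 2 * hamiltonian N J \<tau>) / partition_sum N J \<beta>))"
  by (simp only: ising_def ising_weight)

lemma integral_ising:
  "(LINT \<tau>|ising N J \<beta>. f \<tau>) = (\<Sum>\<tau>\<in>spins N. exp (\<beta> / 2 * hamiltonian N J \<tau>) * f \<tau>) / partition_sum N J \<beta>"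
  for f :: "(nat \<Rightarrow> real) \<Rightarrow> real"
  unfolding ising_altdef using partition_sum_pos[of N J \<beta>]
  by (subst lebesgue_integral_point_measure_finite) (auto simp: sum_divide_distrib)

lemma measure_ising:
  assumes "A \<subseteq> spins N"
  shows "measure (ising N J \<beta>) A = (\<Sum>\<tau>\<in>A. exp (\<beta> / 2 * hamiltonian N J \<tau>)) / partition_sum N J \<beta>"
proof -
  have "emeasure (ising N J \<beta>) A = (\<Sum>\<tau>\<in>A. ennreal (exp (\<beta> / 2 * hamiltonian N J \<tau>) / partition_sum N J \<beta>))"
    unfolding ising_altdef using assms by (intro emeasure_point_measure_finite) auto
  also have "\<dots> = ennreal (\<Sum>\<tau>\<in>A. exp (\<beta> / 2 * hamiltonian N J \<tau>) / partition_sum N J \<beta>)"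
    using partition_sum_pos[of N J \<beta>] by (intro sum_ennreal) auto
  finally show ?thesis
    using partition_sum_pos[of N J \<beta>]
    by (simp add: measure_def sum_divide_distrib sum_nonneg)
qed

section \<open>Spin flips and the comparison of Gibbs measures\<close>

definition flip :: "nat \<Rightarrow> (nat \<Rightarrow> real) \<Rightarrow> nat \<Rightarrow> real" where
  "flip i \<tau> = \<tau>(i := - \<tau> i)"

lemma flip_apply: "flip i \<tau> j = (if j = i then - \<tau> i else \<tau> j)"
  by (simp add: flip_def)

lemma flip_flip [simp]: "flip i (flip i \<tau>) = \<tau>"
  by (simp add: flip_def fun_eq_iff)

lemma flip_spins: "\<tau> \<in> spins N \<Longrightarrow> i \<in> {1..N} \<Longrightarrow> flip i \<tau> \<in> spins N"
  by (auto simp: spins_def flip_apply PiE_iff extensional_def)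

lemma sum_spins_flip:
  assumes "i \<in> {1..N}"
  shows "(\<Sum>\<tau>\<in>spins N. f (flip i \<tau>)) = (\<Sum>\<tau>\<in>spins N. f \<tau>)"
  using assms by (intro sum.reindex_bij_witness[of _ "flip i" "flip i"]) (auto simp: flip_spins)

lemma spin_cases: "\<tau> \<in> spins N \<Longrightarrow> i \<in> {1..N} \<Longrightarrow> \<tau> i = 1 \<or> \<tau> i = -1"
  by (auto simp: spins_def PiE_iff)

text \<open>Under uniform spins the energy has mean 0: the diagonal of \<open>J\<close> vanishes and
  flipping one spin reverses each off-diagonal term. The bound is then
  \<open>exp x \<ge> 1 + x\<close>, summed.\<close>

lemma partition_sum_ge:
  assumes J: "graph_coupling N J"
  shows "2 ^ N \<le> partition_sum N J \<beta>"
proof -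
  have pair: "(\<Sum>\<tau>\<in>spins N. \<tau> i * J i j * \<tau> j) = 0" if "i \<in> {1..N}" for i j
  proof (cases "i = j")
    case False
    have "(\<Sum>\<tau>\<in>spins N. \<tau> i * J i j * \<tau> j) = (\<Sum>\<tau>\<in>spins N. flip i \<tau> i * J i j * flip i \<tau> j)"
      by (rule sum_spins_flip[OF that, symmetric])
    also have "\<dots> = - (\<Sum>\<tau>\<in>spins N. \<tau> i * J i j * \<tau> j)"
      using False by (simp add: flip_apply sum_negf)
    finally show ?thesis by simp
  qed (use J in \<open>simp add: graph_coupling_def\<close>)
  have "(\<Sum>\<tau>\<in>spins N. hamiltonian N J \<tau>) = (\<Sum>i\<in>{1..N}. \<Sum>j\<in>{1..N}. \<Sum>\<tau>\<in>spins N. \<tau> i * J i j * \<tau> j)"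
    unfolding hamiltonian_def by (subst sum.swap, intro sum.cong refl, rule sum.swap)
  also have "\<dots> = 0" using pair by simp
  finally have "2 ^ N = (\<Sum>\<tau>\<in>spins N. 1 + \<beta> / 2 * hamiltonian N J \<tau>)"
    by (simp only: sum.distrib sum_distrib_left[symmetric]) (simp add: card_spins)
  also have "\<dots> \<le> partition_sum N J \<beta>"
    unfolding partition_sum_def by (intro sum_mono) (rule exp_ge_add_one_self)
  finally show ?thesis .
qed

text \<open>With half the energy cut at a level \<open>k\<close>, the likelihood ratio of
  \<open>\<beta>\<^sub>2\<close> to \<open>\<beta>\<^sub>1\<close> is bounded below
  \<open>k\<close>, while above \<open>k\<close> the weight at \<open>\<beta>\<^sub>2\<close> is an
  exponentially small multiple of that at \<open>\<beta>\<^sub>3\<close>. A test whose size tends to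
  0 thus has limiting power at most \<open>1 / 4\<close>.\<close>

lemma no_consistent_tests_of_bounded_partition:
  assumes b: "\<beta>\<^sub>1 < \<beta>\<^sub>2" "\<beta>\<^sub>2 < \<beta>\<^sub>3" and C: "C > 0"
    and ev: "eventually (\<lambda>N. graph_coupling N (J N) \<and> partition_sum N (J N) \<beta>\<^sub>1 \<le> 2 ^ N * C \<and>
      partition_sum N (J N) \<beta>\<^sub>3 \<le> 2 ^ N * C) sequentially"
  shows "\<not> consistent_tests J \<beta>\<^sub>1 \<beta>\<^sub>2 \<phi>"
proof
  assume cons: "consistent_tests J \<beta>\<^sub>1 \<beta>\<^sub>2 \<phi>"
  define E where "E \<beta> N = (LINT \<tau> | ising N (J N) \<beta>. \<phi> N \<tau>)" for \<beta> N
  have lim: "E \<beta>\<^sub>1 \<longlonglongrightarrow> 0" "E \<beta>\<^sub>2 \<longlonglongrightarrow> 1"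
    using cons unfolding consistent_tests_def E_def by blast+
  \<comment> \<open>This level makes the tail factor, multiplied by the bound \<open>C\<close> on
    the partition functions, at most \<open>1 / 4\<close>.\<close>
  define k where "k = \<bar>ln (4 * C)\<bar> / (\<beta>\<^sub>3 - \<beta>\<^sub>2)"
  have k: "exp (- ((\<beta>\<^sub>3 - \<beta>\<^sub>2) * k)) * C \<le> 1 / 4"
  proof -
    have "exp (- ((\<beta>\<^sub>3 - \<beta>\<^sub>2) * k)) \<le> exp (- ln (4 * C))" using b by (simp add: k_def)
    also have "\<dots> = 1 / (4 * C)" using C by (simp add: exp_minus inverse_eq_divide)
    finally show ?thesis using C by (simp add: field_simps)
  qed
  define A where "A = exp ((\<beta>\<^sub>2 - \<beta>\<^sub>1) * k)"
  have A: "A > 0" by (simp add: A_def)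
  have split: "exp (\<beta>\<^sub>2 * h) \<le> A * exp (\<beta>\<^sub>1 * h) + exp (- ((\<beta>\<^sub>3 - \<beta>\<^sub>2) * k)) * exp (\<beta>\<^sub>3 * h)" for h
  proof (cases "h \<le> k")
    case True
    then have "(\<beta>\<^sub>2 - \<beta>\<^sub>1) * h \<le> (\<beta>\<^sub>2 - \<beta>\<^sub>1) * k" using b by (intro mult_left_mono) auto
    then have "exp (\<beta>\<^sub>2 * h) \<le> A * exp (\<beta>\<^sub>1 * h)"
      unfolding A_def exp_add[symmetric] exp_le_cancel_iff by (simp add: left_diff_distrib)
    then show ?thesis
      using mult_pos_pos[OF exp_gt_zero[of "- ((\<beta>\<^sub>3 - \<beta>\<^sub>2) * k)"] exp_gt_zero[of "\<beta>\<^sub>3 * h"]] by linarith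
  next
    case False
    then have "(\<beta>\<^sub>3 - \<beta>\<^sub>2) * k \<le> (\<beta>\<^sub>3 - \<beta>\<^sub>2) * h" using b by (intro mult_left_mono) auto
    then have "exp (\<beta>\<^sub>2 * h) \<le> exp (- ((\<beta>\<^sub>3 - \<beta>\<^sub>2) * k)) * exp (\<beta>\<^sub>3 * h)"
      unfolding exp_add[symmetric] exp_le_cancel_iff by (simp add: left_diff_distrib)
    then show ?thesis
      using mult_pos_pos[OF A exp_gt_zero[of "\<beta>\<^sub>1 * h"]] by linarith
  qed
  have "eventually (\<lambda>N. E \<beta>\<^sub>2 N \<le> A * C * E \<beta>\<^sub>1 N + 1 / 4) sequentially"
    using ev eventually_ge_at_top[of 1]
  proof eventually_elim
    case (elim N)
    have phi: "0 \<le> \<phi> N \<tau>" "\<phi> N \<tau> \<le> 1" if "\<tau> \<in> spins N" for \<tau>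
    proof -
      have "\<phi> N \<tau> \<in> {0, 1}" using cons that elim(2) unfolding consistent_tests_def by blast
      then show "0 \<le> \<phi> N \<tau>" "\<phi> N \<tau> \<le> 1" by auto
    qed
    define S where "S \<beta> = (\<Sum>\<tau>\<in>spins N. exp (\<beta> / 2 * hamiltonian N (J N) \<tau>) * \<phi> N \<tau>)" for \<beta>
    have ES: "E \<beta> N = S \<beta> / partition_sum N (J N) \<beta>" for \<beta> by (simp add: E_def S_def integral_ising)
    have S0: "0 \<le> S \<beta>" for \<beta> unfolding S_def by (intro sum_nonneg mult_nonneg_nonneg phi) auto
    have S3: "S \<beta>\<^sub>3 \<le> 2 ^ N * C"
    proof -
      have "S \<beta>\<^sub>3 \<le> partition_sum N (J N) \<beta>\<^sub>3"
        unfolding S_def partition_sum_def by (intro sum_mono mult_left_le phi) simp_all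
      then show ?thesis using elim(1) by linarith
    qed
    have "S \<beta>\<^sub>1 = E \<beta>\<^sub>1 N * partition_sum N (J N) \<beta>\<^sub>1"
      using partition_sum_pos[of N "J N" \<beta>\<^sub>1] by (simp add: ES)
    also have "\<dots> \<le> E \<beta>\<^sub>1 N * (2 ^ N * C)"
      using elim(1) S0[of \<beta>\<^sub>1] partition_sum_pos[of N "J N" \<beta>\<^sub>1] by (intro mult_left_mono) (auto simp: ES)
    finally have S1: "S \<beta>\<^sub>1 \<le> E \<beta>\<^sub>1 N * (2 ^ N * C)" .
    have "S \<beta>\<^sub>2 \<le> (\<Sum>\<tau>\<in>spins N. A * (exp (\<beta>\<^sub>1 / 2 * hamiltonian N (J N) \<tau>) * \<phi> N \<tau>) +
        exp (- ((\<beta>\<^sub>3 - \<beta>\<^sub>2) * k)) * (exp (\<beta>\<^sub>3 / 2 * hamiltonian N (J N) \<tau>) * \<phi> N \<tau>))"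
      unfolding S_def
    proof (rule sum_mono)
      fix \<tau> assume "\<tau> \<in> spins N"
      then show "exp (\<beta>\<^sub>2 / 2 * hamiltonian N (J N) \<tau>) * \<phi> N \<tau> \<le> A * (exp (\<beta>\<^sub>1 / 2 * hamiltonian N (J N) \<tau>) * \<phi> N \<tau>) +
        exp (- ((\<beta>\<^sub>3 - \<beta>\<^sub>2) * k)) * (exp (\<beta>\<^sub>3 / 2 * hamiltonian N (J N) \<tau>) * \<phi> N \<tau>)"
        using mult_right_mono[OF split[of "hamiltonian N (J N) \<tau> / 2"] phi(1)] by (simp add: algebra_simps)
    qed
    also have "\<dots> = A * S \<beta>\<^sub>1 + exp (- ((\<beta>\<^sub>3 - \<beta>\<^sub>2) * k)) * S \<beta>\<^sub>3"
      by (simp add: S_def sum.distrib sum_distrib_left)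
    also have "\<dots> \<le> A * (E \<beta>\<^sub>1 N * (2 ^ N * C)) + exp (- ((\<beta>\<^sub>3 - \<beta>\<^sub>2) * k)) * (2 ^ N * C)"
      using S1 S3 A by (intro add_mono mult_left_mono) auto
    also have "\<dots> = 2 ^ N * (A * C * E \<beta>\<^sub>1 N) + 2 ^ N * (exp (- ((\<beta>\<^sub>3 - \<beta>\<^sub>2) * k)) * C)"
      by simp
    also have "\<dots> \<le> 2 ^ N * (A * C * E \<beta>\<^sub>1 N) + 2 ^ N * (1 / 4)"
      using k by (intro add_left_mono mult_left_mono) auto
    also have "\<dots> = 2 ^ N * (A * C * E \<beta>\<^sub>1 N + 1 / 4)" by (simp add: algebra_simps)
    finally have S2: "S \<beta>\<^sub>2 \<le> 2 ^ N * (A * C * E \<beta>\<^sub>1 N + 1 / 4)" .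
    have nn: "0 \<le> A * C * E \<beta>\<^sub>1 N + 1 / 4"
      using A C S0[of \<beta>\<^sub>1] partition_sum_pos[of N "J N" \<beta>\<^sub>1] by (simp add: ES add_nonneg_nonneg)
    \<comment> \<open>The unnormalised sums carry a factor \<open>2 ^ N\<close>, which the lower
      bound on the partition function at \<open>\<beta>\<^sub>2\<close> absorbs.\<close>
    have "S \<beta>\<^sub>2 \<le> (A * C * E \<beta>\<^sub>1 N + 1 / 4) * partition_sum N (J N) \<beta>\<^sub>2"
      using S2 mult_right_mono[OF partition_sum_ge[of N "J N" \<beta>\<^sub>2] nn] elim(1) by (simp add: mult.commute)
    then show ?case
      using partition_sum_pos[of N "J N" \<beta>\<^sub>2] by (simp add: ES pos_divide_le_eq)
  qed
  moreover have "(\<lambda>N. A * C * E \<beta>\<^sub>1 N + 1 / 4) \<longlonglongrightarrow> A * C * 0 + 1 / 4"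
    by (intro tendsto_intros lim)
  ultimately have "1 \<le> A * C * 0 + 1 / 4"
    using lim(2) by (intro tendsto_le[OF sequentially_bot])
  then show False by simp
qed

section \<open>The mean-field lower bound\<close>

text \<open>The right side minus the left vanishes at 0 and has derivative
  \<open>y^3 / (1 + y)\<close>, of the same sign as \<open>y\<close>; so 0 is its minimum.\<close>

lemma ln_le_cubic:
  fixes x :: real
  assumes "-1 < x"
  shows "ln (1 + x) \<le> x - x\<^sup>2 / 2 + x ^ 3 / 3"
proof -
  let ?f = "\<lambda>x :: real. x - x\<^sup>2 / 2 + x ^ 3 / 3 - ln (1 + x)"
  have D: "(?f has_real_derivative (y ^ 3 / (1 + y))) (at y)" if "-1 < y" for y
  proof -
    have "(?f has_real_derivative (1 - y + y\<^sup>2 - 1 / (1 + y))) (at y)"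
      using that by (auto intro!: derivative_eq_intros simp: power2_eq_square)
    moreover have "1 - y + y\<^sup>2 - 1 / (1 + y) = y ^ 3 / (1 + y)"
      using that by (simp add: field_simps power2_eq_square power3_eq_cube)
    ultimately show ?thesis by simp
  qed
  have "?f 0 \<le> ?f x"
  proof (cases "0 \<le> x")
    case True
    then show ?thesis
      by (rule DERIV_nonneg_imp_nondecreasing) (use D in \<open>force\<close>)
  next
    case False
    then have "x \<le> 0" by simp
    then show ?thesis
    proof (rule DERIV_nonpos_imp_nonincreasing)
      fix y assume y: "x \<le> y" "y \<le> 0"
      have "y ^ 3 \<le> 0" using y by (simp add: power_le_zero_eq)
      then have "y ^ 3 / (1 + y) \<le> 0" using y assms by (intro divide_nonpos_pos) auto
      then show "\<exists>d. (?f has_real_derivative d) (at y) \<and> d \<le> 0"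
        using D[of y] y assms by (intro exI[of _ "y ^ 3 / (1 + y)"]) auto
    qed
  qed
  then show ?thesis by simp
qed

lemma sum_spins_prod:
  fixes g :: "nat \<Rightarrow> real \<Rightarrow> real"
  shows "(\<Sum>\<tau>\<in>spins N. \<Prod>k\<in>{1..N}. g k (\<tau> k)) = (\<Prod>k\<in>{1..N}. g k (-1) + g k 1)"
  unfolding spins_def by (subst prod_sum_PiE[symmetric]) auto

text \<open>For means \<open>u k\<close> in \<open>[-1, 1]\<close>, \<open>P\<close> is the law of
  independent spins; each coordinate that is not observed contributes a factor that sums to
  1.\<close>

lemma spin_product_measure:
  fixes u :: "nat \<Rightarrow> real" and N :: nat
  defines "P \<equiv> \<lambda>\<tau>. \<Prod>k\<in>{1..N}. (1 + u k * \<tau> k) / 2"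
  shows "(\<Sum>\<tau>\<in>spins N. P \<tau>) = 1"
    and "i \<in> {1..N} \<Longrightarrow> (\<Sum>\<tau>\<in>spins N. P \<tau> * h (\<tau> i)) = (1 - u i) / 2 * h (-1) + (1 + u i) / 2 * h 1"
    and "i \<in> {1..N} \<Longrightarrow> j \<in> {1..N} \<Longrightarrow> i \<noteq> j \<Longrightarrow> (\<Sum>\<tau>\<in>spins N. P \<tau> * (\<tau> i * \<tau> j)) = u i * u j"
proof -
  show "(\<Sum>\<tau>\<in>spins N. P \<tau>) = 1"
    unfolding P_def by (subst sum_spins_prod) (auto intro!: prod.neutral simp: field_simps)
  { assume i: "i \<in> {1..N}"
    have "(\<Sum>\<tau>\<in>spins N. P \<tau> * h (\<tau> i)) =
        (\<Sum>\<tau>\<in>spins N. \<Prod>k\<in>{1..N}. (1 + u k * \<tau> k) / 2 * (if k = i then h (\<tau> k) else 1))"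
      unfolding P_def prod.distrib using i by (simp add: prod.delta)
    also have "\<dots> = (\<Prod>k\<in>{1..N}. if k = i then (1 - u i) / 2 * h (-1) + (1 + u i) / 2 * h 1 else 1)"
      by (subst sum_spins_prod, intro prod.cong refl) (simp add: field_simps)
    finally show "(\<Sum>\<tau>\<in>spins N. P \<tau> * h (\<tau> i)) = (1 - u i) / 2 * h (-1) + (1 + u i) / 2 * h 1"
      using i by simp }
  { assume ij: "i \<in> {1..N}" "j \<in> {1..N}" "i \<noteq> j"
    have "(\<Sum>\<tau>\<in>spins N. P \<tau> * (\<tau> i * \<tau> j)) = (\<Sum>\<tau>\<in>spins N. \<Prod>k\<in>{1..N}.
        (1 + u k * \<tau> k) / 2 * ((if k = i then \<tau> k else 1) * (if k = j then \<tau> k else 1)))"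
      unfolding P_def prod.distrib using ij by (simp add: prod.delta)
    also have "\<dots> = (\<Prod>k\<in>{1..N}. (if k = i then u i else 1) * (if k = j then u j else 1))"
      by (subst sum_spins_prod, intro prod.cong refl) (use ij in \<open>simp add: field_simps\<close>)
    finally show "(\<Sum>\<tau>\<in>spins N. P \<tau> * (\<tau> i * \<tau> j)) = u i * u j"
      unfolding prod.distrib using ij by simp }
qed

text \<open>Jensen's inequality under the product measure with means \<open>u\<close> (the Gibbs variational bound).\<close>

lemma partition_sum_ge_mean_field:
  assumes J: "graph_coupling N J" and u: "\<And>i. i \<in> {1..N} \<Longrightarrow> \<bar>u i\<bar> < 1"
  shows "2 ^ N * exp (\<beta> / 2 * (\<Sum>i\<in>{1..N}. \<Sum>j\<in>{1..N}. u i * J i j * u j)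
      - (\<Sum>i\<in>{1..N}. (u i)\<^sup>2 / 2 + (u i) ^ 4 / 3)) \<le> partition_sum N J \<beta>"
proof -
  define P where "P \<tau> = (\<Prod>k\<in>{1..N}. (1 + u k * \<tau> k) / 2)" for \<tau> :: "nat \<Rightarrow> real"
  \<comment> \<open>\<open>Y\<close> is the logarithm of the Gibbs weight divided by
    \<open>2 ^ N * P\<close>, so the \<open>P\<close>-mean of \<open>exp Y\<close> is the partition
    function divided by \<open>2 ^ N\<close>.\<close>
  define Y where "Y \<tau> = \<beta> / 2 * hamiltonian N J \<tau> - (\<Sum>k\<in>{1..N}. ln (1 + u k * \<tau> k))" for \<tau>
  define M where "M = (\<Sum>\<tau>\<in>spins N. P \<tau> * Y \<tau>)"
  note E = spin_product_measure[where N=N and u=u, folded P_def]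
  have pos: "0 < 1 + u k * \<tau> k" if "\<tau> \<in> spins N" "k \<in> {1..N}" for \<tau> k
    using spin_cases[OF that] u[OF that(2)] by auto
  have P0: "0 \<le> P \<tau>" if "\<tau> \<in> spins N" for \<tau>
    unfolding P_def using pos[OF that] by (intro prod_nonneg) (auto simp: less_imp_le)
  have PY: "P \<tau> * exp (Y \<tau>) = exp (\<beta> / 2 * hamiltonian N J \<tau>) / 2 ^ N" if "\<tau> \<in> spins N" for \<tau>
  proof -
    define Q where "Q = (\<Prod>k\<in>{1..N}. 1 + u k * \<tau> k)"
    have "exp (\<Sum>k\<in>{1..N}. ln (1 + u k * \<tau> k)) = Q"
      unfolding Q_def exp_sum[OF finite_atLeastAtMost] using pos[OF that] by (intro prod.cong) auto
    moreover have "Q > 0" unfolding Q_def using pos[OF that] by (intro prod_pos) auto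
    moreover have "P \<tau> = Q / 2 ^ N"
      by (simp add: P_def Q_def prod_dividef)
    ultimately show ?thesis by (simp add: Y_def exp_diff)
  qed
  \<comment> \<open>The tangent line of the exponential at \<open>M\<close> has
    \<open>P\<close>-mean \<open>exp M\<close> and lies below the exponential; this is Jensen's
    inequality.\<close>
  have "exp M = (\<Sum>\<tau>\<in>spins N. P \<tau> * (exp M * (1 + (Y \<tau> - M))))"
  proof -
    have "(\<Sum>\<tau>\<in>spins N. P \<tau> * (exp M * (1 + (Y \<tau> - M)))) =
      exp M * ((1 - M) * (\<Sum>\<tau>\<in>spins N. P \<tau>) + (\<Sum>\<tau>\<in>spins N. P \<tau> * Y \<tau>))"
      by (simp add: sum_distrib_left sum.distrib[symmetric] algebra_simps)
    then show ?thesis using E(1) by (simp add: M_def)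
  qed
  also have "\<dots> \<le> (\<Sum>\<tau>\<in>spins N. P \<tau> * exp (Y \<tau>))"
  proof (intro sum_mono mult_left_mono P0)
    fix \<tau>
    have "exp M * (1 + (Y \<tau> - M)) \<le> exp M * exp (Y \<tau> - M)"
      by (intro mult_left_mono) auto
    then show "exp M * (1 + (Y \<tau> - M)) \<le> exp (Y \<tau>)" by (simp flip: exp_add)
  qed
  also have "\<dots> = partition_sum N J \<beta> / 2 ^ N"
    by (simp add: PY partition_sum_def sum_divide_distrib)
  finally have Z: "exp M \<le> partition_sum N J \<beta> / 2 ^ N" .
  have H: "(\<Sum>\<tau>\<in>spins N. P \<tau> * hamiltonian N J \<tau>) = (\<Sum>i\<in>{1..N}. \<Sum>j\<in>{1..N}. u i * J i j * u j)"
  proof -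
    have "(\<Sum>\<tau>\<in>spins N. P \<tau> * hamiltonian N J \<tau>) =
        (\<Sum>\<tau>\<in>spins N. \<Sum>i\<in>{1..N}. \<Sum>j\<in>{1..N}. J i j * (P \<tau> * (\<tau> i * \<tau> j)))"
      by (simp add: hamiltonian_def sum_distrib_left mult_ac)
    also have "\<dots> = (\<Sum>i\<in>{1..N}. \<Sum>j\<in>{1..N}. \<Sum>\<tau>\<in>spins N. J i j * (P \<tau> * (\<tau> i * \<tau> j)))"
      by (subst sum.swap, intro sum.cong refl, rule sum.swap)
    also have "\<dots> = (\<Sum>i\<in>{1..N}. \<Sum>j\<in>{1..N}. u i * J i j * u j)"
    proof (intro sum.cong refl)
      fix i j assume ij: "i \<in> {1..N}" "j \<in> {1..N}"
      show "(\<Sum>\<tau>\<in>spins N. J i j * (P \<tau> * (\<tau> i * \<tau> j))) = u i * J i j * u j"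
      proof (cases "i = j")
        case False
        then show ?thesis using E(3)[OF ij] by (simp flip: sum_distrib_left)
      qed (use J in \<open>simp add: graph_coupling_def\<close>)
    qed
    finally show ?thesis .
  qed
  have L: "(\<Sum>\<tau>\<in>spins N. P \<tau> * ln (1 + u k * \<tau> k)) \<le> (u k)\<^sup>2 / 2 + (u k) ^ 4 / 3" if k: "k \<in> {1..N}" for k
  proof -
    have "(\<Sum>\<tau>\<in>spins N. P \<tau> * ln (1 + u k * \<tau> k)) =
        (1 - u k) / 2 * ln (1 + u k * (-1)) + (1 + u k) / 2 * ln (1 + u k * 1)"
      by (rule E(2)[OF k])
    \<comment> \<open>In the mean, the odd terms of the cubic gain a factor \<open>u k\<close> and
      the even one is unchanged: \<open>u - u^2/2 + u^3/3\<close> becomes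
      \<open>u^2/2 + u^4/3\<close>.\<close>
    also have "\<dots> \<le> (1 - u k) / 2 * (u k * (-1) - (u k * (-1))\<^sup>2 / 2 + (u k * (-1)) ^ 3 / 3) +
        (1 + u k) / 2 * (u k * 1 - (u k * 1)\<^sup>2 / 2 + (u k * 1) ^ 3 / 3)"
      using u[OF k] by (intro add_mono mult_left_mono ln_le_cubic) auto
    also have "\<dots> = (u k)\<^sup>2 / 2 + (u k) ^ 4 / 3"
      by (simp add: field_simps power2_eq_square power3_eq_cube power4_eq_xxxx)
    finally show ?thesis .
  qed
  have "M = \<beta> / 2 * (\<Sum>\<tau>\<in>spins N. P \<tau> * hamiltonian N J \<tau>) -
      (\<Sum>\<tau>\<in>spins N. \<Sum>k\<in>{1..N}. P \<tau> * ln (1 + u k * \<tau> k))"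
    by (simp add: M_def Y_def right_diff_distrib sum_subtractf sum_distrib_left mult_ac)
  moreover have "(\<Sum>\<tau>\<in>spins N. \<Sum>k\<in>{1..N}. P \<tau> * ln (1 + u k * \<tau> k)) \<le> (\<Sum>k\<in>{1..N}. (u k)\<^sup>2 / 2 + (u k) ^ 4 / 3)"
    by (subst sum.swap) (intro sum_mono L)
  ultimately have "\<beta> / 2 * (\<Sum>i\<in>{1..N}. \<Sum>j\<in>{1..N}. u i * J i j * u j)
      - (\<Sum>i\<in>{1..N}. (u i)\<^sup>2 / 2 + (u i) ^ 4 / 3) \<le> M"
    by (simp add: H)
  then have "exp (\<beta> / 2 * (\<Sum>i\<in>{1..N}. \<Sum>j\<in>{1..N}. u i * J i j * u j)
      - (\<Sum>i\<in>{1..N}. (u i)\<^sup>2 / 2 + (u i) ^ 4 / 3)) \<le> partition_sum N J \<beta> / 2 ^ N"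
    using Z by (meson exp_le_cancel_iff order_trans)
  then show ?thesis by (simp add: pos_le_divide_eq mult.commute)
qed

text \<open>Symmetry of \<open>J\<close> moves the steps of the second walk one by one to the
  first.\<close>

lemma sum_walk_mult_walk:
  assumes J: "graph_coupling N J"
  shows "(\<Sum>i\<in>{1..N}. walk N J a i * walk N J b i) = real N * walk_mean N J (a + b)"
proof (induction b arbitrary: a)
  case 0
  then show ?case using J by (simp add: walk_mean_def graph_coupling_def)
next
  case (Suc b)
  have "(\<Sum>i\<in>{1..N}. walk N J a i * walk N J (Suc b) i) = (\<Sum>i\<in>{1..N}. \<Sum>j\<in>{1..N}. walk N J a i * (J i j * walk N J b j))"
    by (simp add: walk_Suc sum_distrib_left)
  also have "\<dots> = (\<Sum>j\<in>{1..N}. \<Sum>i\<in>{1..N}. (J j i * walk N J a i) * walk N J b j)"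
  proof (subst sum.swap, intro sum.cong refl)
    fix i j
    have "J i j = J j i" using J by (simp add: graph_coupling_def)
    then show "walk N J a i * (J i j * walk N J b j) = J j i * walk N J a i * walk N J b j" by simp
  qed
  also have "\<dots> = (\<Sum>j\<in>{1..N}. walk N J (Suc a) j * walk N J b j)"
    by (simp add: walk_Suc sum_distrib_right)
  also have "\<dots> = real N * walk_mean N J (Suc a + b)" by (rule Suc)
  finally show ?case by simp
qed

text \<open>
  The trial magnetisation is a multiple of \<open>f = \<beta>\<^sup>k J\<^sup>k 1 + \<beta>\<^sup>k\<^sup>+\<^sup>1 J\<^sup>k\<^sup>+\<^sup>1 1\<close>, for which \<open>\<beta> \<langle>f, J f\<rangle> - \<langle>f, f\<rangle>\<close>
  telescopes; being bounded uniformly in \<open>N\<close>, it makes the quartic part of the entropy negligible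
  for small \<open>\<epsilon>\<close>.
\<close>

lemma partition_sum_ge_walks:
  assumes J: "graph_coupling N J" and b: "0 \<le> \<beta>" and e: "0 \<le> \<epsilon>" "\<epsilon> * (\<beta> ^ k + \<beta> ^ Suc k) < 1"
    and D: "D \<le> \<beta> ^ (2 * k + 3) * walk_mean N J (2 * k + 3) + \<beta> ^ (2 * k + 2) * walk_mean N J (2 * k + 2)
      - \<beta> ^ (2 * k + 1) * walk_mean N J (2 * k + 1) - \<beta> ^ (2 * k) * walk_mean N J (2 * k)"
  shows "2 ^ N * exp (real N * (\<epsilon>\<^sup>2 / 2 * D - (\<epsilon> * (\<beta> ^ k + \<beta> ^ Suc k)) ^ 4 / 3)) \<le> partition_sum N J \<beta>"
proof -
  define B where "B = \<beta> ^ k + \<beta> ^ Suc k"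
  define a where "a = \<beta> ^ k"
  have pow: "\<beta> ^ Suc k = a * \<beta>" "\<beta> ^ (2 * k) = a * a" "\<beta> ^ (2 * k + 1) = a * a * \<beta>"
    "\<beta> ^ (2 * k + 2) = a * a * (\<beta> * \<beta>)" "\<beta> ^ (2 * k + 3) = a * a * (\<beta> * \<beta> * \<beta>)"
    by (simp_all only: a_def mult_2 power_add power_Suc2 power_one_right power2_eq_square power3_eq_cube)
  have a0: "0 \<le> a" using b by (simp add: a_def)
  define f where "f i = a * walk N J k i + a * \<beta> * walk N J (Suc k) i" for i
  have f0: "0 \<le> f i" for i using b a0 walk_bounds(1)[OF J] by (simp add: f_def)
  have fB: "f i \<le> B" for i
    unfolding f_def B_def pow a_def[symmetric] using b a0 walk_bounds(2)[OF J] by (intro add_mono mult_left_le) auto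
  define u where "u i = \<epsilon> * f i" for i
  have u0: "0 \<le> u i" and uB: "u i \<le> \<epsilon> * B" for i using e f0 fB by (auto simp: u_def mult_left_mono)
  have u1: "\<bar>u i\<bar> < 1" for i using u0[of i] uB[of i] e(2) unfolding B_def by linarith
  let ?p = "walk_mean N J"
  have Jf: "(\<Sum>j\<in>{1..N}. J i j * f j) = a * walk N J (Suc k) i + a * \<beta> * walk N J (Suc (Suc k)) i" for i
  proof -
    have "(\<Sum>j\<in>{1..N}. J i j * f j) = a * (\<Sum>j\<in>{1..N}. J i j * walk N J k j) + a * \<beta> * (\<Sum>j\<in>{1..N}. J i j * walk N J (Suc k) j)"
      unfolding sum_distrib_left sum.distrib[symmetric] by (intro sum.cong refl) (simp add: f_def algebra_simps)
    then show ?thesis by (simp only: walk_Suc)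
  qed
  have ff: "(\<Sum>i\<in>{1..N}. (f i)\<^sup>2) = real N * (\<beta> ^ (2 * k) * ?p (2 * k) + 2 * (\<beta> ^ (2 * k + 1) * ?p (2 * k + 1))
      + \<beta> ^ (2 * k + 2) * ?p (2 * k + 2))"
  proof -
    have "(\<Sum>i\<in>{1..N}. (f i)\<^sup>2) = \<beta> ^ (2 * k) * (\<Sum>i\<in>{1..N}. walk N J k i * walk N J k i)
      + 2 * (\<beta> ^ (2 * k + 1) * (\<Sum>i\<in>{1..N}. walk N J k i * walk N J (Suc k) i))
      + \<beta> ^ (2 * k + 2) * (\<Sum>i\<in>{1..N}. walk N J (Suc k) i * walk N J (Suc k) i)"
      unfolding sum_distrib_left sum.distrib[symmetric] pow
      by (intro sum.cong refl) (simp add: f_def power2_eq_square algebra_simps)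
    moreover have "k + k = 2 * k" "k + Suc k = 2 * k + 1" "Suc k + Suc k = 2 * k + 2" by simp_all
    ultimately show ?thesis
      unfolding sum_walk_mult_walk[OF J] by (simp only:) (simp only: algebra_simps)
  qed
  have fJf: "(\<Sum>i\<in>{1..N}. f i * (\<Sum>j\<in>{1..N}. J i j * f j)) * \<beta> = real N * (\<beta> ^ (2 * k + 1) * ?p (2 * k + 1)
      + 2 * (\<beta> ^ (2 * k + 2) * ?p (2 * k + 2)) + \<beta> ^ (2 * k + 3) * ?p (2 * k + 3))"
  proof -
    have "(\<Sum>i\<in>{1..N}. f i * (\<Sum>j\<in>{1..N}. J i j * f j)) * \<beta> =
      \<beta> ^ (2 * k + 1) * (\<Sum>i\<in>{1..N}. walk N J k i * walk N J (Suc k) i)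
      + \<beta> ^ (2 * k + 2) * ((\<Sum>i\<in>{1..N}. walk N J k i * walk N J (Suc (Suc k)) i)
          + (\<Sum>i\<in>{1..N}. walk N J (Suc k) i * walk N J (Suc k) i))
      + \<beta> ^ (2 * k + 3) * (\<Sum>i\<in>{1..N}. walk N J (Suc k) i * walk N J (Suc (Suc k)) i)"
      unfolding Jf sum_distrib_left sum_distrib_right sum.distrib[symmetric] pow
      by (intro sum.cong refl) (simp add: f_def algebra_simps)
    moreover have "k + Suc k = 2 * k + 1" "k + Suc (Suc k) = 2 * k + 2" "Suc k + Suc k = 2 * k + 2"
      "Suc k + Suc (Suc k) = 2 * k + 3" by simp_all
    ultimately show ?thesis
      unfolding sum_walk_mult_walk[OF J] by (simp only:) (simp only: algebra_simps mult_2)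
  qed
  have quad: "\<beta> / 2 * (\<Sum>i\<in>{1..N}. \<Sum>j\<in>{1..N}. u i * J i j * u j) - (\<Sum>i\<in>{1..N}. (u i)\<^sup>2 / 2)
    = \<epsilon>\<^sup>2 / 2 * ((\<Sum>i\<in>{1..N}. f i * (\<Sum>j\<in>{1..N}. J i j * f j)) * \<beta> - (\<Sum>i\<in>{1..N}. (f i)\<^sup>2))"
    by (simp add: u_def power_mult_distrib sum_distrib_left sum_distrib_right right_diff_distrib
        power2_eq_square mult_ac)
  \<comment> \<open>Write \<open>q0, ..., q3\<close> for \<open>\<beta>^n\<close> times the walk
    mean at \<open>n = 2 * k, ..., 2 * k + 3\<close>. Then
    \<open>(q1 + 2 q2 + q3) - (q0 + 2 q1 + q2) = q3 + q2 - q1 - q0\<close>, which is the quantity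
    bounded below by \<open>D\<close>.\<close>
  have "real N * D * (\<epsilon>\<^sup>2 / 2) \<le> ((\<Sum>i\<in>{1..N}. f i * (\<Sum>j\<in>{1..N}. J i j * f j)) * \<beta> - (\<Sum>i\<in>{1..N}. (f i)\<^sup>2)) * (\<epsilon>\<^sup>2 / 2)"
  proof (rule mult_right_mono)
    show "real N * D \<le> (\<Sum>i\<in>{1..N}. f i * (\<Sum>j\<in>{1..N}. J i j * f j)) * \<beta> - (\<Sum>i\<in>{1..N}. (f i)\<^sup>2)"
      using mult_left_mono[OF D, of "real N"] unfolding ff fJf by (simp add: algebra_simps)
  qed simp
  moreover have "(\<Sum>i\<in>{1..N}. (u i) ^ 4 / 3) \<le> (\<Sum>i\<in>{1..N}. (\<epsilon> * B) ^ 4 / 3)"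
    using u0 uB by (intro sum_mono divide_right_mono power_mono) auto
  ultimately have "real N * (\<epsilon>\<^sup>2 / 2 * D - (\<epsilon> * B) ^ 4 / 3) \<le>
      \<beta> / 2 * (\<Sum>i\<in>{1..N}. \<Sum>j\<in>{1..N}. u i * J i j * u j) - (\<Sum>i\<in>{1..N}. (u i)\<^sup>2 / 2 + (u i) ^ 4 / 3)"
    using quad unfolding sum.distrib by (simp add: algebra_simps)
  then have "2 ^ N * exp (real N * (\<epsilon>\<^sup>2 / 2 * D - (\<epsilon> * B) ^ 4 / 3)) \<le> 2 ^ N *
      exp (\<beta> / 2 * (\<Sum>i\<in>{1..N}. \<Sum>j\<in>{1..N}. u i * J i j * u j) - (\<Sum>i\<in>{1..N}. (u i)\<^sup>2 / 2 + (u i) ^ 4 / 3))"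
    by simp
  also have "\<dots> \<le> partition_sum N J \<beta>"
    by (rule partition_sum_ge_mean_field[OF J u1])
  finally show ?thesis by (simp add: B_def)
qed

section \<open>The pseudolikelihood score\<close>

lemma tanh_diff_le:
  fixes a b :: real
  shows "\<bar>tanh a - tanh b\<bar> \<le> \<bar>a - b\<bar>"
proof -
  have *: "tanh b - tanh a \<le> b - a" if "a \<le> b" for a b :: real
  proof -
    have "(\<lambda>x. x - tanh x) a \<le> (\<lambda>x. x - tanh x) b"
    proof (rule DERIV_nonneg_imp_nondecreasing[OF that])
      fix x :: real
      have "((\<lambda>x. x - tanh x) has_real_derivative (tanh x)\<^sup>2) (at x)"
        by (auto intro!: derivative_eq_intros)
      then show "\<exists>d. ((\<lambda>x. x - tanh x) has_real_derivative d) (at x) \<and> 0 \<le> d"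
        by (intro exI[of _ "(tanh x)\<^sup>2"]) simp
    qed
    then show ?thesis by simp
  qed
  show ?thesis
  proof (cases "a \<le> b")
    case True
    moreover have "tanh a \<le> tanh b" using True by simp
    ultimately show ?thesis using *[OF True] by simp
  next
    case False
    then have "b \<le> a" by simp
    moreover from this have "tanh b \<le> tanh a" by simp
    ultimately show ?thesis using *[of b a] by simp
  qed
qed

lemma abs_tanh_less_1: "\<bar>tanh x\<bar> < 1" for x :: real
  using tanh_real_bounds[of x] by auto

lemma abs_local_field_le:
  assumes J: "graph_coupling N J" and t: "\<tau> \<in> spins N"
  shows "\<bar>local_field N J \<tau> i\<bar> \<le> 1"
proof -
  have "\<bar>local_field N J \<tau> i\<bar> \<le> (\<Sum>j\<in>{1..N}. \<bar>J i j * \<tau> j\<bar>)"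
    unfolding local_field_def by (rule sum_abs)
  also have "\<dots> \<le> (\<Sum>j\<in>{1..N}. 1 / real N)"
  proof (rule sum_mono)
    fix j assume j: "j \<in> {1..N}"
    have "\<bar>\<tau> j\<bar> = 1" using spin_cases[OF t j] by auto
    then show "\<bar>J i j * \<tau> j\<bar> \<le> 1 / real N"
      using J by (simp add: abs_mult graph_coupling_def)
  qed
  also have "\<dots> \<le> 1" by simp
  finally show ?thesis .
qed

lemma local_field_flip:
  assumes i: "i \<in> {1..N}"
  shows "local_field N J (flip i \<tau>) j = local_field N J \<tau> j - 2 * J j i * \<tau> i"
proof -
  have "local_field N J (flip i \<tau>) j = (\<Sum>k\<in>{1..N}. J j k * \<tau> k - (if k = i then 2 * J j i * \<tau> i else 0))"
    unfolding local_field_def by (intro sum.cong refl) (simp add: flip_apply)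
  also have "\<dots> = local_field N J \<tau> j - 2 * J j i * \<tau> i"
    unfolding sum_subtractf using i by (simp add: local_field_def)
  finally show ?thesis .
qed

lemma hamiltonian_local_field: "hamiltonian N J \<tau> = (\<Sum>i\<in>{1..N}. \<tau> i * local_field N J \<tau> i)"
  by (simp add: hamiltonian_def local_field_def sum_distrib_left mult_ac)

text \<open>Spin \<open>i\<close> enters the energy through its row and its column. Each changes by
  twice the product of the spin and its local field, hence the 4; the zero diagonal leaves no
  further term.\<close>

lemma hamiltonian_flip:
  assumes J: "graph_coupling N J" and i: "i \<in> {1..N}"
  shows "hamiltonian N J (flip i \<tau>) = hamiltonian N J \<tau> - 4 * \<tau> i * local_field N J \<tau> i"
proof -
  have Jii: "J i i = 0" and sym: "J a b = J b a" for a b using J by (auto simp: graph_coupling_def)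
  have "hamiltonian N J (flip i \<tau>) = (\<Sum>a\<in>{1..N}. flip i \<tau> a * local_field N J \<tau> a)
      - 2 * \<tau> i * (\<Sum>a\<in>{1..N}. J i a * flip i \<tau> a)"
    unfolding hamiltonian_local_field local_field_flip[OF i] sum_distrib_left sum_subtractf[symmetric]
    by (intro sum.cong refl) (simp add: sym[of i] algebra_simps)
  also have "(\<Sum>a\<in>{1..N}. J i a * flip i \<tau> a) = local_field N J \<tau> i"
    using local_field_flip[OF i, of J \<tau> i] by (simp add: local_field_def Jii)
  also have "(\<Sum>a\<in>{1..N}. flip i \<tau> a * local_field N J \<tau> a) =
      (\<Sum>a\<in>{1..N}. \<tau> a * local_field N J \<tau> a - (if a = i then 2 * \<tau> i * local_field N J \<tau> i else 0))"
    by (intro sum.cong refl) (simp add: flip_apply)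
  also have "\<dots> = hamiltonian N J \<tau> - 2 * \<tau> i * local_field N J \<tau> i"
    unfolding sum_subtractf hamiltonian_local_field using i by simp
  finally show ?thesis by simp
qed

section \<open>Cancellation and second moment of the score\<close>

definition site_score :: "nat \<Rightarrow> (nat \<Rightarrow> nat \<Rightarrow> real) \<Rightarrow> real \<Rightarrow> (nat \<Rightarrow> real) \<Rightarrow> nat \<Rightarrow> real" where
  "site_score N J \<beta> \<tau> i = local_field N J \<tau> i * (\<tau> i - tanh (\<beta> * local_field N J \<tau> i))"

lemma abs_site_score_le:
  assumes J: "graph_coupling N J" and t: "\<tau> \<in> spins N" and i: "i \<in> {1..N}"
  shows "\<bar>site_score N J \<beta> \<tau> i\<bar> \<le> 2"
proof -
  have "\<bar>\<tau> i - tanh (\<beta> * local_field N J \<tau> i)\<bar> \<le> 2"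
    using spin_cases[OF t i] abs_tanh_less_1[of "\<beta> * local_field N J \<tau> i"] by auto
  then have "\<bar>local_field N J \<tau> i\<bar> * \<bar>\<tau> i - tanh (\<beta> * local_field N J \<tau> i)\<bar> \<le> 1 * 2"
    by (intro mult_mono abs_local_field_le[OF J t]) auto
  then show ?thesis by (simp add: site_score_def abs_mult)
qed

text \<open>Conditionally on the other spins, \<open>\<tau> i\<close> has mean \<open>tanh (\<beta> m\<^sub>i)\<close>.\<close>

lemma sum_site_score_mult_eq_0:
  assumes J: "graph_coupling N J" and i: "i \<in> {1..N}"
    and h: "\<And>\<tau>. \<tau> \<in> spins N \<Longrightarrow> h (flip i \<tau>) = h \<tau>"
  shows "(\<Sum>\<tau>\<in>spins N. exp (\<beta> / 2 * hamiltonian N J \<tau>) * (site_score N J \<beta> \<tau> i * h \<tau>)) = 0"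
proof -
  let ?F = "\<lambda>\<tau>. exp (\<beta> / 2 * hamiltonian N J \<tau>) * (site_score N J \<beta> \<tau> i * h \<tau>)"
  \<comment> \<open>Configurations are paired by the flip at \<open>i\<close>, which fixes
    \<open>h\<close> and the local field at \<open>i\<close>. The Gibbs weights of a pair have ratio
    \<open>exp (- 2 * \<tau> i * x)\<close>, exactly what makes the two terms cancel.\<close>
  have F: "?F \<tau> + ?F (flip i \<tau>) = 0" if t: "\<tau> \<in> spins N" for \<tau>
  proof -
    define x where "x = \<beta> * local_field N J \<tau> i"
    have m: "local_field N J (flip i \<tau>) i = local_field N J \<tau> i"
      using local_field_flip[OF i, of J \<tau> i] J by (simp add: graph_coupling_def)
    have w: "exp (\<beta> / 2 * hamiltonian N J (flip i \<tau>)) = exp (\<beta> / 2 * hamiltonian N J \<tau>) * exp (- 2 * \<tau> i * x)"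
      unfolding hamiltonian_flip[OF J i] exp_add[symmetric] by (simp add: x_def algebra_simps)
    have tanh: "(1 - tanh x) = exp (- 2 * x) * (1 + tanh x)"
    proof -
      have "1 + exp (- 2 * x) \<noteq> 0" using exp_gt_zero[of "- 2 * x"] by linarith
      then show ?thesis by (simp add: tanh_real_altdef field_simps)
    qed
    have "\<tau> i - tanh x + exp (- 2 * \<tau> i * x) * (- \<tau> i - tanh x) = 0"
      using spin_cases[OF t i]
    proof
      assume "\<tau> i = 1"
      then show ?thesis using tanh by (simp add: algebra_simps)
    next
      assume t: "\<tau> i = - 1"
      have "exp (2 * x) * (1 - tanh x) = exp (2 * x) * exp (- 2 * x) * (1 + tanh x)"
        unfolding tanh by (simp only: mult.assoc)
      also have "exp (2 * x) * exp (- 2 * x) = 1" by (simp flip: exp_add)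
      finally show ?thesis using t by (simp add: algebra_simps)
    qed
    moreover have "?F \<tau> + ?F (flip i \<tau>) = exp (\<beta> / 2 * hamiltonian N J \<tau>) * local_field N J \<tau> i * h \<tau> *
        (\<tau> i - tanh x + exp (- 2 * \<tau> i * x) * (- \<tau> i - tanh x))"
      unfolding w h[OF t] site_score_def m x_def[symmetric] flip_apply by (simp add: algebra_simps)
    ultimately show ?thesis by (simp only: mult_zero_right)
  qed
  have "2 * (\<Sum>\<tau>\<in>spins N. ?F \<tau>) = (\<Sum>\<tau>\<in>spins N. ?F \<tau>) + (\<Sum>\<tau>\<in>spins N. ?F (flip i \<tau>))"
    using sum_spins_flip[OF i, of ?F] by linarith
  also have "\<dots> = (\<Sum>\<tau>\<in>spins N. ?F \<tau> + ?F (flip i \<tau>))" by (rule sum.distrib[symmetric])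
  also have "\<dots> = 0" using F by simp
  finally show ?thesis by simp
qed

text \<open>One flip moves any other local field by at most \<open>2 / N\<close>, and the score at
  \<open>j\<close> is Lipschitz in its field because \<open>tanh\<close> has slope at most 1;
  \<open>\<tau> j\<close> itself stays put as \<open>i \<noteq> j\<close>.\<close>

lemma site_score_flip_diff:
  assumes J: "graph_coupling N J" and t: "\<tau> \<in> spins N" and i: "i \<in> {1..N}" and j: "j \<in> {1..N}"
    and ij: "i \<noteq> j" and b: "0 \<le> \<beta>"
  shows "\<bar>site_score N J \<beta> \<tau> j - site_score N J \<beta> (flip i \<tau>) j\<bar> \<le> (4 + 2 * \<beta>) / real N"
proof -
  define m where "m = local_field N J \<tau> j"
  define m' where "m' = local_field N J (flip i \<tau>) j"
  have "m - m' = 2 * J j i * \<tau> i" using local_field_flip[OF i, of J \<tau> j] by (simp add: m_def m'_def)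
  moreover have "\<bar>\<tau> i\<bar> = 1" using spin_cases[OF t i] by auto
  moreover have "0 \<le> J j i" "J j i \<le> 1 / real N" using J by (auto simp: graph_coupling_def)
  ultimately have mm: "\<bar>m - m'\<bar> \<le> 2 / real N" by (simp add: abs_mult)
  have m'1: "\<bar>m'\<bar> \<le> 1" unfolding m'_def by (rule abs_local_field_le[OF J flip_spins[OF t i]])
  have g: "\<bar>\<tau> j - tanh (\<beta> * m)\<bar> \<le> 2"
    using spin_cases[OF t j] abs_tanh_less_1[of "\<beta> * m"] by auto
  have th: "\<bar>tanh (\<beta> * m') - tanh (\<beta> * m)\<bar> \<le> \<beta> * (2 / real N)"
  proof -
    have "\<bar>tanh (\<beta> * m') - tanh (\<beta> * m)\<bar> \<le> \<beta> * \<bar>m - m'\<bar>"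
      using tanh_diff_le[of "\<beta> * m'" "\<beta> * m"] b
      by (simp add: abs_mult abs_minus_commute flip: right_diff_distrib)
    then show ?thesis using mult_left_mono[OF mm b] by linarith
  qed
  have "site_score N J \<beta> \<tau> j - site_score N J \<beta> (flip i \<tau>) j =
      (m - m') * (\<tau> j - tanh (\<beta> * m)) + m' * (tanh (\<beta> * m') - tanh (\<beta> * m))"
    using ij by (simp add: site_score_def m_def[symmetric] m'_def[symmetric] flip_apply algebra_simps)
  also have "\<bar>\<dots>\<bar> \<le> \<bar>m - m'\<bar> * \<bar>\<tau> j - tanh (\<beta> * m)\<bar> + \<bar>m'\<bar> * \<bar>tanh (\<beta> * m') - tanh (\<beta> * m)\<bar>"
    unfolding abs_mult[symmetric] by (rule abs_triangle_ineq)
  also have "\<dots> \<le> 2 / real N * 2 + 1 * (\<beta> * (2 / real N))"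
    using mm g m'1 th by (intro add_mono mult_mono) auto
  also have "\<dots> = (4 + 2 * \<beta>) / real N" by (simp add: add_divide_distrib)
  finally show ?thesis .
qed

text \<open>For \<open>i \<noteq> j\<close>, the score at \<open>j\<close> splits into parts even
  and odd under the flip at \<open>i\<close>. The even part is uncorrelated with the score at
  \<open>i\<close> and the odd part is \<open>O(1 / N)\<close>, so the double sum is of order
  \<open>N\<close> rather than \<open>N^2\<close>.\<close>

lemma score_second_moment:
  assumes J: "graph_coupling N J" and b: "0 \<le> \<beta>"
  shows "(\<Sum>\<tau>\<in>spins N. exp (\<beta> / 2 * hamiltonian N J \<tau>) * (\<Sum>i\<in>{1..N}. site_score N J \<beta> \<tau> i)\<^sup>2) \<le>
    (8 + 2 * \<beta>) * real N * partition_sum N J \<beta>"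
proof -
  let ?w = "\<lambda>\<tau>. exp (\<beta> / 2 * hamiltonian N J \<tau>)" and ?f = "site_score N J \<beta>"
  let ?Z = "partition_sum N J \<beta>"
  have N: "N \<ge> 1" using J by (simp add: graph_coupling_def)
  have Z0: "0 \<le> ?Z" using partition_sum_pos[of N J \<beta>] by simp
  have corr: "(\<Sum>\<tau>\<in>spins N. ?w \<tau> * (?f \<tau> i * ?f \<tau> j)) \<le> ((if i = j then 4 else 0) + (4 + 2 * \<beta>) / real N) * ?Z"
    if ij: "i \<in> {1..N}" "j \<in> {1..N}" for i j
  proof (cases "i = j")
    case True
    have "(\<Sum>\<tau>\<in>spins N. ?w \<tau> * (?f \<tau> i * ?f \<tau> j)) \<le> (\<Sum>\<tau>\<in>spins N. ?w \<tau> * 4)"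
    proof (intro sum_mono mult_left_mono)
      fix \<tau> assume "\<tau> \<in> spins N"
      then have "\<bar>?f \<tau> i\<bar> * \<bar>?f \<tau> i\<bar> \<le> 2 * 2"
        using ij by (intro mult_mono abs_site_score_le[OF J]) auto
      then show "?f \<tau> i * ?f \<tau> j \<le> 4" using True by simp
    qed simp
    also have "\<dots> = 4 * ?Z" by (simp add: partition_sum_def sum_distrib_left mult.commute)
    also have "\<dots> \<le> (4 + (4 + 2 * \<beta>) / real N) * ?Z"
      using b Z0 by (intro mult_right_mono) auto
    finally show ?thesis using True by simp
  next
    case False
    have split: "(\<Sum>\<tau>\<in>spins N. ?w \<tau> * (?f \<tau> i * ?f \<tau> j)) =
      (\<Sum>\<tau>\<in>spins N. ?w \<tau> * (?f \<tau> i * ((?f \<tau> j + ?f (flip i \<tau>) j) / 2))) +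
      (\<Sum>\<tau>\<in>spins N. ?w \<tau> * (?f \<tau> i * ((?f \<tau> j - ?f (flip i \<tau>) j) / 2)))"
      unfolding sum.distrib[symmetric] distrib_left[symmetric]
      by (intro sum.cong refl) (simp add: field_simps)
    have even: "(\<Sum>\<tau>\<in>spins N. ?w \<tau> * (?f \<tau> i * ((?f \<tau> j + ?f (flip i \<tau>) j) / 2))) = 0"
      by (rule sum_site_score_mult_eq_0[OF J ij(1)]) simp
    have "(\<Sum>\<tau>\<in>spins N. ?w \<tau> * (?f \<tau> i * ((?f \<tau> j - ?f (flip i \<tau>) j) / 2))) \<le>
      (\<Sum>\<tau>\<in>spins N. ?w \<tau> * ((4 + 2 * \<beta>) / real N))"
    proof (intro sum_mono mult_left_mono)
      fix \<tau> assume t: "\<tau> \<in> spins N"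
      have "\<bar>?f \<tau> i\<bar> * \<bar>?f \<tau> j - ?f (flip i \<tau>) j\<bar> \<le> 2 * ((4 + 2 * \<beta>) / real N)"
        using abs_site_score_le[OF J t ij(1)] site_score_flip_diff[OF J t ij False b]
        by (intro mult_mono) auto
      then have "\<bar>?f \<tau> i * (?f \<tau> j - ?f (flip i \<tau>) j)\<bar> \<le> 2 * ((4 + 2 * \<beta>) / real N)"
        by (simp only: abs_mult)
      then show "?f \<tau> i * ((?f \<tau> j - ?f (flip i \<tau>) j) / 2) \<le> (4 + 2 * \<beta>) / real N"
        by linarith
    qed simp
    also have "\<dots> = (4 + 2 * \<beta>) / real N * ?Z" by (simp add: partition_sum_def sum_distrib_left mult.commute)
    finally show ?thesis unfolding split even using False by simp
  qed
  have "(\<Sum>\<tau>\<in>spins N. ?w \<tau> * (\<Sum>i\<in>{1..N}. ?f \<tau> i)\<^sup>2) =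
      (\<Sum>\<tau>\<in>spins N. \<Sum>i\<in>{1..N}. \<Sum>j\<in>{1..N}. ?w \<tau> * (?f \<tau> i * ?f \<tau> j))"
    unfolding power2_eq_square sum_product by (simp only: sum_distrib_left)
  also have "\<dots> = (\<Sum>i\<in>{1..N}. \<Sum>j\<in>{1..N}. \<Sum>\<tau>\<in>spins N. ?w \<tau> * (?f \<tau> i * ?f \<tau> j))"
    by (subst sum.swap, intro sum.cong refl, rule sum.swap)
  also have "\<dots> \<le> (\<Sum>i\<in>{1..N}. \<Sum>j\<in>{1..N}. ((if i = j then 4 else 0) + (4 + 2 * \<beta>) / real N) * ?Z)"
    by (intro sum_mono corr)
  also have "\<dots> = (\<Sum>i\<in>{1..N}. (4 + (4 + 2 * \<beta>)) * ?Z)"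
  proof (intro sum.cong refl)
    fix i assume i: "i \<in> {1..N}"
    have "(\<Sum>j\<in>{1..N}. (if i = j then 4 else 0) + (4 + 2 * \<beta>) / real N) = 4 + (4 + 2 * \<beta>)"
      unfolding sum.distrib using i N by simp
    then show "(\<Sum>j\<in>{1..N}. ((if i = j then 4 else 0) + (4 + 2 * \<beta>) / real N) * ?Z) = (4 + (4 + 2 * \<beta>)) * ?Z"
      by (simp only: sum_distrib_right[symmetric])
  qed
  also have "\<dots> = (8 + 2 * \<beta>) * real N * ?Z" by simp
  finally show ?thesis .
qed

text \<open>The derivative of \<open>m * tanh (z * m)\<close> in \<open>z\<close> is
  \<open>m^2 * (1 - tanh (z * m)^2)\<close>, bounded below through
  \<open>|z * m| \<le> B\<close>.\<close>

lemma tanh_increment_ge: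
  fixes m :: real
  assumes xy: "0 \<le> x" "x \<le> y" "y \<le> B" and m: "\<bar>m\<bar> \<le> 1"
  shows "m\<^sup>2 * (1 - (tanh B)\<^sup>2) * (y - x) \<le> m * (tanh (y * m) - tanh (x * m))"
proof -
  let ?g = "\<lambda>x. m * tanh (x * m) - m\<^sup>2 * (1 - (tanh B)\<^sup>2) * x"
  have "?g x \<le> ?g y"
  proof (rule DERIV_nonneg_imp_nondecreasing[OF xy(2)])
    fix z assume z: "x \<le> z" "z \<le> y"
    have "(?g has_real_derivative (m * ((1 - (tanh (z * m))\<^sup>2) * m) - m\<^sup>2 * (1 - (tanh B)\<^sup>2))) (at z)"
      by (auto intro!: derivative_eq_intros)
    moreover have "0 \<le> m * ((1 - (tanh (z * m))\<^sup>2) * m) - m\<^sup>2 * (1 - (tanh B)\<^sup>2)"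
    proof -
      have "\<bar>z * m\<bar> \<le> B * 1" unfolding abs_mult using xy z m by (intro mult_mono) auto
      then have "\<bar>tanh (z * m)\<bar> \<le> tanh B" by (auto simp: abs_if simp flip: tanh_minus)
      then have "\<bar>tanh (z * m)\<bar>\<^sup>2 \<le> (tanh B)\<^sup>2" by (intro power_mono) auto
      then have "0 \<le> m\<^sup>2 * ((tanh B)\<^sup>2 - (tanh (z * m))\<^sup>2)" by simp
      then show ?thesis by (simp add: power2_eq_square algebra_simps)
    qed
    ultimately show "\<exists>d. (?g has_real_derivative d) (at z) \<and> 0 \<le> d" by blast
  qed
  then show ?thesis by (simp add: algebra_simps)
qed

text \<open>The score falls at rate at least \<open>\<eta> * c\<close> around
  \<open>\<beta>\<close>, so a small value at \<open>\<beta>\<close> forces opposite signs at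
  \<open>\<beta> - r\<close> and \<open>\<beta> + r\<close>, and monotonicity confines every zero to
  the interval between. The limits on \<open>r\<close> keep that interval inside
  \<open>[0, \<beta> + 1]\<close>, where the rate is guaranteed.\<close>

lemma mple_close:
  assumes J: "graph_coupling N J" and t: "\<tau> \<in> spins N" and b: "0 < \<beta>" and r: "0 < r" "r \<le> 1" "r \<le> \<beta>"
    and eta: "\<eta> * real N \<le> (\<Sum>i\<in>{1..N}. (local_field N J \<tau> i)\<^sup>2)"
    and score: "\<bar>pseudo_score N J \<tau> \<beta>\<bar> < \<eta> * (1 - (tanh (\<beta> + 1))\<^sup>2) * r"
  shows "\<bar>mple N J \<tau> - ereal \<beta>\<bar> \<le> ereal r"
proof -
  let ?L = "pseudo_score N J \<tau>" and ?m = "local_field N J \<tau>"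
  define c where "c = 1 - (tanh (\<beta> + 1))\<^sup>2"
  have N: "N \<ge> 1" using J by (simp add: graph_coupling_def)
  have c0: "0 \<le> c" using abs_tanh_less_1[of "\<beta> + 1"] by (simp add: c_def abs_square_le_1)
  have diff: "?L x - ?L y = 1 / real N * (\<Sum>i\<in>{1..N}. ?m i * (tanh (y * ?m i) - tanh (x * ?m i)))" for x y
    unfolding pseudo_score_def right_diff_distrib[symmetric] sum_subtractf[symmetric]
    by (intro arg_cong2[where f="(*)"] refl sum.cong) (simp add: algebra_simps)
  have anti: "?L y \<le> ?L x" if "x \<le> y" for x y
  proof -
    have "0 \<le> ?m i * (tanh (y * ?m i) - tanh (x * ?m i))" for i
    proof (cases "0 \<le> ?m i")
      case True
      then show ?thesis using that by (intro mult_nonneg_nonneg) (auto intro: mult_right_mono)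
    next
      case False
      then show ?thesis using that by (intro mult_nonpos_nonpos) (auto intro: mult_right_mono_neg)
    qed
    then have "0 \<le> (\<Sum>i\<in>{1..N}. ?m i * (tanh (y * ?m i) - tanh (x * ?m i)))" by (intro sum_nonneg)
    then have "0 \<le> ?L x - ?L y" unfolding diff by simp
    then show ?thesis by simp
  qed
  have steep: "\<eta> * c * (y - x) \<le> ?L x - ?L y" if xy: "0 \<le> x" "x \<le> y" "y \<le> \<beta> + 1" for x y
  proof -
    have "\<eta> * real N * (c * (y - x)) \<le> (\<Sum>i\<in>{1..N}. (?m i)\<^sup>2) * (c * (y - x))"
      using eta c0 xy by (intro mult_right_mono) auto
    also have "\<dots> = (\<Sum>i\<in>{1..N}. (?m i)\<^sup>2 * c * (y - x))" by (simp add: sum_distrib_right mult.assoc)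
    also have "\<dots> \<le> (\<Sum>i\<in>{1..N}. ?m i * (tanh (y * ?m i) - tanh (x * ?m i)))"
      unfolding c_def using xy by (intro sum_mono tanh_increment_ge abs_local_field_le[OF J t])
    finally show ?thesis unfolding diff using N by (simp add: field_simps)
  qed
  have up: "?L (\<beta> + r) < 0"
    using steep[of \<beta> "\<beta> + r"] b r score by (simp add: c_def)
  have down: "0 < ?L (\<beta> - r)"
    using steep[of "\<beta> - r" \<beta>] b r score by (simp add: c_def)
  have cont: "continuous_on {\<beta> - r..\<beta> + r} ?L"
    unfolding pseudo_score_def by (intro continuous_intros) auto
  obtain z where z: "\<beta> - r \<le> z" "z \<le> \<beta> + r" "?L z = 0"
    using IVT2'[of ?L "\<beta> + r" 0 "\<beta> - r"] up down r cont by auto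
  let ?S = "{x. 0 \<le> x \<and> ?L x = 0}"
  have S: "\<beta> - r \<le> x \<and> x \<le> \<beta> + r" if "x \<in> ?S" for x
    using that anti[of x "\<beta> - r"] anti[of "\<beta> + r" x] up down by (auto simp: not_le[symmetric])
  have zS: "z \<in> ?S" using z r by auto
  have "\<beta> - r \<le> Inf ?S" by (rule cInf_greatest) (use zS S in auto)
  moreover have "Inf ?S \<le> \<beta> + r"
    using cInf_lower[OF zS bdd_belowI[of _ 0]] z by auto
  \<comment> \<open>The signs at \<open>\<beta> - r\<close> and \<open>\<beta> + r\<close> exclude
    both conventional cases of \<open>mple\<close>.\<close>
  moreover have "mple N J \<tau> = ereal (Inf ?S)"
  proof -
    have "\<not> ?L 0 < 0" using anti[of 0 "\<beta> - r"] down r by auto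
    moreover have "\<not> (\<forall>x\<ge>0. 0 < ?L x)"
    proof
      assume "\<forall>x\<ge>0. 0 < ?L x"
      then have "0 < ?L (\<beta> + r)" using b r by auto
      then show False using up by simp
    qed
    ultimately show ?thesis by (simp add: mple_def)
  qed
  ultimately show ?thesis by (simp add: abs_if)
qed

section \<open>Root-N consistency and the main result\<close>

text \<open>Linear growth of the log-partition function forces \<open>H\<^sub>N \<ge> \<delta> N\<close>, which bounds the curvature of the pseudolikelihood from below.\<close>

lemma measure_mple_far_le:
  assumes J: "graph_coupling N J" and b: "0 < \<beta>" and c: "0 < c"
    and Z: "2 ^ N * exp (c * real N) \<le> partition_sum N J \<beta>"
    and \<kappa>: "\<kappa> = (c / \<beta>)\<^sup>2 * (1 - (tanh (\<beta> + 1))\<^sup>2)"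
    and K: "0 < K" "K / sqrt (real N) \<le> 1" "K / sqrt (real N) \<le> \<beta>"
  shows "measure (ising N J \<beta>) {\<sigma> \<in> spins N. ereal (sqrt (real N)) * \<bar>mple N J \<sigma> - ereal \<beta>\<bar> > ereal K}
    \<le> exp (- (c * real N / 2)) + (8 + 2 * \<beta>) / (\<kappa>\<^sup>2 * K\<^sup>2)"
proof -
  have N: "N \<ge> 1" using J by (simp add: graph_coupling_def)
  let ?w = "\<lambda>\<tau>. exp (\<beta> / 2 * hamiltonian N J \<tau>)" and ?Z = "partition_sum N J \<beta>"
  have Z0: "?Z > 0" by (rule partition_sum_pos)
  define r where "r = K / sqrt (real N)"
  have sN: "sqrt (real N) > 0" using N by simp
  have r: "0 < r" "r \<le> 1" "r \<le> \<beta>" using K sN by (auto simp: r_def)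
  \<comment> \<open>At energies up to \<open>\<delta> * N\<close> the Gibbs exponent is at most
    \<open>c * N / 2\<close>, half the growth exponent of the partition function, so such
    configurations are exponentially unlikely.\<close>
  define \<delta> where "\<delta> = c / \<beta>"
  have d: "\<delta> > 0" using b c by (simp add: \<delta>_def)
  have k0: "\<kappa> > 0"
    using abs_tanh_less_1[of "\<beta> + 1"] b c by (simp add: \<kappa> abs_square_less_1)
  define s where "s \<tau> = (\<Sum>i\<in>{1..N}. site_score N J \<beta> \<tau> i)" for \<tau>
  have score: "pseudo_score N J \<tau> \<beta> = s \<tau> / real N" for \<tau>
    by (simp add: pseudo_score_def s_def site_score_def)
  define A where "A = {\<tau> \<in> spins N. hamiltonian N J \<tau> \<le> \<delta> * real N}"
  define B where "B = {\<tau> \<in> spins N. \<kappa> * r \<le> \<bar>pseudo_score N J \<tau> \<beta>\<bar>}"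
  let ?E = "{\<sigma> \<in> spins N. ereal (sqrt (real N)) * \<bar>mple N J \<sigma> - ereal \<beta>\<bar> > ereal K}"
  \<comment> \<open>Off \<open>A\<close> the energy is large, and Cauchy-Schwarz makes the sum of
    squared local fields at least \<open>\<delta>^2 * N\<close>; off \<open>B\<close> the score is
    small. Then \<open>mple_close\<close> applies with radius \<open>K / sqrt N\<close>.\<close>
  have sub: "?E \<subseteq> A \<union> B"
  proof (rule subsetI, rule ccontr)
    fix \<tau> assume E: "\<tau> \<in> ?E" and nAB: "\<tau> \<notin> A \<union> B"
    then have t: "\<tau> \<in> spins N" by simp
    let ?m = "local_field N J \<tau>"
    have H: "\<delta> * real N < hamiltonian N J \<tau>" and L: "\<bar>pseudo_score N J \<tau> \<beta>\<bar> < \<kappa> * r"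
      using nAB t by (auto simp: A_def B_def)
    have "(\<delta> * real N)\<^sup>2 \<le> (hamiltonian N J \<tau>)\<^sup>2" using H d by (intro power_mono) auto
    also have "\<dots> \<le> (\<Sum>i\<in>{1..N}. (\<tau> i)\<^sup>2) * (\<Sum>i\<in>{1..N}. (?m i)\<^sup>2)"
      unfolding hamiltonian_local_field by (rule Cauchy_Schwarz_ineq_sum)
    also have "(\<Sum>i\<in>{1..N}. (\<tau> i)\<^sup>2) = (\<Sum>i\<in>{1..N}. 1)"
      by (intro sum.cong refl) (use spin_cases[OF t] in \<open>simp add: power2_eq_1_iff\<close>)
    also have "\<dots> * (\<Sum>i\<in>{1..N}. (?m i)\<^sup>2) = real N * (\<Sum>i\<in>{1..N}. (?m i)\<^sup>2)" by simp
    finally have "real N * (\<delta>\<^sup>2 * real N) \<le> real N * (\<Sum>i\<in>{1..N}. (?m i)\<^sup>2)"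
      by (simp add: power_mult_distrib power2_eq_square mult_ac)
    then have "\<delta>\<^sup>2 * real N \<le> (\<Sum>i\<in>{1..N}. (?m i)\<^sup>2)" using N by simp
    from mple_close[OF J t b r this] L
    have "\<bar>mple N J \<tau> - ereal \<beta>\<bar> \<le> ereal r" by (simp add: \<kappa> \<delta>_def)
    then have "ereal (sqrt (real N)) * \<bar>mple N J \<tau> - ereal \<beta>\<bar> \<le> ereal (sqrt (real N)) * ereal r"
      by (rule ereal_mult_left_mono) simp
    also have "\<dots> = ereal K" using sN by (simp add: r_def)
    finally show False using E by (simp add: not_le[symmetric])
  qed
  have "(\<Sum>\<tau>\<in>A. ?w \<tau>) \<le> (\<Sum>\<tau>\<in>spins N. exp (c * real N / 2))"
  proof (rule order_trans[OF sum_mono sum_mono2])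
    fix \<tau> assume "\<tau> \<in> A"
    then have "\<beta> / 2 * hamiltonian N J \<tau> \<le> \<beta> / 2 * (\<delta> * real N)"
      using b by (intro mult_left_mono) (auto simp: A_def)
    then show "?w \<tau> \<le> exp (c * real N / 2)" using b by (simp add: \<delta>_def)
  qed (auto simp: A_def)
  also have "\<dots> = exp (- (c * real N / 2)) * (2 ^ N * exp (c * real N))"
    by (simp add: card_spins flip: exp_add)
  also have "\<dots> \<le> exp (- (c * real N / 2)) * ?Z" by (intro mult_left_mono Z) simp
  finally have A: "(\<Sum>\<tau>\<in>A. ?w \<tau>) / ?Z \<le> exp (- (c * real N / 2))"
    using Z0 by (simp add: pos_divide_le_eq)
  \<comment> \<open>Chebyshev's inequality: on \<open>B\<close> the summed score is at least
    \<open>\<kappa> * K * sqrt N\<close>, while its second moment is of order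
    \<open>N\<close>.\<close>
  have "(\<Sum>\<tau>\<in>B. ?w \<tau> * (\<kappa> * K)\<^sup>2 * real N) \<le> (\<Sum>\<tau>\<in>B. ?w \<tau> * (s \<tau>)\<^sup>2)"
  proof (rule sum_mono)
    fix \<tau> assume "\<tau> \<in> B"
    then have "\<kappa> * r * real N \<le> \<bar>s \<tau>\<bar>" using N by (simp add: B_def score field_simps)
    moreover have "\<kappa> * r * real N = \<kappa> * K * sqrt (real N)"
    proof -
      have "\<kappa> * r * real N = \<kappa> * K * (real N / sqrt (real N))" by (simp add: r_def)
      then show ?thesis by (simp only: real_div_sqrt of_nat_0_le_iff)
    qed
    ultimately have "(\<kappa> * K * sqrt (real N))\<^sup>2 \<le> \<bar>s \<tau>\<bar>\<^sup>2" using k0 K by (intro power_mono) auto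
    then have "(\<kappa> * K)\<^sup>2 * real N \<le> (s \<tau>)\<^sup>2" by (simp add: power_mult_distrib)
    then show "?w \<tau> * (\<kappa> * K)\<^sup>2 * real N \<le> ?w \<tau> * (s \<tau>)\<^sup>2"
      unfolding mult.assoc by (intro mult_left_mono) auto
  qed
  also have "\<dots> \<le> (\<Sum>\<tau>\<in>spins N. ?w \<tau> * (s \<tau>)\<^sup>2)"
    by (rule sum_mono2) (auto simp: B_def)
  also have "\<dots> \<le> (8 + 2 * \<beta>) * real N * ?Z"
    unfolding s_def using score_second_moment[OF J] b by simp
  finally have "(\<Sum>\<tau>\<in>B. ?w \<tau>) * (\<kappa> * K)\<^sup>2 * real N \<le> (8 + 2 * \<beta>) * ?Z * real N"
    by (simp add: sum_distrib_left sum_distrib_right mult_ac)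
  then have "(\<Sum>\<tau>\<in>B. ?w \<tau>) * (\<kappa> * K)\<^sup>2 \<le> (8 + 2 * \<beta>) * ?Z" using N by simp
  then have B: "(\<Sum>\<tau>\<in>B. ?w \<tau>) / ?Z \<le> (8 + 2 * \<beta>) / (\<kappa>\<^sup>2 * K\<^sup>2)"
    using Z0 k0 K by (simp add: field_simps)
  have fin: "finite A" "finite B" by (auto simp: A_def B_def)
  have "(\<Sum>\<tau>\<in>?E. ?w \<tau>) \<le> (\<Sum>\<tau>\<in>A \<union> B. ?w \<tau>)" using fin sub by (intro sum_mono2) auto
  also have "\<dots> \<le> (\<Sum>\<tau>\<in>A. ?w \<tau>) + (\<Sum>\<tau>\<in>B. ?w \<tau>)"
    using sum.union_inter[OF fin, of ?w] sum_nonneg[of "A \<inter> B" ?w] by simp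
  finally have "(\<Sum>\<tau>\<in>?E. ?w \<tau>) / ?Z \<le> (\<Sum>\<tau>\<in>A. ?w \<tau>) / ?Z + (\<Sum>\<tau>\<in>B. ?w \<tau>) / ?Z"
    unfolding add_divide_distrib[symmetric] using Z0 by (intro divide_right_mono) auto
  then show ?thesis using A B by (subst measure_ising) auto
qed

text \<open>As \<open>N\<close> grows the exponential term disappears and the Chebyshev term, of
  order \<open>1 / K^2\<close>, remains; it vanishes as \<open>K\<close> grows.\<close>

lemma mple_consistent_of_linear_growth:
  assumes b: "0 < \<beta>" and c: "0 < c"
    and ev: "eventually (\<lambda>N. graph_coupling N (J N) \<and> 2 ^ N * exp (c * real N) \<le> partition_sum N (J N) \<beta>) sequentially"
  shows "mple_consistent (\<lambda>N. sqrt (real N)) J \<beta>"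
proof -
  define \<kappa> where "\<kappa> = (c / \<beta>)\<^sup>2 * (1 - (tanh (\<beta> + 1))\<^sup>2)"
  define M where "M K N = measure (ising N (J N) \<beta>)
    {\<sigma> \<in> spins N. ereal (sqrt (real N)) * \<bar>mple N (J N) \<sigma> - ereal \<beta>\<bar> > ereal K}" for K N
  let ?C = "\<lambda>K. (8 + 2 * \<beta>) / (\<kappa>\<^sup>2 * K\<^sup>2)"
  have le: "limsup (\<lambda>N. ereal (M K N)) \<le> ereal (?C K)" if K: "K > 0" for K
  proof -
    \<comment> \<open>For fixed \<open>K\<close> the radius \<open>K / sqrt N\<close> eventually
      meets the limits set by \<open>measure_mple_far_le\<close>.\<close>
    have "(\<lambda>N. K / sqrt (real N)) \<longlonglongrightarrow> 0" by real_asymp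
    then have "eventually (\<lambda>N. K / sqrt (real N) < min 1 \<beta>) sequentially"
      using b by (intro order_tendstoD) auto
    with ev have "eventually (\<lambda>N. M K N \<le> exp (- (c * real N / 2)) + ?C K) sequentially"
    proof eventually_elim
      case (elim N)
      then show ?case unfolding M_def
        by (intro measure_mple_far_le[OF _ b c _ \<kappa>_def K]) auto
    qed
    then have "limsup (\<lambda>N. ereal (M K N)) \<le> limsup (\<lambda>N. ereal (exp (- (c * real N / 2)) + ?C K))"
      by (intro Limsup_mono) simp
    also have "\<dots> = ereal (?C K)"
    proof (rule lim_imp_Limsup)
      have "(\<lambda>N. exp (- (c * real N / 2))) \<longlonglongrightarrow> 0" using c by real_asymp
      then have "(\<lambda>N. exp (- (c * real N / 2)) + ?C K) \<longlonglongrightarrow> 0 + ?C K" by (intro tendsto_intros)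
      then show "(\<lambda>N. ereal (exp (- (c * real N / 2)) + ?C K)) \<longlonglongrightarrow> ereal (?C K)" by simp
    qed simp
    finally show ?thesis .
  qed
  have "Limsup at_top (\<lambda>K. limsup (\<lambda>N. ereal (M K N))) \<le> Limsup at_top (\<lambda>K :: real. ereal (?C K))"
    using le by (intro Limsup_mono eventually_mono[OF eventually_gt_at_top[of 0]])
  also have "\<dots> = ereal 0"
  proof (rule lim_imp_Limsup)
    have "((\<lambda>K. (8 + 2 * \<beta>) / \<kappa>\<^sup>2 * (1 / K\<^sup>2)) \<longlongrightarrow> (8 + 2 * \<beta>) / \<kappa>\<^sup>2 * 0) at_top"
      by (intro tendsto_mult tendsto_const) real_asymp
    then show "((\<lambda>K. ereal (?C K)) \<longlongrightarrow> ereal 0) at_top" by simp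
  qed simp
  finally have "Limsup at_top (\<lambda>K. limsup (\<lambda>N. ereal (M K N))) \<le> 0" by (simp add: zero_ereal_def)
  moreover have "0 \<le> limsup (\<lambda>N. ereal (M K N))" for K
    by (intro le_Limsup) (auto simp: M_def)
  then have "0 \<le> Limsup at_top (\<lambda>K. limsup (\<lambda>N. ereal (M K N)))"
    by (intro le_Limsup) auto
  ultimately show ?thesis
    unfolding mple_consistent_def M_def by (rule antisym)
qed

theorem theorem3p3:
  fixes G :: "nat \<Rightarrow> nat set set" and W :: "real \<Rightarrow> real \<Rightarrow> real"
    and J :: "nat \<Rightarrow> nat \<Rightarrow> nat \<Rightarrow> real"
  assumes "\<And>N. N \<ge> 1 \<Longrightarrow> simple_graph {1..N} (G N)"
    and "graphon W"
    and "converges_to_graphon G W"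
    and "(LINT (x, y) | lebesgue_on ({0..1} \<times> {0..1}). W x y) > 0"
    and "\<And>N i j. J N i j = 1 / real N * adjacency (G N) i j"
  shows "(\<forall>\<beta>\<^sub>1 \<beta>\<^sub>2. 0 \<le> \<beta>\<^sub>1 \<and> \<beta>\<^sub>1 < \<beta>\<^sub>2 \<and> \<beta>\<^sub>2 < 1 / graphon_norm W \<longrightarrow>
            \<not> (\<exists>\<phi>. consistent_tests J \<beta>\<^sub>1 \<beta>\<^sub>2 \<phi>)) \<and>
         (\<forall>\<beta>\<^sub>0. \<beta>\<^sub>0 > 1 / graphon_norm W \<longrightarrow> mple_consistent (\<lambda>N. sqrt (real N)) J \<beta>\<^sub>0)"
proof -

  \<comment> \<open>From graph convergence to path densities\<close>
  obtain U where U: "unit_kernel U" and sym: "\<And>x y. U x y = U y x"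
    and ae: "AE (x, y) in unit_lborel \<Otimes>\<^sub>M unit_lborel. W x y = U x y"
    and int: "(LINT (x, y) | lebesgue_on ({0..1} \<times> {0..1}). W x y) = path_density U 1"
    by (rule graphon_borel_version[OF assms(2)]) (rule that)
  define g where "g = graphon_norm W"
  have g: "g > 0" unfolding g_def by (rule graphon_norm_pos[OF U ae]) (use assms(4) int in simp)
  let ?p = "path_density U"
  have coupling: "graph_coupling N (J N)" if "N \<ge> 1" for N
    using graph_coupling_adjacency[OF assms(1)[OF that] that assms(5)] .
  have p: "(\<lambda>N. walk_mean N (J N) n) \<longlonglongrightarrow> ?p n" for n
  proof -
    have "(\<lambda>N. hom_density {..n} (path_edges n) (graph_kernel N (G N))) \<longlonglongrightarrow> hom_density {..n} (path_edges n) W"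
      using assms(3) simple_graph_path unfolding converges_to_graphon_def by blast
    moreover have "hom_density {..n} (path_edges n) (graph_kernel N E) = path_density (graph_kernel N E) n" for N E
      by (rule hom_density_path[OF unit_kernel_graph_kernel]) simp
    ultimately have "(\<lambda>N. path_density (graph_kernel N (G N)) n) \<longlonglongrightarrow> ?p n"
      by (simp only: hom_density_path[OF U ae])
    moreover have "eventually (\<lambda>N. path_density (graph_kernel N (G N)) n = walk_mean N (J N) n) sequentially"
      using eventually_ge_at_top[of 1]
      by eventually_elim (rule path_density_graph_kernel[OF _ assms(5)])
    ultimately show ?thesis by (rule Lim_transform_eventually)
  qed

  \<comment> \<open>Impossibility of testing below the threshold\<close>
  have "\<not> consistent_tests J \<beta>\<^sub>1 \<beta>\<^sub>2 \<phi>" if b: "0 \<le> \<beta>\<^sub>1" "\<beta>\<^sub>1 < \<beta>\<^sub>2" "\<beta>\<^sub>2 < 1 / g" for \<beta>\<^sub>1 \<beta>\<^sub>2 \<phi>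
  proof -
    \<comment> \<open>A third parameter, still below the threshold, supplies the exponential moment
      for the tail of the likelihood ratio.\<close>
    obtain \<beta>\<^sub>3 where b3: "\<beta>\<^sub>2 < \<beta>\<^sub>3" "\<beta>\<^sub>3 < 1 / g" using dense[OF b(3)] by blast
    have b30: "0 < \<beta>\<^sub>3" using b b3 by linarith
    have bg: "0 \<le> \<beta>\<^sub>3 * g" "\<beta>\<^sub>3 * g < 1" using b30 b3 g by (auto simp: pos_less_divide_eq)
    \<comment> \<open>Since \<open>\<beta>\<^sub>3 * g < 1\<close>, some \<open>m\<close> brings the
      truncation error of the Neumann series below \<open>1 / 2\<close>, the value used for
      \<open>q\<close>.\<close>
    have "(\<lambda>m. \<beta>\<^sub>3 * (\<beta>\<^sub>3 * g) ^ m) \<longlonglongrightarrow> \<beta>\<^sub>3 * 0"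
      by (intro tendsto_intros LIMSEQ_realpow_zero bg)
    then have "eventually (\<lambda>m. \<beta>\<^sub>3 * (\<beta>\<^sub>3 * g) ^ m < 1 / 2) sequentially"
      by (rule order_tendstoD) simp
    then obtain m where m: "\<beta>\<^sub>3 * (\<beta>\<^sub>3 * g) ^ m < 1 / 2"
      using eventually_happens'[OF sequentially_bot] by blast
    have "\<beta>\<^sub>3 ^ Suc m * ?p m \<le> \<beta>\<^sub>3 ^ Suc m * g ^ m"
      using path_density_le_norm_power[OF U ae, of m] g b30 by (intro mult_left_mono) (auto simp: g_def)
    also have "\<dots> < 1 / 2" using m by (simp add: power_mult_distrib)
    finally have lim: "\<beta>\<^sub>3 ^ Suc m * ?p m < 1 / 2" .
    define C where "C = exp (\<beta>\<^sub>3\<^sup>2 / 2 * (1 / (1 - 1 / 2) * (\<Sum>n\<le>m. \<beta>\<^sub>3 ^ n)))"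
    have "(\<lambda>N. \<beta>\<^sub>3 ^ Suc m * walk_mean N (J N) m) \<longlonglongrightarrow> \<beta>\<^sub>3 ^ Suc m * ?p m"
      by (intro tendsto_intros p)
    then have "eventually (\<lambda>N. \<beta>\<^sub>3 ^ Suc m * walk_mean N (J N) m < 1 / 2) sequentially"
      using lim by (rule order_tendstoD)
    then have "eventually (\<lambda>N. graph_coupling N (J N) \<and> partition_sum N (J N) \<beta>\<^sub>1 \<le> 2 ^ N * C \<and>
      partition_sum N (J N) \<beta>\<^sub>3 \<le> 2 ^ N * C) sequentially"
      using eventually_ge_at_top[of 1]
    proof eventually_elim
      case (elim N)
      have J: "graph_coupling N (J N)" using coupling elim(2) .
      \<comment> \<open>Hypothesis and bound are both monotone in the parameter, so the
        \<open>m\<close> and \<open>C\<close> chosen at \<open>\<beta>\<^sub>3\<close> serve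
        \<open>\<beta>\<^sub>1\<close> as well.\<close>
      have "partition_sum N (J N) \<beta> \<le> 2 ^ N * C" if bb: "0 \<le> \<beta>" "\<beta> \<le> \<beta>\<^sub>3" for \<beta>
      proof -
        have "\<beta> ^ Suc m * walk_mean N (J N) m \<le> \<beta>\<^sub>3 ^ Suc m * walk_mean N (J N) m"
          using bb walk_mean_nonneg[OF J] by (intro mult_right_mono power_mono)
        also have "\<dots> \<le> 1 / 2" using elim(1) by simp
        finally have "partition_sum N (J N) \<beta> \<le> 2 ^ N * exp (\<beta>\<^sup>2 / 2 * (1 / (1 - 1 / 2) * (\<Sum>n\<le>m. \<beta> ^ n)))"
          by (intro partition_sum_bounded[OF J bb(1)]) auto
        also have "\<dots> \<le> 2 ^ N * C"
          unfolding C_def using bb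
          by (intro mult_left_mono, subst exp_le_cancel_iff)
            (auto intro!: mult_mono divide_right_mono sum_mono power_mono sum_nonneg)
        finally show ?thesis .
      qed
      then show ?case using J b b3 by auto
    qed
    then show ?thesis
      by (intro no_consistent_tests_of_bounded_partition[OF b(2) b3(1)]) (auto simp: C_def)
  qed

  \<comment> \<open>Linear growth of the log-partition function above the threshold\<close>
  moreover have "mple_consistent (\<lambda>N. sqrt (real N)) J \<beta>" if bg: "\<beta> > 1 / g" for \<beta>
  proof -
    have b: "\<beta> > 0" using bg g by (meson less_trans zero_less_divide_1_iff)
    have "1 / \<beta> < g" using bg b g by (simp add: divide_less_eq mult.commute)
    then obtain l where l: "1 / \<beta> < l" "l < g" using dense by blast
    have l0: "0 < l" using l b by (meson less_trans zero_less_divide_1_iff)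
    have bl: "1 < \<beta> * l" using l b by (simp add: divide_less_eq mult.commute)
    define q where "q n = \<beta> ^ n * ?p n" for n
    have p0: "0 \<le> ?p n" for n
      by (rule LIMSEQ_le_const[OF p]) (use coupling walk_mean_nonneg in blast)
    \<comment> \<open>Otherwise the sums of consecutive pairs would never increase, hence stay
      bounded, whereas \<open>q (2 * k)\<close> is at least
      \<open>l\<^sup>2 * (\<beta> * l) ^ (2 * k)\<close> with \<open>\<beta> * l > 1\<close>. Pairs
      are needed because the lower bound concerns even indices only.\<close>
    have "\<exists>k. q (2 * k) + q (2 * k + 1) < q (2 * k + 2) + q (2 * k + 3)"
    proof (rule ccontr)
      assume "\<nexists>k. q (2 * k) + q (2 * k + 1) < q (2 * k + 2) + q (2 * k + 3)"
      then have step: "q (2 * k + 2) + q (2 * k + 3) \<le> q (2 * k) + q (2 * k + 1)" for k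
        by (auto simp: not_less)
      have bounded: "q (2 * k) + q (2 * k + 1) \<le> q 0 + q 1" for k
      proof (induction k)
        case (Suc k)
        then show ?case using step[of k] by (simp add: eval_nat_numeral)
      qed simp
      have "l\<^sup>2 * ((\<beta> * l)\<^sup>2) ^ k \<le> q 0 + q 1" for k
      proof -
        have "l\<^sup>2 * ((\<beta> * l)\<^sup>2) ^ k = \<beta> ^ (2 * k) * l ^ (2 * k + 2)"
          by (simp only: power_mult_distrib power_mult[symmetric] power_add mult_ac)
        also have "\<dots> \<le> q (2 * k)"
          unfolding q_def using path_density_ge_norm_power[OF U sym ae, of l k] l l0 b
          by (intro mult_left_mono) (auto simp: g_def)
        also have "\<dots> \<le> q 0 + q 1"
        proof -
          have "0 \<le> q (2 * k + 1)" unfolding q_def using p0 b by (intro mult_nonneg_nonneg) auto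
          then show ?thesis using bounded[of k] by linarith
        qed
        finally show ?thesis .
      qed
      moreover have "1 < (\<beta> * l)\<^sup>2" using bl by (simp add: one_less_power)
      then obtain k where "(q 0 + q 1) / l\<^sup>2 < ((\<beta> * l)\<^sup>2) ^ k" using real_arch_pow by blast
      then have "q 0 + q 1 < l\<^sup>2 * ((\<beta> * l)\<^sup>2) ^ k" using l0 by (simp add: pos_divide_less_eq mult.commute)
      ultimately show False by (simp add: not_le[symmetric])
    qed
    then obtain k where k: "q (2 * k) + q (2 * k + 1) < q (2 * k + 2) + q (2 * k + 3)" ..
    \<comment> \<open>Half of the limiting gain, so that the gain at finite \<open>N\<close>
      eventually exceeds \<open>D\<close>.\<close>
    define D where "D = (q (2 * k + 3) + q (2 * k + 2) - q (2 * k + 1) - q (2 * k)) / 2"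
    have D: "D > 0" using k by (simp add: D_def)
    define B where "B = \<beta> ^ k + \<beta> ^ Suc k"
    have B: "B > 0" using b by (simp add: B_def add_pos_pos)
    \<comment> \<open>A single small \<open>\<epsilon>\<close> must keep the trial magnetisation
      below 1 and the quartic entropy term below half of the quadratic gain; both follow once the
      sum of the two quantities is small.\<close>
    have "((\<lambda>\<epsilon>. (\<epsilon> * B) + \<epsilon>\<^sup>2 * B ^ 4 / 3) \<longlongrightarrow> 0 * B + 0\<^sup>2 * B ^ 4 / 3) (at_right 0)"
      by (intro tendsto_intros) auto
    then have "eventually (\<lambda>\<epsilon>. \<epsilon> * B + \<epsilon>\<^sup>2 * B ^ 4 / 3 < min 1 (D / 4)) (at_right 0)"
      using D by (intro order_tendstoD) auto
    then have "eventually (\<lambda>\<epsilon>. 0 < \<epsilon> \<and> \<epsilon> * B + \<epsilon>\<^sup>2 * B ^ 4 / 3 < min 1 (D / 4)) (at_right 0)"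
      using eventually_at_right_less[of 0] by eventually_elim auto
    then obtain \<epsilon> where e: "0 < \<epsilon>" "\<epsilon> * B + \<epsilon>\<^sup>2 * B ^ 4 / 3 < min 1 (D / 4)"
      using eventually_happens'[OF trivial_limit_at_right_real] by blast
    have pos: "0 < \<epsilon> * B" "0 \<le> \<epsilon>\<^sup>2 * B ^ 4 / 3" using e(1) B by auto
    have e1: "\<epsilon> * B < 1" and e2: "\<epsilon>\<^sup>2 * B ^ 4 / 3 \<le> D / 4"
      using e(2) pos by linarith+
    have rate: "\<epsilon>\<^sup>2 * D / 4 \<le> \<epsilon>\<^sup>2 / 2 * D - (\<epsilon> * B) ^ 4 / 3"
    proof -
      have "(\<epsilon> * B) ^ 4 / 3 = \<epsilon>\<^sup>2 * (\<epsilon>\<^sup>2 * B ^ 4 / 3)" by (simp add: power_mult_distrib eval_nat_numeral)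
      also have "\<dots> \<le> \<epsilon>\<^sup>2 * (D / 4)" by (intro mult_left_mono e2) simp
      finally show ?thesis by (simp add: algebra_simps)
    qed
    let ?D = "\<lambda>N. \<beta> ^ (2 * k + 3) * walk_mean N (J N) (2 * k + 3) + \<beta> ^ (2 * k + 2) * walk_mean N (J N) (2 * k + 2)
      - \<beta> ^ (2 * k + 1) * walk_mean N (J N) (2 * k + 1) - \<beta> ^ (2 * k) * walk_mean N (J N) (2 * k)"
    have "?D \<longlonglongrightarrow> \<beta> ^ (2 * k + 3) * ?p (2 * k + 3) + \<beta> ^ (2 * k + 2) * ?p (2 * k + 2)
      - \<beta> ^ (2 * k + 1) * ?p (2 * k + 1) - \<beta> ^ (2 * k) * ?p (2 * k)" (is "_ \<longlonglongrightarrow> ?d")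
      by (intro tendsto_intros p)
    moreover have "2 * D = ?d"
    proof -
      have "2 * (x / 2) = x" for x :: real by simp
      then have "2 * D = q (2 * k + 3) + q (2 * k + 2) - q (2 * k + 1) - q (2 * k)" unfolding D_def .
      then show ?thesis by (simp only: q_def)
    qed
    ultimately have "?D \<longlonglongrightarrow> 2 * D" by (simp only:)
    then have "eventually (\<lambda>N. D < ?D N) sequentially"
      using D by (intro order_tendstoD) auto
    then have "eventually (\<lambda>N. graph_coupling N (J N) \<and> 2 ^ N * exp (\<epsilon>\<^sup>2 * D / 4 * real N) \<le> partition_sum N (J N) \<beta>) sequentially"
      using eventually_ge_at_top[of 1]
    proof eventually_elim
      case (elim N)
      have J: "graph_coupling N (J N)" using coupling elim(2) .
      have "real N * (\<epsilon>\<^sup>2 * D / 4) \<le> real N * (\<epsilon>\<^sup>2 / 2 * D - (\<epsilon> * B) ^ 4 / 3)"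
        by (intro mult_left_mono rate) simp
      then have "2 ^ N * exp (\<epsilon>\<^sup>2 * D / 4 * real N) \<le> 2 ^ N * exp (real N * (\<epsilon>\<^sup>2 / 2 * D - (\<epsilon> * B) ^ 4 / 3))"
        by (simp add: mult.commute)
      also have "\<dots> \<le> partition_sum N (J N) \<beta>"
        unfolding B_def using e(1) e1 b elim(1)
        by (intro partition_sum_ge_walks[OF J]) (auto simp: B_def)
      finally show ?case using J by simp
    qed
    then show ?thesis
      using e(1) D by (intro mple_consistent_of_linear_growth[OF b, of "\<epsilon>\<^sup>2 * D / 4"]) auto
  qed
  ultimately show ?thesis unfolding g_def by blast
qed

end
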